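(* Let $n\geq 7$ and let $G$ be the graph obtained from the complete graph $K_n$ by a $\Delta Y$-move on some $3$-cycle of $K_n$. Then $\mathrm{cr}(G)<\mathrm{cr}(K_n)$.
   Context: A drawing of a graph is a continuous map from the graph (viewed as a topological 1-complex) to the plane $\mathbb{R}^2$ whose only multiple points are finitely many transversal double points (crossings), none at images of vertices. The crossing number $\mathrm{cr}(G)$ of a graph $G$ is the minimum number of crossings over all drawings of $G$. A $\Delta Y$-move on a $3$-cycle with vertices $v_1,v_2,v_3$ of a graph removes the three edges $v_1v_2$, $v_2v_3$, $v_3v_1$, adds a new vertex $v$, and adds the three edges $vv_1$, $vv_2$, $vv_3$. *)

theory Defs
  imports "HOL-Analysis.Analysis" "HOL-Library.Ramsey" "HOL-Library.Extended_Nat"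
begin

text \<open>A simple graph is a pair \<open>(V, E)\<close> of a vertex set and a set of two-element subsets of it.\<close>

type_synonym 'a ugraph = "'a set \<times> 'a set set"

definition complete_graph :: "'a set \<Rightarrow> 'a ugraph" where
  "complete_graph V = (V, nsets V 2)"

definition delta_Y_move :: "'a ugraph \<Rightarrow> 'a ugraph \<Rightarrow> bool" where
  "delta_Y_move G H \<longleftrightarrow>
    (\<exists>v1 v2 v3 v.
      distinct [v1, v2, v3] \<and> {v1, v2, v3} \<subseteq> fst G \<and>
      {{v1, v2}, {v2, v3}, {v3, v1}} \<subseteq> snd G \<and>
      v \<notin> fst G \<and>
      H = (insert v (fst G),
           (snd G - {{v1, v2}, {v2, v3}, {v3, v1}}) \<union> {{v, v1}, {v, v2}, {v, v3}}))"

text \<open>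
  The points of a graph viewed as a topological 1-complex: the vertices, together with the points
  \<open>Inner e t\<close>, \<open>0 < t < 1\<close>, in the interior of each edge \<open>e\<close>. A continuous map from the complex to
  the plane (here: the type of complex numbers) is given by the images \<open>p v\<close> of the vertices and a
  path \<open>\<gamma> e\<close> for each edge that joins the images of its two ends.
\<close>

datatype 'a complex_point = Vertex 'a | Inner "'a set" real

definition complex_points :: "'a ugraph \<Rightarrow> 'a complex_point set" where
  "complex_points G = Vertex ` fst G \<union> {Inner e t | e t. e \<in> snd G \<and> 0 < t \<and> t < 1}"

fun place :: "('a \<Rightarrow> complex) \<Rightarrow> ('a set \<Rightarrow> real \<Rightarrow> complex) \<Rightarrow> 'a complex_point \<Rightarrow> complex" where
  "place p \<gamma> (Vertex v) = p v"
| "place p \<gamma> (Inner e t) = \<gamma> e t"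

definition fibre ::
  "'a ugraph \<Rightarrow> ('a \<Rightarrow> complex) \<Rightarrow> ('a set \<Rightarrow> real \<Rightarrow> complex) \<Rightarrow> complex \<Rightarrow> 'a complex_point set" where
  "fibre G p \<gamma> z = {x \<in> complex_points G. place p \<gamma> x = z}"

definition multiple_points ::
  "'a ugraph \<Rightarrow> ('a \<Rightarrow> complex) \<Rightarrow> ('a set \<Rightarrow> real \<Rightarrow> complex) \<Rightarrow> complex set" where
  "multiple_points G p \<gamma> = {z. \<exists>x\<in>fibre G p \<gamma> z. \<exists>y\<in>fibre G p \<gamma> z. x \<noteq> y}"

text \<open>
  Transversality of continuous curves: a homeomorphism from a neighbourhood of the common point
  onto the open unit disc straightens the two local strands to the horizontal and the vertical
  diameter.
\<close>

definition transversal_at ::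
  "(real \<Rightarrow> complex) \<Rightarrow> real \<Rightarrow> (real \<Rightarrow> complex) \<Rightarrow> real \<Rightarrow> bool" where
  "transversal_at g s h t \<longleftrightarrow>
    g s = h t \<and>
    (\<exists>U \<phi> \<psi> a b c d.
      open U \<and> homeomorphism U (ball 0 1) \<phi> \<psi> \<and> g s \<in> U \<and> \<phi> (g s) = 0 \<and>
      0 \<le> a \<and> a < s \<and> s < b \<and> b \<le> 1 \<and>
      0 \<le> c \<and> c < t \<and> t < d \<and> d \<le> 1 \<and>
      g ` {a<..<b} \<subseteq> U \<and> \<phi> ` g ` {a<..<b} = {w \<in> ball 0 1. Im w = 0} \<and>
      h ` {c<..<d} \<subseteq> U \<and> \<phi> ` h ` {c<..<d} = {w \<in> ball 0 1. Re w = 0})"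

text \<open>Since its fibre consists of inner points of edges, a crossing is never the image of a vertex.\<close>

definition transversal_double_point ::
  "'a ugraph \<Rightarrow> ('a \<Rightarrow> complex) \<Rightarrow> ('a set \<Rightarrow> real \<Rightarrow> complex) \<Rightarrow> complex \<Rightarrow> bool" where
  "transversal_double_point G p \<gamma> z \<longleftrightarrow>
    (\<exists>e s f t. Inner e s \<noteq> Inner f t \<and> fibre G p \<gamma> z = {Inner e s, Inner f t} \<and>
      transversal_at (\<gamma> e) s (\<gamma> f) t)"

definition drawing ::
  "'a ugraph \<Rightarrow> ('a \<Rightarrow> complex) \<Rightarrow> ('a set \<Rightarrow> real \<Rightarrow> complex) \<Rightarrow> bool" where
  "drawing G p \<gamma> \<longleftrightarrow>
    (\<forall>e\<in>snd G. path (\<gamma> e) \<and>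
      (\<exists>u v. e = {u, v} \<and> pathstart (\<gamma> e) = p u \<and> pathfinish (\<gamma> e) = p v)) \<and>
    finite (multiple_points G p \<gamma>) \<and>
    (\<forall>z\<in>multiple_points G p \<gamma>. transversal_double_point G p \<gamma> z)"

text \<open>
  Extended natural numbers make the infimum over an empty set infinite; over a nonempty set the
  infimum is attained, i.e. it is the minimum.
\<close>

definition crossing_number :: "'a ugraph \<Rightarrow> enat" where
  "crossing_number G = Inf {enat (card (multiple_points G p \<gamma>)) | p \<gamma>. drawing G p \<gamma>}"

end

theory Submission
  imports Defs
begin

text \<open>
  Fix a drawing of the complete graph on \<open>n\<close> vertices with the fewest crossings. Near a vertex \<open>v0\<close>, replace
  the edges at \<open>v0\<close> by straight radii up to their last exit from a small disc. If \<open>k\<close> radii lie in a sector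
  between those to \<open>a\<close> and \<open>b\<close>, put the new vertex into this sector and join it to \<open>v0\<close> and, along the old
  edges, to \<open>a\<close> and \<open>b\<close>. This creates \<open>k\<close> crossings and removes the \<open>c(ab)\<close> crossings on the edge \<open>ab\<close>. Since
  all triangles are equivalent, a counterexample satisfies \<open>c(ab) \<le> k\<close> for all \<open>v0, a, b\<close> and both sectors,
  and summing over \<open>v0, a, b\<close> bounds the number of crossings from above.

  On the other hand, in every drawing of the complete graph on five vertices two disjoint edges cross, so there
  are at least \<open>(n choose 5) / (n - 4)\<close> crossings of disjoint edges. For \<open>n \<ge> 9\<close> this exceeds the upper bound.
  For \<open>n = 7\<close> and \<open>n = 8\<close> the upper bound is improved: an edge has at most two crossings, every vertex lies on
  three uncrossed edges and on at most \<open>n - 6\<close> edges with two crossings; for \<open>n = 7\<close> the edges with two crossings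
  form a matching, which misses a vertex.
\<close>

section \<open>Van Kampen's theorem for five vertices\<close>

text \<open>The obstacle is that edges are merely continuous: one may reenter every disc around its
  end infinitely often, so no cyclic order of the edges at a vertex is given in advance, and edges
  may cross themselves or adjacent edges. The last exits supply the order: all crossings keep away
  from a small disc, so the exit points are distinct. The drawing need not be normalised, since the
  bound on \<open>c(ab)\<close> covers all crossings on \<open>ab\<close>, while the lower bound
  counts only those of disjoint edges.

  For fixed \<open>v0\<close> and \<open>a\<close>, the sectors from \<open>a\<close> to the other
  ends \<open>b\<close> contain 0, 1, ..., n - 3 edges, each number once, and the complementary
  sectors contain the rest. So \<open>c(ab)\<close> is at most min(j, n - 3 - j) with every j
  occurring once, a sum of at most (n - 3)^2 / 4.

  The number of crossings of disjoint edges is thus at least n(n-1)(n-2)(n-3) / 120 and at most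
  n(n-1)(n-3)^2 / (16(n-2)). These contradict each other if 2(n-2)^2 > 15(n-3), which holds for n =
  9 (98 > 90) and beyond, but just fails for n = 8 (72 < 75).\<close>

definition log_change :: "(real \<Rightarrow> complex) \<Rightarrow> complex" where
  "log_change h = (SOME d. \<exists>l. continuous_on {0..1} l \<and> (\<forall>t\<in>{0..1}. h t = exp (l t)) \<and> d = l 1 - l 0)"

text \<open>Two logarithms of \<open>h\<close> differ by a continuous function with values in 2 pi i
  Z, hence by a constant. So the choice made by \<open>SOME\<close> does not matter; the imaginary
  part of \<open>log_change h\<close> is the total turn of \<open>h\<close> around 0.\<close>

lemma log_change_eq:
  assumes l: "continuous_on {0..1} l" "\<And>t. t \<in> {0..1} \<Longrightarrow> h t = exp (l t)"
  shows "log_change h = l 1 - l 0"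
proof -
  have "\<exists>l'. continuous_on {0..1} l' \<and> (\<forall>t\<in>{0..1}. h t = exp (l' t)) \<and> log_change h = l' 1 - l' 0"
    unfolding log_change_def by (rule someI_ex) (use l in blast)
  then obtain l' where l': "continuous_on {0..1} l'" "\<And>t. t \<in> {0..1} \<Longrightarrow> h t = exp (l' t)"
    and eq: "log_change h = l' 1 - l' 0" by blast
  have "(\<lambda>t. l t - l' t) constant_on {0..1}"
  proof (rule continuous_discrete_range_constant)
    show "connected {0..1::real}" by simp
    show "continuous_on {0..1} (\<lambda>t. l t - l' t)"
      using l(1) l'(1) by (intro continuous_intros)
    fix x :: real assume x: "x \<in> {0..1}"
    show "\<exists>e>0. \<forall>y. y \<in> {0..1} \<and> l y - l' y \<noteq> l x - l' x \<longrightarrow> e \<le> norm ((l y - l' y) - (l x - l' x))"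
    proof (intro exI[of _ "2*pi"] conjI allI impI)
      fix y assume y: "y \<in> {0..1} \<and> l y - l' y \<noteq> l x - l' x"
      have "exp (l y) = exp (l' y)" "exp (l x) = exp (l' x)" using l(2) l'(2) x y by metis+
      then obtain m n :: int where "l y = l' y + (of_int (2*m) * pi) * \<i>" "l x = l' x + (of_int (2*n) * pi) * \<i>"
        unfolding exp_eq by blast
      then have d: "(l y - l' y) - (l x - l' x) = complex_of_real (2 * pi * of_int (m - n)) * \<i>"
        by (simp add: algebra_simps)
      have "m \<noteq> n" using y d by auto
      then have "1 \<le> \<bar>real_of_int (m - n)\<bar>" by linarith
      then show "2*pi \<le> norm ((l y - l' y) - (l x - l' x))"
        unfolding d norm_mult norm_of_real by (simp add: abs_mult)
    qed simp
  qed
  then have "l 1 - l' 1 = l 0 - l' 0"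
    unfolding constant_on_def by (metis atLeastAtMost_iff order_refl zero_le_one)
  then show ?thesis using eq by algebra
qed

lemma exp_log_change:
  assumes "continuous_on {0..1} h" "\<And>t. t \<in> {0..1} \<Longrightarrow> h t \<noteq> 0"
  shows "exp (log_change h) = h 1 / h 0"
proof -
  obtain l where l: "continuous_on {0..1} l" "\<And>t. t \<in> {0..1} \<Longrightarrow> h t = exp (l t)"
    using continuous_logarithm_on_contractible[OF assms(1) convex_imp_contractible] assms(2) 
    by (metis convex_real_interval(5))
  then show ?thesis
    using log_change_eq[OF l] by (simp add: exp_diff)
qed

lemma log_change_uminus:
  assumes "continuous_on {0..1} h" "\<And>t. t \<in> {0..1} \<Longrightarrow> h t \<noteq> 0"
  shows "log_change (\<lambda>t. - h t) = log_change h"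
proof -
  obtain l where l: "continuous_on {0..1} l" "\<And>t. t \<in> {0..1} \<Longrightarrow> h t = exp (l t)"
    using continuous_logarithm_on_contractible[OF assms(1) convex_imp_contractible] assms(2) 
    by (metis convex_real_interval(5))
  have "log_change (\<lambda>t. - h t) = (l 1 + \<i> * pi) - (l 0 + \<i> * pi)"
    by (rule log_change_eq) (use l in \<open>auto intro!: continuous_intros simp: exp_add\<close>)
  then show ?thesis using log_change_eq[OF l] by simp
qed

lemma log_change_reverse:
  assumes "continuous_on {0..1} h" "\<And>t. t \<in> {0..1} \<Longrightarrow> h t \<noteq> 0"
  shows "log_change (\<lambda>t. h (1 - t)) = - log_change h"
proof -
  obtain l where l: "continuous_on {0..1} l" "\<And>t. t \<in> {0..1} \<Longrightarrow> h t = exp (l t)"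
    using continuous_logarithm_on_contractible[OF assms(1) convex_imp_contractible] assms(2) 
    by (metis convex_real_interval(5))
  have "log_change (\<lambda>t. h (1 - t)) = (\<lambda>t. l (1 - t)) 1 - (\<lambda>t. l (1 - t)) 0"
    by (rule log_change_eq)
      (use l in \<open>auto intro!: continuous_intros continuous_on_compose2[of "{0..1}" l]\<close>)
  then show ?thesis using log_change_eq[OF l] by simp
qed

text \<open>The difference \<open>g s - h t\<close> has no zero on the unit square, which is
  contractible, so it has a logarithm there. Both sides are the same alternating sum of this
  logarithm over the four corners.\<close>

lemma log_change_square:
  assumes g: "path g" and h: "path h"
    and ne: "\<And>s t. s \<in> {0..1} \<Longrightarrow> t \<in> {0..1} \<Longrightarrow> g s \<noteq> h t"
  shows "log_change (\<lambda>s. g s - h 0) - log_change (\<lambda>s. g s - h 1)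
       = log_change (\<lambda>t. h t - g 0) - log_change (\<lambda>t. h t - g 1)"
proof -
  let ?Q = "{0..1::real} \<times> {0..1::real}"
  have g': "continuous_on {0..1} g" and h': "continuous_on {0..1} h"
    using g h by (auto simp: path_def)
  have "continuous_on ?Q (\<lambda>z. g (fst z) - h (snd z))"
    by (intro continuous_intros continuous_on_compose2[OF g'] continuous_on_compose2[OF h']) auto
  moreover have "contractible ?Q"
    by (intro convex_imp_contractible convex_Times) auto
  ultimately obtain l where l: "continuous_on ?Q l" "\<And>z. z \<in> ?Q \<Longrightarrow> g (fst z) - h (snd z) = exp (l z)"
    by (rule continuous_logarithm_on_contractible) (use ne in auto)
  have row: "log_change (\<lambda>s. g s - h t) = l (1,t) - l (0,t)" if "t \<in> {0..1}" for t
  proof (rule log_change_eq)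
    show "continuous_on {0..1} (\<lambda>s. l (s, t))"
      by (rule continuous_on_compose2[OF l(1)]) (use that in \<open>auto intro!: continuous_intros\<close>)
  qed (use l(2) that in auto)
  have col: "log_change (\<lambda>t. h t - g s) = l (s,1) - l (s,0)" if "s \<in> {0..1}" for s
  proof -
    have "log_change (\<lambda>t. h t - g s) = log_change (\<lambda>t. - (h t - g s))"
      by (rule log_change_uminus[symmetric]) (use h' ne that in \<open>force intro!: continuous_intros\<close>)+
    also have "\<dots> = l (s,1) - l (s,0)"
    proof (rule log_change_eq)
      show "continuous_on {0..1} (\<lambda>t. l (s, t))"
        by (rule continuous_on_compose2[OF l(1)]) (use that in \<open>auto intro!: continuous_intros\<close>)
      show "- (h t - g s) = exp (l (s, t))" if "t \<in> {0..1}" for t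
        using l(2)[of "(s,t)"] that \<open>s \<in> _\<close> by auto
    qed
    finally show ?thesis .
  qed
  show ?thesis
    using row[of 0] row[of 1] col[of 0] col[of 1] by simp
qed

text \<open>
  For a path from \<open>a\<close> to \<open>b\<close> and a
  vertex \<open>c\<close>, let \<open>A(ab;c)\<close> be the change of \<open>log (g - p c)\<close>, so that
  \<open>W(abc;d) = A(ab;d) + A(bc;d) + A(ca;d)\<close> measures the winding number of a triangle. If disjoint
  edges never meet, then \<open>W(abc;d) = W(abc;e)\<close>, so \<open>W(abc;d) - W(abd;c) + W(acd;b) - W(bcd;a) = 0\<close>.
  But this sum is \<open>2 B\<close> with \<open>exp B = -1\<close>.
\<close>

lemma van_Kampen_K5:
  fixes p :: "'a \<Rightarrow> complex" and g :: "'a \<Rightarrow> 'a \<Rightarrow> real \<Rightarrow> complex"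
  assumes S: "distinct [a,b,c,d,e]" "S = {a,b,c,d,e}"
    and g: "\<And>u v. u \<in> S \<Longrightarrow> v \<in> S \<Longrightarrow> u \<noteq> v \<Longrightarrow> path (g u v)"
      "\<And>u v. u \<in> S \<Longrightarrow> v \<in> S \<Longrightarrow> u \<noteq> v \<Longrightarrow> g u v 0 = p u"
      "\<And>u v. u \<in> S \<Longrightarrow> v \<in> S \<Longrightarrow> u \<noteq> v \<Longrightarrow> g u v 1 = p v"
      "\<And>u v t. u \<in> S \<Longrightarrow> v \<in> S \<Longrightarrow> u \<noteq> v \<Longrightarrow> g v u t = g u v (1 - t)"
    and disj: "\<And>u v w x s t. {u,v,w,x} \<subseteq> S \<Longrightarrow> distinct [u,v,w,x] \<Longrightarrow>
      s \<in> {0..1} \<Longrightarrow> t \<in> {0..1} \<Longrightarrow> g u v s \<noteq> g w x t"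
  shows False
proof -
  define A where "A u v w = log_change (\<lambda>t. g u v t - p w)" for u v w
  have cont: "continuous_on {0..1} (\<lambda>t. g u v t - p w)" if "u \<in> S" "v \<in> S" "u \<noteq> v" for u v w
    using g(1)[OF that] by (auto simp: path_def intro!: continuous_intros)
  have nz: "g u v t - p w \<noteq> 0" if uvw: "{u,v,w} \<subseteq> S" "distinct [u,v,w]" and t: "t \<in> {0..1}" for u v w t
  proof -
    \<comment> \<open>\<open>disj\<close> speaks only of disjoint edges; a fourth vertex
      \<open>x\<close> makes \<open>p w\<close> the start of an edge disjoint from
      \<open>uv\<close>.\<close>
    obtain x where x: "x \<in> S" "x \<notin> {u,v,w}"
    proof -
      have "card {u,v,w} < card S" using S uvw by simp
      then show ?thesis using that by (meson card_mono finite.intros not_less subsetI)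
    qed
    have "g w x 0 = p w" using g(2) uvw x by auto
    then show ?thesis using disj[of u v w x t 0] uvw x t by auto
  qed
  have expA: "exp (A u v w) = (p v - p w) / (p u - p w)" if uvw: "{u,v,w} \<subseteq> S" "distinct [u,v,w]" for u v w
    unfolding A_def using exp_log_change[OF cont nz, of u v w] g(2,3) uvw by auto
  have revA: "A v u w = - A u v w" if uvw: "{u,v,w} \<subseteq> S" "distinct [u,v,w]" for u v w
  proof -
    have "A v u w = log_change (\<lambda>t. g u v (1 - t) - p w)"
      unfolding A_def using g(4)[of u v] uvw by auto
    also have "\<dots> = - A u v w"
      unfolding A_def using log_change_reverse[OF cont nz, of u v w] uvw by auto
    finally show ?thesis .
  qed
  have sq: "A u v w - A u v x = A w x u - A w x v" if ux: "{u,v,w,x} \<subseteq> S" "distinct [u,v,w,x]" for u v w x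
  proof -
    have "path (g u v)" "path (g w x)" using g(1) ux by auto
    from log_change_square[OF this disj[OF ux]]
    have "log_change (\<lambda>s. g u v s - g w x 0) - log_change (\<lambda>s. g u v s - g w x 1)
       = log_change (\<lambda>t. g w x t - g u v 0) - log_change (\<lambda>t. g w x t - g u v 1)" .
    moreover have "g u v 0 = p u" "g u v 1 = p v" "g w x 0 = p w" "g w x 1 = p x"
      using g(2,3) ux by auto
    ultimately show ?thesis unfolding A_def by (simp only:)
  qed
  have tri: "A u v w + A v x w + A x u w = A u v y + A v x y + A x u y"
    if ux: "{u,v,w,x,y} \<subseteq> S" "distinct [u,v,w,x,y]" for u v w x y
  proof -
    have "A u v w - A u v y = A w y u - A w y v" "A v x w - A v x y = A w y v - A w y x"
      "A x u w - A x u y = A w y x - A w y u"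
      by (rule sq; use ux in auto)+
    then show ?thesis by algebra
  qed
  \<comment> \<open>The twelve terms of the alternating sum group by the three pairs of opposite
    edges of the tetrahedron \<open>abcd\<close>. By \<open>sq\<close> the two edges of a pair
    contribute equally; \<open>B\<close> keeps one of each pair, namely \<open>cd\<close>,
    \<open>da\<close> and \<open>bd\<close>.\<close>
  define B where "B = A c d b - A c d a + A d a b - A d a c + A b d a - A b d c"
  have in_S: "a \<in> S" "b \<in> S" "c \<in> S" "d \<in> S" "e \<in> S" using S by auto
  have ne: "a \<noteq> b" "a \<noteq> c" "a \<noteq> d" "a \<noteq> e" "b \<noteq> c" "b \<noteq> d" "b \<noteq> e" "c \<noteq> d" "c \<noteq> e" "d \<noteq> e"
    and ne': "b \<noteq> a" "c \<noteq> a" "d \<noteq> a" "e \<noteq> a" "c \<noteq> b" "d \<noteq> b" "e \<noteq> b" "d \<noteq> c" "e \<noteq> c" "e \<noteq> d"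
    using S(1) by auto
  note [simp] = in_S ne ne'
  have "2 * B = (A a b d + A b c d + A c a d) - (A a b c + A b d c + A d a c)
      + (A a c b + A c d b + A d a b) - (A b c a + A c d a + A d b a)"
  proof -
    have "A a b c - A a b d = A c d a - A c d b" "A b c d - A b c a = A d a b - A d a c"
      "A c a b - A c a d = A b d c - A b d a" "A d b a = - A b d a" "A a c b = - A c a b"
      by (rule sq revA; simp)+
    then show ?thesis unfolding B_def by algebra
  qed
  also have "\<dots> = (A a b e + A b c e + A c a e) - (A a b e + A b d e + A d a e)
      + (A a c e + A c d e + A d a e) - (A b c e + A c d e + A d b e)"
  proof -
    have "A a b d + A b c d + A c a d = A a b e + A b c e + A c a e"
      "A a b c + A b d c + A d a c = A a b e + A b d e + A d a e"
      "A a c b + A c d b + A d a b = A a c e + A c d e + A d a e"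
      "A b c a + A c d a + A d b a = A b c e + A c d e + A d b e"
      by (rule tri; simp)+
    then show ?thesis by (simp only:)
  qed
  also have "\<dots> = 0"
  proof -
    have "A c a e = - A a c e" "A d b e = - A b d e" by (rule revA; simp)+
    then show ?thesis by algebra
  qed
  finally have "exp B = 1" by simp
  have p_ne: "p u \<noteq> p v" if "u \<in> S" "v \<in> S" "u \<noteq> v" for u v
  proof -
    have "card {u,v} < card S" using S by (simp add: card_insert_if)
    then obtain w where w: "w \<in> S" "w \<notin> {u,v}" by (meson card_mono finite.intros not_less subsetI)
    then show ?thesis using nz[of u w v 0] g(2)[of u w] that by auto
  qed
  \<comment> \<open>Up to sign, each of the six differences occurs once above and once below the
    line; three of them (\<open>ab\<close>, \<open>bc\<close>, \<open>ca\<close>) occur with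
    opposite signs, and this odd number produces -1.\<close>
  have cancel: "x / (- bc) / (y / ca) * (ab / x) / (- ca / z) * (y / (- ab)) / (z / bc) = -1"
    if "x \<noteq> 0" "y \<noteq> 0" "z \<noteq> 0" "ab \<noteq> 0" "bc \<noteq> 0" "ca \<noteq> 0" for x y z ab bc ca :: complex
    using that by (simp add: field_simps)
  have "exp B = exp (A c d b) / exp (A c d a) * exp (A d a b) / exp (A d a c) * exp (A b d a) / exp (A b d c)"
    unfolding B_def exp_add exp_diff by simp
  also have "\<dots> = (p d - p b) / (p c - p b) / ((p d - p a) / (p c - p a)) * ((p a - p b) / (p d - p b))
      / ((p a - p c) / (p d - p c)) * ((p d - p a) / (p b - p a)) / ((p d - p c) / (p b - p c))"
    by (simp add: expA)
  also have "\<dots> = (p d - p b) / (- (p b - p c)) / ((p d - p a) / (p c - p a)) * ((p a - p b) / (p d - p b))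
      / (- (p c - p a) / (p d - p c)) * ((p d - p a) / (- (p a - p b))) / ((p d - p c) / (p b - p c))"
    by (simp only: minus_diff_eq)
  also have "\<dots> = -1"
    by (rule cancel) (simp_all add: p_ne)
  finally show False using \<open>exp B = 1\<close> by simp
qed

section \<open>Transversal crossings\<close>

text \<open>The local strand of a transversal crossing can be cut down to an arbitrarily small interval.\<close>

lemma crossing_interval_shrink:
  fixes f :: "real \<Rightarrow> real"
  assumes cont: "continuous_on {a<..<b} f" and s: "a < s" "s < b"
    and img: "f ` {a<..<b} = {-1<..<1}"
    and zero: "\<And>x. x \<in> {a<..<b} \<Longrightarrow> f x = 0 \<longleftrightarrow> x = s"
    and "\<eta> > 0"
  obtains \<delta>0 where "\<delta>0 > 0"
    "\<And>\<delta>. 0 < \<delta> \<Longrightarrow> \<delta> \<le> \<delta>0 \<Longrightarrow> \<exists>a' b'. a \<le> a' \<and> s - \<eta> \<le> a' \<and> a' < s \<and> s < b' \<and> b' \<le> b \<and> b' \<le> s + \<eta> \<and>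
      f ` {a'<..<b'} = {-\<delta><..<\<delta>}"
proof -
  \<comment> \<open>The case in which \<open>f\<close> passes from negative to positive values at
    \<open>s\<close>; the other case follows by applying it to \<open>-f\<close>.\<close>
  have core: "\<exists>\<delta>0>0. \<forall>\<delta>. 0 < \<delta> \<and> \<delta> \<le> \<delta>0 \<longrightarrow> (\<exists>a' b'. a \<le> a' \<and> s - \<eta> \<le> a' \<and> a' < s \<and> s < b' \<and> b' \<le> b \<and> b' \<le> s + \<eta> \<and>
      f ` {a'<..<b'} = {-\<delta><..<\<delta>})"
    if cont: "continuous_on {a<..<b} f"
      and zero: "\<And>x. x \<in> {a<..<b} \<Longrightarrow> f x = 0 \<longleftrightarrow> x = s"
      and neg: "\<And>x. a < x \<Longrightarrow> x < s \<Longrightarrow> f x < 0" and pos: "\<And>x. s < x \<Longrightarrow> x < b \<Longrightarrow> f x > 0" for f :: "real \<Rightarrow> real"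
  proof -
    define a1 where "a1 = max (s - \<eta>) ((a + s) / 2)"
    define b1 where "b1 = min (s + \<eta>) ((b + s) / 2)"
    have a1: "a < a1" "a1 < s" "s - \<eta> \<le> a1" and b1: "b1 < b" "s < b1" "b1 \<le> s + \<eta>"
      using s \<open>\<eta> > 0\<close> by (auto simp: a1_def b1_def less_max_iff_disj min_less_iff_disj)
    have fs: "f s = 0" using zero s by auto
    have "\<exists>a' b'. a \<le> a' \<and> s - \<eta> \<le> a' \<and> a' < s \<and> s < b' \<and> b' \<le> b \<and> b' \<le> s + \<eta> \<and> f ` {a'<..<b'} = {-\<delta><..<\<delta>}"
      if \<delta>: "0 < \<delta>" "\<delta> \<le> min (- f a1) (f b1)" for \<delta>
    proof -
      have contL: "continuous_on {a1..s} f" and contR: "continuous_on {s..b1} f"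
        using a1 b1 s by (auto intro: continuous_on_subset[OF cont])
      \<comment> \<open>\<open>a'\<close> is the last point before \<open>s\<close> with value at
        most \<open>-\<delta>\<close> and \<open>b'\<close> the first point after \<open>s\<close>
        with value at least \<open>\<delta>\<close>. The bound on \<open>\<delta>\<close> makes
        \<open>a1\<close> and \<open>b1\<close> candidates.\<close>
      have "compact ({a1..s} \<inter> f -` {..-\<delta>})"
        by (metis contL continuous_closed_preimage closed_atMost closed_real_atLeastAtMost compact_Icc compact_Int_closed Int_left_absorb)
      moreover have "a1 \<in> {a1..s} \<inter> f -` {..-\<delta>}" using a1 \<delta> by auto
      ultimately obtain a' where a': "a' \<in> {a1..s} \<inter> f -` {..-\<delta>}" "\<And>x. x \<in> {a1..s} \<inter> f -` {..-\<delta>} \<Longrightarrow> x \<le> a'"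
        using compact_attains_sup[of "{a1..s} \<inter> f -` {..-\<delta>}"] by blast
      have "compact ({s..b1} \<inter> f -` {\<delta>..})"
        by (metis contR continuous_closed_preimage closed_atLeast closed_real_atLeastAtMost compact_Icc compact_Int_closed Int_left_absorb)
      moreover have "b1 \<in> {s..b1} \<inter> f -` {\<delta>..}" using b1 \<delta> by auto
      ultimately obtain b' where b': "b' \<in> {s..b1} \<inter> f -` {\<delta>..}" "\<And>x. x \<in> {s..b1} \<inter> f -` {\<delta>..} \<Longrightarrow> b' \<le> x"
        using compact_attains_inf[of "{s..b1} \<inter> f -` {\<delta>..}"] by blast
      have "a' \<noteq> s" "b' \<noteq> s" using a'(1) b'(1) fs \<delta> by auto
      then have as: "a1 \<le> a'" "a' < s" "s < b'" "b' \<le> b1" using a'(1) b'(1) by auto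
      have "f ` {a'<..<b'} = {-\<delta><..<\<delta>}"
      proof (intro equalityI subsetI)
        fix y assume "y \<in> f ` {a'<..<b'}"
        then obtain x where x: "a' < x" "x < b'" "y = f x" by auto
        have lo: "f x > -\<delta>"
        proof (cases "x \<le> s")
          case True
          then show ?thesis using a'(2)[of x] x as by (auto simp: not_le[symmetric])
        next
          case False
          then show ?thesis using pos[of x] x as b1 \<delta> by auto
        qed
        have hi: "f x < \<delta>"
        proof (cases "s \<le> x")
          case True
          then show ?thesis using b'(2)[of x] x as by (auto simp: not_le[symmetric])
        next
          case False
          then show ?thesis using neg[of x] x as a1 \<delta> by auto
        qed
        show "y \<in> {-\<delta><..<\<delta>}" using lo hi x by auto
      next
        fix y assume y: "y \<in> {-\<delta><..<\<delta>}"
        have c: "continuous_on {a'..b'} f" using as a1 b1 by (auto intro: continuous_on_subset[OF cont])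
        have "f a' \<le> y" "y \<le> f b'" using a'(1) b'(1) y by auto
        then obtain x where x: "a' \<le> x" "x \<le> b'" "f x = y"
          using IVT'[of f a' y b'] as c by auto
        have "x \<noteq> a'" "x \<noteq> b'" using x y a'(1) b'(1) by auto
        then show "y \<in> f ` {a'<..<b'}" using x by force
      qed
      then show ?thesis using as a1 b1 by (intro exI[of _ a'] exI[of _ b']) auto
    qed
    moreover have "min (- f a1) (f b1) > 0" using neg[of a1] pos[of b1] a1 b1 by auto
    ultimately show ?thesis by blast
  qed
  have const: "(\<forall>x\<in>S. f x < 0) \<or> (\<forall>x\<in>S. f x > 0)" if "connected S" "S \<subseteq> {a<..<b} - {s}" for S
  proof -
    have "continuous_on S f" using that by (auto intro: continuous_on_subset[OF cont])
    then have "connected (f ` S)" using that connected_continuous_image by blast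
    moreover have "0 \<notin> f ` S" using that zero by force
    ultimately show ?thesis
      by (smt (verit, best) connectedD_interval image_eqI)
  qed
  have L: "(\<forall>x\<in>{a<..<s}. f x < 0) \<or> (\<forall>x\<in>{a<..<s}. f x > 0)" 
    using s by (intro const) auto
  have R: "(\<forall>x\<in>{s<..<b}. f x < 0) \<or> (\<forall>x\<in>{s<..<b}. f x > 0)" 
    using s by (intro const) auto
  \<comment> \<open>Two values of opposite sign: they rule out that \<open>f\<close> has the same
    sign on both sides of \<open>s\<close>.\<close>
  have "1/2 \<in> f ` {a<..<b}" "-1/2 \<in> f ` {a<..<b}" unfolding img by auto
  then obtain x y where xy: "x \<in> {a<..<b}" "f x = 1/2" "y \<in> {a<..<b}" "f y = -1/2" by force
  then have xs: "x \<noteq> s" "y \<noteq> s" using zero by force+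
  have "(\<forall>x\<in>{a<..<s}. f x < 0) \<and> (\<forall>x\<in>{s<..<b}. f x > 0) \<or> (\<forall>x\<in>{a<..<s}. f x > 0) \<and> (\<forall>x\<in>{s<..<b}. f x < 0)"
  proof -
    have "x \<in> {a<..<s} \<or> x \<in> {s<..<b}" "y \<in> {a<..<s} \<or> y \<in> {s<..<b}" using xy xs by auto
    moreover have "\<not> f x < 0" "\<not> f y > 0" using xy by auto
    ultimately show ?thesis using L R by blast
  qed
  then show ?thesis
  proof
    assume "(\<forall>x\<in>{a<..<s}. f x < 0) \<and> (\<forall>x\<in>{s<..<b}. f x > 0)"
    then show ?thesis using core[OF cont zero] that by auto
  next
    assume A: "(\<forall>x\<in>{a<..<s}. f x > 0) \<and> (\<forall>x\<in>{s<..<b}. f x < 0)"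
    have im: "f ` T = {-\<delta><..<\<delta>}" if "(\<lambda>x. - f x) ` T = {-\<delta><..<\<delta>}" for T and \<delta> :: real
    proof -
      have "f ` T = uminus ` (\<lambda>x. - f x) ` T" by (force simp: image_image)
      then show ?thesis unfolding that by simp
    qed
    obtain \<delta>0 where \<delta>0: "\<delta>0 > 0" "\<forall>\<delta>. 0 < \<delta> \<and> \<delta> \<le> \<delta>0 \<longrightarrow> (\<exists>a' b'. a \<le> a' \<and> s - \<eta> \<le> a' \<and> a' < s \<and> s < b' \<and> b' \<le> b \<and> b' \<le> s + \<eta> \<and>
      (\<lambda>x. - f x) ` {a'<..<b'} = {-\<delta><..<\<delta>})"
      using core[of "\<lambda>x. - f x"] A cont zero by (force intro!: continuous_intros)
    show ?thesis
    proof (rule that[OF \<delta>0(1)])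
      fix \<delta> :: real assume "0 < \<delta>" "\<delta> \<le> \<delta>0"
      with \<delta>0(2) obtain a' b' where ab': "a \<le> a'" "s - \<eta> \<le> a'" "a' < s" "s < b'" "b' \<le> b" "b' \<le> s + \<eta>"
        "(\<lambda>x. - f x) ` {a'<..<b'} = {-\<delta><..<\<delta>}" by metis
      then show "\<exists>a' b'. a \<le> a' \<and> s - \<eta> \<le> a' \<and> a' < s \<and> s < b' \<and> b' \<le> b \<and> b' \<le> s + \<eta> \<and>
        f ` {a'<..<b'} = {-\<delta><..<\<delta>}" using im[OF ab'(7)] by (intro exI[of _ a'] exI[of _ b'] conjI)
    qed
  qed
qed

text \<open>
  Hypotheses \<open>z1\<close> and \<open>z2\<close> say that the crossing is a double point; the case \<open>g = h\<close> is that of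
  a self-crossing.
\<close>

lemma transversal_at_local:
  assumes tr: "transversal_at g s h t" and g: "path g" and h: "path h"
    and z1: "\<And>x. 0 < x \<Longrightarrow> x < 1 \<Longrightarrow> g x = g s \<Longrightarrow> x = s \<or> g = h \<and> x = t"
    and z2: "\<And>x. 0 < x \<Longrightarrow> x < 1 \<Longrightarrow> h x = g s \<Longrightarrow> x = t \<or> g = h \<and> x = s"
    and s': "0 < s'" "s' < 1" and t': "0 < t'" "t' < 1" and "\<epsilon> > 0"
    and \<sigma>: "\<sigma> = 1 \<or> \<sigma> = -1" and \<tau>: "\<tau> = 1 \<or> \<tau> = -1"
    and g': "\<And>x. \<bar>x\<bar> < \<epsilon> \<Longrightarrow> g' (s' + x) = g (s + \<sigma> * x)"
    and h': "\<And>x. \<bar>x\<bar> < \<epsilon> \<Longrightarrow> h' (t' + x) = h (t + \<tau> * x)"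
  shows "transversal_at g' s' h' t'"
proof -
  obtain U \<phi> \<psi> a b c d where gs: "g s = h t" and U: "open U" "homeomorphism U (ball 0 1) \<phi> \<psi>" "g s \<in> U" "\<phi> (g s) = 0"
    and ab: "0 \<le> a" "a < s" "s < b" "b \<le> 1" and cd: "0 \<le> c" "c < t" "t < d" "d \<le> 1"
    and gU: "g ` {a<..<b} \<subseteq> U" and gi: "\<phi> ` g ` {a<..<b} = {w \<in> ball 0 1. Im w = 0}"
    and hU: "h ` {c<..<d} \<subseteq> U" and hi: "\<phi> ` h ` {c<..<d} = {w \<in> ball 0 1. Re w = 0}"
    using tr unfolding transversal_at_def by - (elim conjE exE, rule that)
  have \<phi>c: "continuous_on U \<phi>" and \<psi>c: "continuous_on (ball 0 1) \<psi>"
    and \<psi>\<phi>: "\<And>x. x \<in> U \<Longrightarrow> \<psi> (\<phi> x) = x" and \<phi>\<psi>: "\<And>y. y \<in> ball 0 1 \<Longrightarrow> \<phi> (\<psi> y) = y"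
    and \<phi>U: "\<phi> ` U = ball 0 1" and \<psi>B: "\<psi> ` ball 0 1 = U"
    using U(2) by (auto simp: homeomorphism_def)
  have gc: "continuous_on {a<..<b} g" "continuous_on {c<..<d} h"
    using g h ab cd by (auto simp: path_def intro: continuous_on_subset)
  \<comment> \<open>In a self-crossing the two parameter intervals must be disjoint: on an overlap
    \<open>\<phi> (g x)\<close> would lie on both diameters, hence be 0, so a nonempty open interval
    would consist of \<open>s\<close> and \<open>t\<close> alone.\<close>
  have inf: False if "t0 \<in> {a<..<b} \<inter> {c<..<d}" "g = h" for t0
  proof -
    have "g x = g s" if x: "x \<in> {a<..<b} \<inter> {c<..<d}" for x
    proof -
      have "\<phi> (g x) \<in> {w \<in> ball 0 1. Im w = 0}" "\<phi> (g x) \<in> {w \<in> ball 0 1. Re w = 0}"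
        using gi hi x \<open>g = h\<close> by blast+
      then have "\<phi> (g x) = \<phi> (g s)" using U(4) by (auto simp: complex_eq_iff)
      then show ?thesis using \<psi>\<phi> gU U(3) x by (metis IntD1 image_subset_iff)
    qed
    then have "x = s \<or> x = t" if "x \<in> {a<..<b} \<inter> {c<..<d}" for x
      using z1[of x] that ab cd by auto
    then have "{a<..<b} \<inter> {c<..<d} \<subseteq> {s, t}" by blast
    then have "finite ({a<..<b} \<inter> {c<..<d})" by (rule finite_subset) simp
    moreover have "{a<..<b} \<inter> {c<..<d} = {max a c<..<min b d}" by auto
    ultimately show False using that by (auto simp: infinite_Ioo)
  qed
  have zg: "Re (\<phi> (g x)) = 0 \<longleftrightarrow> x = s" if x: "x \<in> {a<..<b}" for x
  proof
    assume "Re (\<phi> (g x)) = 0"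
    moreover have "Im (\<phi> (g x)) = 0" using gi x by blast
    ultimately have "\<phi> (g x) = \<phi> (g s)" using U(4) by (auto simp: complex_eq_iff)
    then have "g x = g s" using \<psi>\<phi> gU U(3) x by (metis image_subset_iff)
    then show "x = s" using z1[of x] x ab inf[of x] cd by auto
  qed (use U in auto)
  have zh: "Im (\<phi> (h x)) = 0 \<longleftrightarrow> x = t" if x: "x \<in> {c<..<d}" for x
  proof
    assume "Im (\<phi> (h x)) = 0"
    moreover have "Re (\<phi> (h x)) = 0" using hi x by blast
    ultimately have "\<phi> (h x) = \<phi> (g s)" using U(4) by (auto simp: complex_eq_iff)
    then have "h x = g s" using \<psi>\<phi> hU U(3) x by (metis image_subset_iff)
    then show "x = t" using z2[of x] x ab inf[of x] cd by auto
  qed (use U gs in auto)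
  have cg: "continuous_on {a<..<b} (\<lambda>x. Re (\<phi> (g x)))"
    by (intro continuous_intros continuous_on_compose2[OF \<phi>c] gc gU)
  have ch: "continuous_on {c<..<d} (\<lambda>x. Im (\<phi> (h x)))"
    by (intro continuous_intros continuous_on_compose2[OF \<phi>c] gc hU)
  have ig: "(\<lambda>x. Re (\<phi> (g x))) ` {a<..<b} = {-1<..<1}"
  proof -
    have "(\<lambda>x. Re (\<phi> (g x))) ` {a<..<b} = Re ` {w \<in> ball 0 1. Im w = 0}"
      unfolding gi[symmetric] by (simp add: image_image)
    also have "\<dots> = {-1<..<1}"
    proof (intro equalityI subsetI)
      fix y :: real assume "y \<in> {-1<..<1}"
      then show "y \<in> Re ` {w \<in> ball 0 1. Im w = 0}"
        by (intro image_eqI[of _ _ "complex_of_real y"]) auto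
    next
      fix y assume "y \<in> Re ` {w \<in> ball 0 1. Im w = 0}"
      then obtain w where "y = Re w" "cmod w < 1" by auto
      then show "y \<in> {-1<..<1}" using abs_Re_le_cmod[of w] by auto
    qed
    finally show ?thesis .
  qed
  have ih: "(\<lambda>x. Im (\<phi> (h x))) ` {c<..<d} = {-1<..<1}"
  proof -
    have "(\<lambda>x. Im (\<phi> (h x))) ` {c<..<d} = Im ` {w \<in> ball 0 1. Re w = 0}"
      unfolding hi[symmetric] by (simp add: image_image)
    also have "\<dots> = {-1<..<1}"
    proof (intro equalityI subsetI)
      fix y :: real assume "y \<in> {-1<..<1}"
      then show "y \<in> Im ` {w \<in> ball 0 1. Re w = 0}"
        by (intro image_eqI[of _ _ "\<i> * complex_of_real y"]) (auto simp: norm_mult)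
    next
      fix y assume "y \<in> Im ` {w \<in> ball 0 1. Re w = 0}"
      then obtain w where "y = Im w" "cmod w < 1" by auto
      then show "y \<in> {-1<..<1}" using abs_Im_le_cmod[of w] by auto
    qed
    finally show ?thesis .
  qed
  \<comment> \<open>Keeps the shortened intervals, moved to \<open>s'\<close> and \<open>t'\<close>,
    inside the unit interval and inside the range where \<open>g'\<close> and \<open>h'\<close> are
    known.\<close>
  define \<eta> where "\<eta> = Min {\<epsilon>, s', 1 - s', t', 1 - t'}"
  have \<eta>: "\<eta> > 0" "\<eta> \<le> \<epsilon>" "\<eta> \<le> s'" "\<eta> \<le> 1 - s'" "\<eta> \<le> t'" "\<eta> \<le> 1 - t'"
    using \<open>\<epsilon> > 0\<close> s' t' unfolding \<eta>_def by (auto simp: Min_gr_iff)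
  obtain \<delta>1 where \<delta>1: "\<delta>1 > 0" "\<And>\<delta>. 0 < \<delta> \<Longrightarrow> \<delta> \<le> \<delta>1 \<Longrightarrow> \<exists>a' b'. a \<le> a' \<and> s - \<eta> \<le> a' \<and> a' < s \<and> s < b' \<and> b' \<le> b \<and> b' \<le> s + \<eta> \<and>
      (\<lambda>x. Re (\<phi> (g x))) ` {a'<..<b'} = {-\<delta><..<\<delta>}"
    using crossing_interval_shrink[OF cg ab(2,3) ig zg \<eta>(1)] by blast
  obtain \<delta>2 where \<delta>2: "\<delta>2 > 0" "\<And>\<delta>. 0 < \<delta> \<Longrightarrow> \<delta> \<le> \<delta>2 \<Longrightarrow> \<exists>c' d'. c \<le> c' \<and> t - \<eta> \<le> c' \<and> c' < t \<and> t < d' \<and> d' \<le> d \<and> d' \<le> t + \<eta> \<and>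
      (\<lambda>x. Im (\<phi> (h x))) ` {c'<..<d'} = {-\<delta><..<\<delta>}"
    using crossing_interval_shrink[OF ch cd(2,3) ih zh \<eta>(1)] by blast
  \<comment> \<open>Both strands are cut at the same level, because one disc of radius
    \<open>\<delta>\<close>, rescaled to the unit disc, must have both of them as full
    diameters.\<close>
  define \<delta> where "\<delta> = Min {\<delta>1, \<delta>2, 1}"
  have \<delta>: "0 < \<delta>" "\<delta> \<le> \<delta>1" "\<delta> \<le> \<delta>2" "\<delta> \<le> 1" using \<delta>1(1) \<delta>2(1) by (auto simp: \<delta>_def)
  obtain a' b' where ab': "a \<le> a'" "s - \<eta> \<le> a'" "a' < s" "s < b'" "b' \<le> b" "b' \<le> s + \<eta>"
    and ig': "(\<lambda>x. Re (\<phi> (g x))) ` {a'<..<b'} = {-\<delta><..<\<delta>}" using \<delta>1(2)[OF \<delta>(1,2)] by blast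
  obtain c' d' where cd': "c \<le> c'" "t - \<eta> \<le> c'" "c' < t" "t < d'" "d' \<le> d" "d' \<le> t + \<eta>"
    and ih': "(\<lambda>x. Im (\<phi> (h x))) ` {c'<..<d'} = {-\<delta><..<\<delta>}" using \<delta>2(2)[OF \<delta>(1,3)] by blast
  define U' where "U' = U \<inter> \<phi> -` ball 0 \<delta>"
  define \<phi>' where "\<phi>' x = \<phi> x / of_real \<delta>" for x
  define \<psi>' where "\<psi>' y = \<psi> (of_real \<delta> * y)" for y
  have sub: "of_real \<delta> * y \<in> ball 0 \<delta>" "of_real \<delta> * y \<in> ball 0 1" if "y \<in> ball 0 1" for y :: complex
  proof -
    have "\<delta> * cmod y < \<delta> * 1" using that \<delta> by (intro mult_strict_left_mono) auto
    then have "cmod (of_real \<delta> * y) < \<delta>" using \<delta> by (simp add: norm_mult)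
    then show "of_real \<delta> * y \<in> ball 0 \<delta>" "of_real \<delta> * y \<in> ball 0 1" using \<delta> by auto
  qed
  have "open U'"
    unfolding U'_def using \<phi>c U(1) open_ball by (rule continuous_open_preimage)
  moreover have "homeomorphism U' (ball 0 1) \<phi>' \<psi>'"
  proof (rule homeomorphismI)
    show "continuous_on U' \<phi>'"
      unfolding \<phi>'_def U'_def using \<delta> by (intro continuous_intros continuous_on_subset[OF \<phi>c]) auto
    show "continuous_on (ball 0 1) \<psi>'"
      unfolding \<psi>'_def by (rule continuous_on_compose2[OF \<psi>c]) (use sub in \<open>auto intro!: continuous_intros\<close>)
    show "\<phi>' ` U' \<subseteq> ball 0 1"
      using \<delta> by (auto simp: \<phi>'_def U'_def norm_divide)
    show "\<psi>' ` ball 0 1 \<subseteq> U'"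
      using sub \<phi>\<psi> \<psi>B by (fastforce simp: \<psi>'_def U'_def)
    show "\<psi>' (\<phi>' x) = x" if "x \<in> U'" for x
      using that \<psi>\<phi> \<delta> by (auto simp: \<psi>'_def \<phi>'_def U'_def)
    show "\<phi>' (\<psi>' y) = y" if "y \<in> ball 0 1" for y
      using \<phi>\<psi>[OF sub(2)[OF that]] \<delta> by (auto simp: \<psi>'_def \<phi>'_def)
  qed
  moreover have gin: "g ` {a'<..<b'} \<subseteq> U' \<and> \<phi>' ` g ` {a'<..<b'} = {w \<in> ball 0 1. Im w = 0}"
  proof -
    have re: "\<phi> (g x) = of_real (Re (\<phi> (g x)))" if "x \<in> {a'<..<b'}" for x
    proof -
      have "x \<in> {a<..<b}" using that ab' by auto
      then have "Im (\<phi> (g x)) = 0" using gi by blast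
      then show ?thesis by (simp add: complex_eq_iff)
    qed
    have "\<phi>' ` g ` {a'<..<b'} = (\<lambda>r. complex_of_real (r / \<delta>)) ` (\<lambda>x. Re (\<phi> (g x))) ` {a'<..<b'}"
      unfolding image_image \<phi>'_def by (rule image_cong[OF refl]) (subst re, auto)
    also have "\<dots> = {w \<in> ball 0 1. Im w = 0}"
    proof -
      have "w \<in> (\<lambda>r. complex_of_real (r / \<delta>)) ` {-\<delta><..<\<delta>}" if "w \<in> ball 0 1" "Im w = 0" for w
      proof (rule image_eqI[of _ _ "\<delta> * Re w"])
        have "\<bar>Re w\<bar> < 1" using that abs_Re_le_cmod[of w] by auto
        from mult_strict_left_mono[OF this \<delta>(1)] have "\<bar>\<delta> * Re w\<bar> < \<delta> * 1"
          using \<delta> by (simp add: abs_mult)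
        then show "\<delta> * Re w \<in> {-\<delta><..<\<delta>}" by auto
      qed (use that \<delta> in \<open>auto simp: complex_eq_iff\<close>)
      then show ?thesis unfolding ig' using \<delta> by (auto simp: norm_divide abs_if)
    qed
    finally have 1: "\<phi>' ` g ` {a'<..<b'} = {w \<in> ball 0 1. Im w = 0}" .
    have "g x \<in> U'" if x: "x \<in> {a'<..<b'}" for x
    proof -
      have "(\<lambda>x. Re (\<phi> (g x))) x \<in> {-\<delta><..<\<delta>}" using x unfolding ig'[symmetric] by (rule imageI)
      then have "\<bar>Re (\<phi> (g x))\<bar> < \<delta>" by auto
      then have "\<phi> (g x) \<in> ball 0 \<delta>" by (subst re[OF x]) (auto simp del: of_real_Re)
      then show ?thesis using gU x ab' by (auto simp: U'_def)
    qed
    then show ?thesis using 1 by auto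
  qed
  moreover have hin: "h ` {c'<..<d'} \<subseteq> U' \<and> \<phi>' ` h ` {c'<..<d'} = {w \<in> ball 0 1. Re w = 0}"
  proof -
    have re: "\<phi> (h x) = \<i> * of_real (Im (\<phi> (h x)))" if "x \<in> {c'<..<d'}" for x
    proof -
      have "x \<in> {c<..<d}" using that cd' by auto
      then have "Re (\<phi> (h x)) = 0" using hi by blast
      then show ?thesis by (simp add: complex_eq_iff)
    qed
    have "\<phi>' ` h ` {c'<..<d'} = (\<lambda>r. \<i> * complex_of_real (r / \<delta>)) ` (\<lambda>x. Im (\<phi> (h x))) ` {c'<..<d'}"
      unfolding image_image \<phi>'_def by (rule image_cong[OF refl]) (subst re, auto)
    also have "\<dots> = {w \<in> ball 0 1. Re w = 0}"
    proof -
      have "w \<in> (\<lambda>r. \<i> * complex_of_real (r / \<delta>)) ` {-\<delta><..<\<delta>}" if "w \<in> ball 0 1" "Re w = 0" for w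
      proof (rule image_eqI[of _ _ "\<delta> * Im w"])
        have "\<bar>Im w\<bar> < 1" using that abs_Im_le_cmod[of w] by auto
        from mult_strict_left_mono[OF this \<delta>(1)] have "\<bar>\<delta> * Im w\<bar> < \<delta> * 1"
          using \<delta> by (simp add: abs_mult)
        then show "\<delta> * Im w \<in> {-\<delta><..<\<delta>}" by auto
      qed (use that \<delta> in \<open>auto simp: complex_eq_iff\<close>)
      then show ?thesis unfolding ih' using \<delta> by (auto simp: norm_divide norm_mult abs_if)
    qed
    finally have 1: "\<phi>' ` h ` {c'<..<d'} = {w \<in> ball 0 1. Re w = 0}" .
    have "h x \<in> U'" if x: "x \<in> {c'<..<d'}" for x
    proof -
      have "(\<lambda>x. Im (\<phi> (h x))) x \<in> {-\<delta><..<\<delta>}" using x unfolding ih'[symmetric] by (rule imageI)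
      then have "\<bar>Im (\<phi> (h x))\<bar> < \<delta>" by auto
      then have "\<phi> (h x) \<in> ball 0 \<delta>" by (subst re[OF x]) (auto simp: norm_mult)
      then show ?thesis using hU x cd' by (auto simp: U'_def)
    qed
    then show ?thesis using 1 by auto
  qed
  moreover have "g' s' = g s" "h' t' = h t" using g'[of 0] h'[of 0] \<open>\<epsilon> > 0\<close> by auto
  moreover have "g s \<in> U'" "\<phi>' (g s) = 0" using U \<delta> by (auto simp: U'_def \<phi>'_def)
  moreover have reparam: "\<exists>\<alpha> \<beta>. 0 \<le> \<alpha> \<and> \<alpha> < x' \<and> x' < \<beta> \<and> \<beta> \<le> 1 \<and> k' ` {\<alpha><..<\<beta>} = k ` {l<..<r}"
    if k': "\<And>y. \<bar>y\<bar> < \<epsilon> \<Longrightarrow> k' (x' + y) = k (x + \<rho> * y)" and "\<rho> = 1 \<or> \<rho> = -1" "x - \<eta> \<le> l" "l < x" "x < r" "r \<le> x + \<eta>"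
      "\<eta> \<le> x'" "\<eta> \<le> 1 - x'" for k k' :: "real \<Rightarrow> complex" and x x' \<rho> l r :: real
  proof (cases "\<rho> = 1")
    case True
    have "k' ` {x' + (l - x)<..<x' + (r - x)} = k ` {l<..<r}"
    proof -
      have "{x' + (l - x)<..<x' + (r - x)} = (\<lambda>y. x' + (y - x)) ` {l<..<r}"
        by (auto simp: image_iff intro!: bexI[of _ "_ - x' + x"])
      moreover have "k' (x' + (y - x)) = k y" if "y \<in> {l<..<r}" for y
        using that k'[of "y - x"] \<eta> True \<open>x - \<eta> \<le> l\<close> \<open>r \<le> x + \<eta>\<close> by auto
      ultimately show ?thesis by (simp add: image_image)
    qed
    then show ?thesis using that by (intro exI[of _ "x' + (l - x)"] exI[of _ "x' + (r - x)"]) auto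
  next
    case False
    have "k' ` {x' + (x - r)<..<x' + (x - l)} = k ` {l<..<r}"
    proof -
      have "{x' + (x - r)<..<x' + (x - l)} = (\<lambda>y. x' + (x - y)) ` {l<..<r}"
        by (auto simp: image_iff intro!: bexI[of _ "x' + x - _"])
      moreover have "k' (x' + (x - y)) = k y" if "y \<in> {l<..<r}" for y
        using that k'[of "x - y"] \<eta> False \<open>\<rho> = 1 \<or> \<rho> = -1\<close> \<open>x - \<eta> \<le> l\<close> \<open>r \<le> x + \<eta>\<close> by auto
      ultimately show ?thesis by (simp add: image_image)
    qed
    then show ?thesis using that by (intro exI[of _ "x' + (x - r)"] exI[of _ "x' + (x - l)"]) auto
  qed
  ultimately show ?thesis
  proof -
    obtain \<alpha> \<beta> where 1: "0 \<le> \<alpha>" "\<alpha> < s'" "s' < \<beta>" "\<beta> \<le> 1" "g' ` {\<alpha><..<\<beta>} = g ` {a'<..<b'}"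
      using reparam[of g' s' g s \<sigma> a' b', OF g' \<sigma>] ab' \<eta> by auto
    obtain \<kappa> \<mu> where 2: "0 \<le> \<kappa>" "\<kappa> < t'" "t' < \<mu>" "\<mu> \<le> 1" "h' ` {\<kappa><..<\<mu>} = h ` {c'<..<d'}"
      using reparam[of h' t' h t \<tau> c' d', OF h' \<tau>] cd' \<eta> by auto
    show ?thesis
      unfolding transversal_at_def
    proof (intro conjI exI)
      show "g' s' = h' t'" using \<open>g' s' = g s\<close> \<open>h' t' = h t\<close> gs by simp
      show "open U'" "homeomorphism U' (ball 0 1) \<phi>' \<psi>'" by fact+
      show "g' s' \<in> U'" "\<phi>' (g' s') = 0"
        using \<open>g' s' = g s\<close> \<open>g s \<in> U'\<close> \<open>\<phi>' (g s) = 0\<close> by auto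
      show "0 \<le> \<alpha>" "\<alpha> < s'" "s' < \<beta>" "\<beta> \<le> 1" "0 \<le> \<kappa>" "\<kappa> < t'" "t' < \<mu>" "\<mu> \<le> 1" by fact+
      show "g' ` {\<alpha><..<\<beta>} \<subseteq> U'" "\<phi>' ` g' ` {\<alpha><..<\<beta>} = {w \<in> ball 0 1. Im w = 0}"
        using gin unfolding 1(5) by auto
      show "h' ` {\<kappa><..<\<mu>} \<subseteq> U'" "\<phi>' ` h' ` {\<kappa><..<\<mu>} = {w \<in> ball 0 1. Re w = 0}"
        using hin unfolding 2(5) by auto
    qed
  qed
qed

text \<open>Linear coordinates in the basis \<open>u\<close>, \<open>w\<close> straighten both
  segments at once; \<open>Im (cnj u * w)\<close> is the determinant of this basis.\<close>

lemma transversal_at_affine: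
  fixes u w z :: complex
  assumes "\<epsilon> > 0" and s: "0 < s" "s < 1" and t: "0 < t" "t < 1"
    and d0: "Im (cnj u * w) \<noteq> 0"
    and g: "\<And>x. \<bar>x\<bar> < \<epsilon> \<Longrightarrow> g (s + x) = z + of_real x * u"
    and h: "\<And>x. \<bar>x\<bar> < \<epsilon> \<Longrightarrow> h (t + x) = z + of_real x * w"
  shows "transversal_at g s h t"
proof -
  define \<eta> where "\<eta> = Min {\<epsilon>, s, 1 - s, t, 1 - t}"
  have \<eta>: "\<eta> > 0" "\<eta> \<le> \<epsilon>" "\<eta> \<le> s" "\<eta> \<le> 1 - s" "\<eta> \<le> t" "\<eta> \<le> 1 - t"
    using \<open>\<epsilon> > 0\<close> s t unfolding \<eta>_def by (auto simp: Min_gr_iff)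
  define d where "d = Im (cnj u * w)"
  have d: "d \<noteq> 0" using d0 by (simp add: d_def)
  \<comment> \<open>Cramer's rule: the coordinates of \<open>\<zeta> - z\<close> in the basis
    \<open>u\<close>, \<open>w\<close>, scaled so that a parameter distance \<open>\<eta>\<close>
    becomes 1.\<close>
  define \<phi> where "\<phi> \<zeta> = complex_of_real (Im (cnj (\<zeta> - z) * w) / (d * \<eta>)) + \<i> * complex_of_real (Im (cnj u * (\<zeta> - z)) / (d * \<eta>))" for \<zeta>
  define \<psi> where "\<psi> y = z + of_real \<eta> * (of_real (Re y) * u + of_real (Im y) * w)" for y
  have \<phi>\<psi>: "\<phi> (\<psi> y) = y" for y
  proof -
    have "Im (cnj (\<psi> y - z) * w) = d * \<eta> * Re y" "Im (cnj u * (\<psi> y - z)) = d * \<eta> * Im y"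
      by (simp_all add: \<psi>_def d_def algebra_simps)
    then show ?thesis using d \<eta> by (simp add: \<phi>_def complex_eq_iff)
  qed
  have \<psi>\<phi>: "\<psi> (\<phi> x) = x" for x
  proof -
    define \<xi> where "\<xi> = x - z"
    have "of_real (Im (cnj \<xi> * w)) * u + of_real (Im (cnj u * \<xi>)) * w = of_real d * \<xi>"
      by (simp add: d_def complex_eq_iff algebra_simps)
    moreover have "\<psi> (\<phi> x) = z + (of_real (Im (cnj \<xi> * w)) * u + of_real (Im (cnj u * \<xi>)) * w) / of_real d"
    proof -
      have "h * (X / (c * h) * u + Y / (c * h) * w) = (X * u + Y * w) / c"
        if "h \<noteq> 0" "c \<noteq> 0" for h c X Y :: complex
        using that by (simp add: field_simps)
      moreover have "Re (\<phi> x) = Im (cnj \<xi> * w) / (d * \<eta>)" "Im (\<phi> x) = Im (cnj u * \<xi>) / (d * \<eta>)"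
        by (simp_all add: \<phi>_def \<xi>_def)
      ultimately show ?thesis using d \<eta>(1) by (simp only: \<psi>_def of_real_divide of_real_mult) simp
    qed
    ultimately show ?thesis using d by (simp add: \<xi>_def)
  qed
  have \<phi>c: "continuous_on A \<phi>" and \<psi>c: "continuous_on A \<psi>" for A
    unfolding \<phi>_def \<psi>_def by (intro continuous_intros; use d \<eta> in simp)+
  define U where "U = \<phi> -` ball 0 1"
  have gl: "g x = \<psi> (of_real ((x - s) / \<eta>))" if "x \<in> {s - \<eta><..<s + \<eta>}" for x
  proof -
    have "\<bar>x - s\<bar> < \<epsilon>" using that \<eta> by auto
    from g[OF this] show ?thesis using \<eta> by (simp add: \<psi>_def)
  qed
  have hl: "h x = \<psi> (\<i> * of_real ((x - t) / \<eta>))" if "x \<in> {t - \<eta><..<t + \<eta>}" for x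
  proof -
    have "\<bar>x - t\<bar> < \<epsilon>" using that \<eta> by auto
    from h[OF this] show ?thesis using \<eta> by (simp add: \<psi>_def)
  qed
  have scale: "(\<lambda>x. (x - r) / \<eta>) ` {r - \<eta><..<r + \<eta>} = {-1<..<1}" for r
  proof (intro equalityI subsetI)
    fix y :: real assume "y \<in> {-1<..<1}"
    then show "y \<in> (\<lambda>x. (x - r) / \<eta>) ` {r - \<eta><..<r + \<eta>}"
      using \<eta>(1) mult_strict_left_mono[of y 1 \<eta>] mult_strict_left_mono[of "-1" y \<eta>]
      by (intro image_eqI[of _ _ "r + \<eta> * y"]) auto
  qed (use \<eta>(1) in \<open>auto simp: field_simps\<close>)
  have gi: "\<phi> ` g ` {s - \<eta><..<s + \<eta>} = {w \<in> ball 0 1. Im w = 0}"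
  proof -
    have "\<phi> ` g ` {s - \<eta><..<s + \<eta>} = complex_of_real ` (\<lambda>x. (x - s) / \<eta>) ` {s - \<eta><..<s + \<eta>}"
      unfolding image_image by (rule image_cong[OF refl]) (simp add: gl \<phi>\<psi> del: of_real_divide of_real_diff)
    also have "\<dots> = {w \<in> ball 0 1. Im w = 0}"
    proof (intro equalityI subsetI)
      fix y assume y: "y \<in> {w \<in> ball 0 1. Im w = 0}"
      then have "y = of_real (Re y)" "\<bar>Re y\<bar> < 1" using abs_Re_le_cmod[of y] by (auto simp: complex_eq_iff)
      then show "y \<in> complex_of_real ` (\<lambda>x. (x - s) / \<eta>) ` {s - \<eta><..<s + \<eta>}"
        unfolding scale by (intro image_eqI[of _ _ "Re y"]) auto
    qed (unfold scale, auto)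
    finally show ?thesis .
  qed
  have hi: "\<phi> ` h ` {t - \<eta><..<t + \<eta>} = {w \<in> ball 0 1. Re w = 0}"
  proof -
    have "\<phi> ` h ` {t - \<eta><..<t + \<eta>} = (\<lambda>r. \<i> * complex_of_real r) ` (\<lambda>x. (x - t) / \<eta>) ` {t - \<eta><..<t + \<eta>}"
      unfolding image_image by (rule image_cong[OF refl]) (simp add: hl \<phi>\<psi> del: of_real_divide of_real_diff)
    also have "\<dots> = {w \<in> ball 0 1. Re w = 0}"
    proof (intro equalityI subsetI)
      fix y assume y: "y \<in> {w \<in> ball 0 1. Re w = 0}"
      then have "y = \<i> * of_real (Im y)" "\<bar>Im y\<bar> < 1" using abs_Im_le_cmod[of y] by (auto simp: complex_eq_iff)
      then show "y \<in> (\<lambda>r. \<i> * complex_of_real r) ` (\<lambda>x. (x - t) / \<eta>) ` {t - \<eta><..<t + \<eta>}"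
        unfolding scale by (intro image_eqI[of _ _ "Im y"]) auto
    qed (unfold scale, auto simp: norm_mult)
    finally show ?thesis .
  qed
  show ?thesis
    unfolding transversal_at_def
  proof (intro conjI exI)
    show "g s = h t" using g[of 0] h[of 0] \<open>\<epsilon> > 0\<close> by simp
    show "open U" unfolding U_def by (rule open_vimage[OF open_ball \<phi>c])
    show "homeomorphism U (ball 0 1) \<phi> \<psi>"
      by (rule homeomorphismI) (auto simp: \<phi>c \<psi>c U_def \<phi>\<psi> \<psi>\<phi>)
    have "\<phi> (g s) = 0" using gl[of s] \<eta> \<phi>\<psi>[of 0] by simp
    then show "\<phi> (g s) = 0" "g s \<in> U" by (auto simp: U_def)
    show "0 \<le> s - \<eta>" "s - \<eta> < s" "s < s + \<eta>" "s + \<eta> \<le> 1" "0 \<le> t - \<eta>" "t - \<eta> < t" "t < t + \<eta>" "t + \<eta> \<le> 1"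
      using \<eta> by auto
    show "g ` {s - \<eta><..<s + \<eta>} \<subseteq> U" using gi by (auto simp: U_def)
    show "h ` {t - \<eta><..<t + \<eta>} \<subseteq> U" using hi by (auto simp: U_def)
  qed (fact gi hi)+
qed

section \<open>Carrying crossings from one drawing to another\<close>

lemma multiple_points_iff:
  "z \<in> multiple_points G p \<gamma> \<longleftrightarrow> (\<exists>x\<in>fibre G p \<gamma> z. \<exists>y\<in>fibre G p \<gamma> z. x \<noteq> y)"
  by (simp add: multiple_points_def)

lemma Inner_in_fibre_iff:
  "Inner e t \<in> fibre G p \<gamma> z \<longleftrightarrow> e \<in> snd G \<and> 0 < t \<and> t < 1 \<and> \<gamma> e t = z"
  by (auto simp: fibre_def complex_points_def)

lemma Vertex_in_fibre_iff:
  "Vertex v \<in> fibre G p \<gamma> z \<longleftrightarrow> v \<in> fst G \<and> p v = z"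
  by (auto simp: fibre_def complex_points_def)

text \<open>The fibre at \<open>z\<close> has at least two points in the new drawing and exactly two
  in the old one, so the injection \<open>m\<close> is a bijection. Vertices go to vertices, so the
  new fibre consists of two inner points, and there the edges agree locally up to orientation with
  the old ones; \<open>transversal_at_local\<close> does the rest.\<close>

lemma transversal_double_point_transfer:
  assumes D: "drawing G p \<gamma>" and z: "z \<in> multiple_points H q \<delta>"
    and m: "inj_on m (fibre H q \<delta> z)" "m ` fibre H q \<delta> z \<subseteq> fibre G p \<gamma> z"
    and mV: "\<And>v. Vertex v \<in> fibre H q \<delta> z \<Longrightarrow> \<exists>u. m (Vertex v) = Vertex u"
    and loc: "\<And>e' s' e s. Inner e' s' \<in> fibre H q \<delta> z \<Longrightarrow> m (Inner e' s') = Inner e s \<Longrightarrow>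
      \<exists>\<epsilon>>0. \<exists>\<sigma>\<in>{1,-1}. \<forall>x. \<bar>x\<bar> < \<epsilon> \<longrightarrow> \<delta> e' (s' + x) = \<gamma> e (s + \<sigma> * x)"
  shows "z \<in> multiple_points G p \<gamma>" "m ` fibre H q \<delta> z = fibre G p \<gamma> z"
    "transversal_double_point H q \<delta> z"
proof -
  obtain x y where xy: "x \<in> fibre H q \<delta> z" "y \<in> fibre H q \<delta> z" "x \<noteq> y"
    using z by (auto simp: multiple_points_iff)
  have mxy: "m x \<in> fibre G p \<gamma> z" "m y \<in> fibre G p \<gamma> z" "m x \<noteq> m y"
    using m xy by (auto dest: inj_onD)
  then show zG: "z \<in> multiple_points G p \<gamma>" by (auto simp: multiple_points_iff)
  then obtain e s f t where ne: "Inner e s \<noteq> Inner f t" and fib: "fibre G p \<gamma> z = {Inner e s, Inner f t}"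
    and tr: "transversal_at (\<gamma> e) s (\<gamma> f) t"
  proof -
    have "transversal_double_point G p \<gamma> z" using D zG unfolding drawing_def by blast
    then show ?thesis unfolding transversal_double_point_def using that by blast
  qed
  show mim: "m ` fibre H q \<delta> z = fibre G p \<gamma> z"
  proof (rule equalityI[OF m(2)])
    have "fibre G p \<gamma> z = {m x, m y}" using mxy ne unfolding fib by auto
    then show "fibre G p \<gamma> z \<subseteq> m ` fibre H q \<delta> z" using xy by auto
  qed
  then obtain X Y where X: "X \<in> fibre H q \<delta> z" "m X = Inner e s" and Y: "Y \<in> fibre H q \<delta> z" "m Y = Inner f t"
  proof -
    have "Inner e s \<in> m ` fibre H q \<delta> z" "Inner f t \<in> m ` fibre H q \<delta> z" unfolding mim fib by auto
    then show ?thesis using that by (auto elim!: imageE)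
  qed
  have XY: "fibre H q \<delta> z = {X, Y}"
  proof -
    have "w = X \<or> w = Y" if "w \<in> fibre H q \<delta> z" for w
    proof -
      have "m w = m X \<or> m w = m Y" using that m(2) X Y unfolding fib by auto
      then show ?thesis using m(1) that X(1) Y(1) by (auto dest: inj_onD)
    qed
    then show ?thesis using X Y by auto
  qed
  obtain e' s' where X': "X = Inner e' s'" using X mV by (cases X) fastforce+
  obtain f' t' where Y': "Y = Inner f' t'" using Y mV by (cases Y) fastforce+
  have "X \<noteq> Y" using X Y ne by auto
  obtain \<epsilon>1 \<sigma> where 1: "\<epsilon>1 > 0" "\<sigma> = 1 \<or> \<sigma> = -1" "\<And>x. \<bar>x\<bar> < \<epsilon>1 \<Longrightarrow> \<delta> e' (s' + x) = \<gamma> e (s + \<sigma> * x)"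
  proof -
    obtain \<epsilon> \<sigma> where "\<epsilon> > 0" "\<sigma> \<in> {1,-1}" "\<forall>x. \<bar>x\<bar> < \<epsilon> \<longrightarrow> \<delta> e' (s' + x) = \<gamma> e (s + \<sigma> * x)"
      using loc[of e' s' e s] X X' by blast
    then show ?thesis by (intro that[of \<epsilon> \<sigma>]) auto
  qed
  obtain \<epsilon>2 \<tau> where 2: "\<epsilon>2 > 0" "\<tau> = 1 \<or> \<tau> = -1" "\<And>x. \<bar>x\<bar> < \<epsilon>2 \<Longrightarrow> \<delta> f' (t' + x) = \<gamma> f (t + \<tau> * x)"
  proof -
    obtain \<epsilon> \<sigma> where "\<epsilon> > 0" "\<sigma> \<in> {1,-1}" "\<forall>x. \<bar>x\<bar> < \<epsilon> \<longrightarrow> \<delta> f' (t' + x) = \<gamma> f (t + \<sigma> * x)"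
      using loc[of f' t' f t] Y Y' by blast
    then show ?thesis by (intro that[of \<epsilon> \<sigma>]) auto
  qed
  have e: "e \<in> snd G" "0 < s" "s < 1" "\<gamma> e s = z" and f: "f \<in> snd G" "0 < t" "t < 1" "\<gamma> f t = z"
  proof -
    have "Inner e s \<in> fibre G p \<gamma> z" "Inner f t \<in> fibre G p \<gamma> z" unfolding fib by auto
    then show "e \<in> snd G" "0 < s" "s < 1" "\<gamma> e s = z" "f \<in> snd G" "0 < t" "t < 1" "\<gamma> f t = z"
      by (auto simp: Inner_in_fibre_iff)
  qed
  have "transversal_at (\<delta> e') s' (\<delta> f') t'"
  proof (rule transversal_at_local[OF tr, where \<epsilon> = "min \<epsilon>1 \<epsilon>2"])
    show "path (\<gamma> e)" "path (\<gamma> f)" using D e f by (auto simp: drawing_def)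
    show "x = s \<or> \<gamma> e = \<gamma> f \<and> x = t" if "0 < x" "x < 1" "\<gamma> e x = \<gamma> e s" for x
    proof -
      have "Inner e x \<in> fibre G p \<gamma> z" using that e by (auto simp: Inner_in_fibre_iff)
      then show ?thesis unfolding fib by auto
    qed
    show "x = t \<or> \<gamma> e = \<gamma> f \<and> x = s" if "0 < x" "x < 1" "\<gamma> f x = \<gamma> e s" for x
    proof -
      have "Inner f x \<in> fibre G p \<gamma> z" using that e f by (auto simp: Inner_in_fibre_iff)
      then show ?thesis unfolding fib by auto
    qed
    show "0 < s'" "s' < 1" using X X' by (auto simp: Inner_in_fibre_iff)
    show "0 < t'" "t' < 1" using Y Y' by (auto simp: Inner_in_fibre_iff)
    show "\<sigma> = 1 \<or> \<sigma> = -1" "\<tau> = 1 \<or> \<tau> = -1" by fact+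
  qed (use 1 2 in auto)
  then show "transversal_double_point H q \<delta> z"
    unfolding transversal_double_point_def using XY X' Y' \<open>X \<noteq> Y\<close> by blast
qed

lemma crossing_number_le:
  "drawing G p \<gamma> \<Longrightarrow> crossing_number G \<le> enat (card (multiple_points G p \<gamma>))"
  unfolding crossing_number_def by (rule Inf_lower) auto

text \<open>The picture stays the same and only the names change: \<open>\<delta>\<close> reads an
  edge back through the inverse \<open>k\<close>. Applied to permutations of the vertices, this
  compares the moves on different triangles.\<close>

lemma crossing_number_image_le:
  assumes inj: "inj_on f V" and E: "\<And>e. e \<in> E \<Longrightarrow> e \<subseteq> V"
  shows "crossing_number (f ` V, (`) f ` E) \<le> crossing_number (V, E)"
proof -
  have "crossing_number (f ` V, (`) f ` E) \<le> enat (card (multiple_points (V, E) p \<gamma>))"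
    if D: "drawing (V, E) p \<gamma>" for p \<gamma>
  proof -
    define k where "k = inv_into V f"
    define q where "q = p \<circ> k"
    define \<delta> where "\<delta> e = \<gamma> (k ` e)" for e
    let ?H = "(f ` V, (`) f ` E)"
    have kf: "k (f v) = v" if "v \<in> V" for v using that inj by (simp add: k_def)
    have kfe: "k ` f ` e = e" if "e \<in> E" for e
      using E[OF that] kf by (force simp: image_image)
    have mult: "z \<in> multiple_points (V, E) p \<gamma> \<and> transversal_double_point ?H q \<delta> z"
      if "z \<in> multiple_points ?H q \<delta>" for z
    proof -
      define m where "m x = (case x of Vertex v \<Rightarrow> Vertex (k v) | Inner e t \<Rightarrow> Inner (k ` e) t)" for x
      have fibH: "x \<in> fibre ?H q \<delta> z \<Longrightarrow> (\<exists>v\<in>V. x = Vertex (f v) \<and> m x = Vertex v \<and> p v = z) \<or>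
          (\<exists>e\<in>E. \<exists>t. 0 < t \<and> t < 1 \<and> x = Inner (f ` e) t \<and> m x = Inner e t \<and> \<gamma> e t = z)" for x
      proof (cases x)
        case (Inner e' t)
        assume "x \<in> fibre ?H q \<delta> z"
        then obtain e where "e \<in> E" "e' = f ` e" "0 < t" "t < 1" "\<delta> (f ` e) t = z"
          using Inner by (auto simp: Inner_in_fibre_iff)
        moreover have "k ` f ` e = e" using kfe \<open>e \<in> E\<close> by blast
        ultimately show ?thesis using Inner by (intro disjI2 bexI[of _ e] exI[of _ t]) (auto simp: m_def \<delta>_def)
      qed (auto simp: Vertex_in_fibre_iff m_def q_def kf)
      have 1: "inj_on m (fibre ?H q \<delta> z)"
      proof (rule inj_onI)
        fix x y assume "x \<in> fibre ?H q \<delta> z" "y \<in> fibre ?H q \<delta> z" "m x = m y"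
        then show "x = y" using fibH[of x] fibH[of y] by auto
      qed
      have 2: "m ` fibre ?H q \<delta> z \<subseteq> fibre (V, E) p \<gamma> z"
      proof
        fix y assume "y \<in> m ` fibre ?H q \<delta> z"
        then obtain x where x: "x \<in> fibre ?H q \<delta> z" "y = m x" by auto
        show "y \<in> fibre (V, E) p \<gamma> z"
          using fibH[OF x(1)] x(2) by (auto simp: Vertex_in_fibre_iff Inner_in_fibre_iff)
      qed
      have 3: "\<exists>\<epsilon>>0. \<exists>\<sigma>\<in>{1,-1}. \<forall>x. \<bar>x\<bar> < \<epsilon> \<longrightarrow> \<delta> e' (s' + x) = \<gamma> e (s + \<sigma> * x)"
        if "m (Inner e' s') = Inner e s" for e' s' e s
        using that by (intro exI[of _ 1] conjI bexI[of _ 1]) (auto simp: m_def \<delta>_def)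
      have 4: "\<exists>u. m (Vertex v) = Vertex u" for v by (simp add: m_def)
      show ?thesis
        using transversal_double_point_transfer[OF D that 1 2 4 3] by blast
    qed
    have "drawing ?H q \<delta>"
      unfolding drawing_def
    proof (intro conjI ballI)
      show "finite (multiple_points ?H q \<delta>)"
        by (rule finite_subset[of _ "multiple_points (V, E) p \<gamma>"]) (use mult D in \<open>auto simp: drawing_def\<close>)
      fix e assume "e \<in> snd ?H"
      then obtain e0 where e0: "e = f ` e0" "e0 \<in> E" by auto
      then obtain u v where uv: "e0 = {u,v}" "pathstart (\<gamma> e0) = p u" "pathfinish (\<gamma> e0) = p v" "path (\<gamma> e0)"
        using D by (auto simp: drawing_def)
      have "\<delta> e = \<gamma> e0" unfolding \<delta>_def e0(1) kfe[OF e0(2)] ..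
      moreover have "u \<in> V" "v \<in> V" using e0 E uv by auto
      ultimately show "path (\<delta> e)" "\<exists>u v. e = {u, v} \<and> pathstart (\<delta> e) = q u \<and> pathfinish (\<delta> e) = q v"
        using uv e0 kf by - (simp, rule exI[of _ "f u"], rule exI[of _ "f v"], auto simp: q_def)
    qed (use mult in auto)
    then have "crossing_number ?H \<le> enat (card (multiple_points ?H q \<delta>))" by (rule crossing_number_le)
    also have "\<dots> \<le> enat (card (multiple_points (V, E) p \<gamma>))"
      using mult D by (auto simp: drawing_def intro!: card_mono)
    finally show ?thesis .
  qed
  then show ?thesis
    unfolding crossing_number_def[of "(V, E)"] by (intro Inf_greatest) auto
qed

section \<open>Directions around a vertex\<close>

text \<open>Distinct keys have distinct ranks, and counting makes the map onto. It is the
  surjectivity that matters later: every rank occurs, in particular the extreme ones.\<close>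

lemma bij_betw_rank:
  fixes k :: "'a \<Rightarrow> real"
  assumes "finite A" "inj_on k A"
  shows "bij_betw (\<lambda>y. card {w \<in> A. k w < k y}) A {..<card A}"
proof -
  have less: "card {w \<in> A. k w < k y} < card {w \<in> A. k w < k y'}" if "y \<in> A" "k y < k y'" for y y'
    by (rule psubset_card_mono) (use that assms in auto)
  have inj: "inj_on (\<lambda>y. card {w \<in> A. k w < k y}) A"
  proof (rule inj_onI)
    fix y y' assume y: "y \<in> A" "y' \<in> A" "card {w \<in> A. k w < k y} = card {w \<in> A. k w < k y'}"
    then have "\<not> k y < k y'" "\<not> k y' < k y" using less[of y y'] less[of y' y] by auto
    then show "y = y'" using y assms(2) by (auto dest: inj_onD)
  qed
  have "card {w \<in> A. k w < k y} < card A" if "y \<in> A" for y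
    by (rule psubset_card_mono) (use that assms in auto)
  then have "(\<lambda>y. card {w \<in> A. k w < k y}) ` A \<subseteq> {..<card A}" by auto
  moreover have "card ((\<lambda>y. card {w \<in> A. k w < k y}) ` A) = card A" using inj by (rule card_image)
  ultimately have "(\<lambda>y. card {w \<in> A. k w < k y}) ` A = {..<card A}"
    by (intro card_subset_eq) auto
  with inj show ?thesis by (simp add: bij_betw_def)
qed

text \<open>The number of directions met strictly between those of \<open>x\<close> and \<open>y\<close> when turning counterclockwise.\<close>

definition ccw_rank :: "('a \<Rightarrow> complex) \<Rightarrow> 'a set \<Rightarrow> 'a \<Rightarrow> 'a \<Rightarrow> nat" where
  "ccw_rank u W x y = card {w \<in> W - {x}. Arg2pi (u w / u x) < Arg2pi (u y / u x)}"

lemma Arg2pi_unit_inj: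
  assumes "Arg2pi y = Arg2pi z" "cmod y = 1" "cmod z = 1"
  shows "y = z"
  using Arg2pi_eq[of y] Arg2pi_eq[of z] assms by simp

lemma bij_betw_ccw_rank:
  assumes "finite W" "inj_on u W" "\<And>w. w \<in> W \<Longrightarrow> cmod (u w) = 1" "x \<in> W"
  shows "bij_betw (ccw_rank u W x) (W - {x}) {..<card W - 1}"
proof -
  have "inj_on (\<lambda>w. Arg2pi (u w / u x)) (W - {x})"
  proof (rule inj_onI)
    fix y z assume yz: "y \<in> W - {x}" "z \<in> W - {x}" "Arg2pi (u y / u x) = Arg2pi (u z / u x)"
    then have "u y / u x = u z / u x"
      using assms by (intro Arg2pi_unit_inj) (auto simp: norm_divide)
    moreover have "u x \<noteq> 0" using assms(3)[OF assms(4)] by auto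
    ultimately show "y = z" using yz assms(2) by (auto dest: inj_onD)
  qed
  from bij_betw_rank[OF _ this] show ?thesis
    using assms by (simp add: ccw_rank_def[abs_def])
qed

text \<open>Every direction other than those of \<open>x\<close> and \<open>y\<close> lies in
  exactly one of the two sectors between them. So passing to the complementary sector turns rank j
  into \<open>card W - 2\<close> minus j.\<close>

lemma ccw_rank_add:
  assumes W: "finite W" "inj_on u W" "\<And>w. w \<in> W \<Longrightarrow> cmod (u w) = 1" and xy: "x \<in> W" "y \<in> W" "x \<noteq> y"
  shows "ccw_rank u W x y + ccw_rank u W y x = card W - 2"
proof -
  let ?A = "{w \<in> W - {x}. Arg2pi (u w / u x) < Arg2pi (u y / u x)}"
  let ?B = "{w \<in> W - {y}. Arg2pi (u w / u y) < Arg2pi (u x / u y)}"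
  have nz: "u w \<noteq> 0" if "w \<in> W" for w using W(3)[OF that] by auto
  have Arg_pos: "Arg2pi (u w / u x') > 0" if "w \<in> W" "x' \<in> W" "w \<noteq> x'" for w x'
  proof -
    have "Arg2pi (u w / u x') \<noteq> Arg2pi 1"
    proof
      assume "Arg2pi (u w / u x') = Arg2pi 1"
      then have "u w / u x' = 1" using that W(3) by (intro Arg2pi_unit_inj) (auto simp: norm_divide)
      then show False using that W(2) nz by (auto dest: inj_onD)
    qed
    then show ?thesis using Arg2pi_ge_0[of "u w / u x'"] by (auto simp: Arg2pi_of_real[of 1, simplified])
  qed
  \<comment> \<open>Division by \<open>u y / u x\<close> lowers the angle by that of
    \<open>u y / u x\<close>, with 2 pi added if the result is negative. The angle of
    \<open>u x / u y\<close> is the threshold that is reached exactly when this wrap-around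
    occurs.\<close>
  have iff: "Arg2pi (u w / u y) < Arg2pi (u x / u y) \<longleftrightarrow> \<not> Arg2pi (u w / u x) < Arg2pi (u y / u x)"
    if w: "w \<in> W" "w \<noteq> x" "w \<noteq> y" for w
  proof -
    define \<alpha> \<beta> where "\<alpha> = u w / u x" and "\<beta> = u y / u x"
    have nz': "\<alpha> \<noteq> 0" "\<beta> \<noteq> 0" using nz w xy by (auto simp: \<alpha>_def \<beta>_def)
    have e: "u w / u y = \<alpha> / \<beta>" "u x / u y = 1 / \<beta>" using nz w xy by (auto simp: \<alpha>_def \<beta>_def)
    have pos: "Arg2pi \<beta> > 0" "Arg2pi \<alpha> > 0" unfolding \<alpha>_def \<beta>_def using Arg_pos w xy by auto
    have 1: "Arg2pi (1 / \<beta>) = 2 * pi - Arg2pi \<beta>"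
      using Arg2pi_diff[of 1 \<beta>] nz' pos Arg2pi_of_real[of 1] by (auto split: if_splits)
    have 2: "Arg2pi \<alpha> - Arg2pi \<beta> = (if Arg2pi \<beta> \<le> Arg2pi \<alpha> then Arg2pi (\<alpha> / \<beta>) else Arg2pi (\<alpha> / \<beta>) - 2*pi)"
      using Arg2pi_diff[of \<alpha> \<beta>] nz' by auto
    show ?thesis
      unfolding e 1 using 2 pos Arg2pi_lt_2pi[of \<alpha>] unfolding \<alpha>_def[symmetric] \<beta>_def[symmetric] by (auto split: if_splits)
  qed
  have un: "?A \<union> ?B = W - {x, y}" and disj: "?A \<inter> ?B = {}"
    using iff by auto
  have "finite ?A" "finite ?B" using W(1) by auto
  from card_Un_disjoint[OF this disj] have "card ?A + card ?B = card (W - {x, y})" unfolding un by (rule sym)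
  also have "\<dots> = card W - 2" using xy W(1) by (simp add: card_Diff_subset)
  finally show ?thesis by (simp add: ccw_rank_def)
qed

lemma sin_neg_cases:
  assumes "sin x < 0" "-2*pi < x" "x < 2*pi"
  shows "(-pi < x \<and> x < 0) \<or> (pi < x)"
  using assms sin_ge_zero[of x] sin_ge_zero[of "x + 2*pi"] by force

lemma sin_pos_cases:
  assumes "sin x > 0" "-2*pi < x" "x < 2*pi"
  shows "(0 < x \<and> x < pi) \<or> (x < -pi)"
  using sin_neg_cases[of "-x"] assms by auto

text \<open>
  The ray of direction \<open>\<mu>\<close> lies in the counterclockwise sector from \<open>u a\<close> to \<open>u b\<close> and makes an angle below
  \<open>\<pi>\<close> with both sides, so segments from it to the two sides stay inside the sector.
\<close>

lemma sector_direction: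
  assumes W: "finite W" "inj_on u W" "\<And>w. w \<in> W \<Longrightarrow> cmod (u w) = 1" and ab: "a \<in> W" "b \<in> W" "a \<noteq> b"
  obtains \<mu> where "cmod \<mu> = 1" "\<mu> \<notin> u ` W" "Im (cnj \<mu> * u a) < 0" "Im (cnj \<mu> * u b) > 0"
    "\<And>w c s c1 c2. w \<in> W \<Longrightarrow> c \<in> {a,b} \<Longrightarrow> s > 0 \<Longrightarrow> c1 > 0 \<Longrightarrow> c2 > 0 \<Longrightarrow>
       of_real s * u w = of_real c1 * \<mu> + of_real c2 * u c \<Longrightarrow>
       w \<in> W - {a} \<and> Arg2pi (u w / u a) < Arg2pi (u b / u a)"
proof -
  define k where "k w = Arg2pi (u w / u a)" for w
  define \<theta> where "\<theta> = k b"
  have nz: "u w \<noteq> 0" if "w \<in> W" for w using W(3)[OF that] by auto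
  have uk: "u w = u a * cis (k w)" if "w \<in> W" for w
  proof -
    have "u w / u a = cis (k w)"
      unfolding k_def using Arg2pi_eq[of "u w / u a"] W(3) that ab by (simp add: norm_divide cis_conv_exp)
    then show ?thesis using nz[OF ab(1)] by (simp add: field_simps)
  qed
  have k: "0 \<le> k w" "k w < 2*pi" for w by (auto simp: k_def Arg2pi_ge_0 Arg2pi_lt_2pi)
  have \<theta>: "0 < \<theta>" "\<theta> < 2*pi"
  proof -
    have "\<theta> \<noteq> 0"
    proof
      assume "\<theta> = 0"
      then have "u b = u a" using uk[OF ab(2)] by (simp add: \<theta>_def)
      then show False using ab W(2) by (auto dest: inj_onD)
    qed
    then show "0 < \<theta>" "\<theta> < 2*pi" using k[of b] by (auto simp: \<theta>_def)
  qed
  \<comment> \<open>\<open>\<beta>\<close> between 0 and \<open>\<theta>\<close> puts the ray into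
    the sector; \<open>\<theta> - pi < \<beta> < pi\<close> keeps both angles to the sides below pi.
    The interval is infinite, so the finitely many directions in \<open>W\<close> can be
    avoided.\<close>
  have "max 0 (\<theta> - pi) < min \<theta> pi" using \<theta> by auto
  then have "infinite {max 0 (\<theta> - pi)<..<min \<theta> pi}" by (rule infinite_Ioo)
  then have "infinite ({max 0 (\<theta> - pi)<..<min \<theta> pi} - k ` W)" using W(1) by (simp add: Diff_infinite_finite)
  then obtain \<beta> where \<beta>0: "\<beta> \<in> {max 0 (\<theta> - pi)<..<min \<theta> pi} - k ` W" by (metis ex_in_conv finite.emptyI)
  then have \<beta>: "0 < \<beta>" "\<beta> < pi" "\<beta> < \<theta>" "\<theta> - \<beta> < pi" "\<beta> \<notin> k ` W" by auto
  define \<mu> where "\<mu> = u a * cis \<beta>"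
  have uu: "cnj (u a) * u a = 1"
    using complex_norm_square[of "u a"] W(3)[OF ab(1)] by (simp add: mult.commute)
  have cross: "cnj (u a * cis x) * (u a * cis y) = cis (y - x)" for x y
  proof -
    have "cnj (u a * cis x) * (u a * cis y) = (cnj (u a) * u a) * (cnj (cis x) * cis y)" by simp
    also have "\<dots> = cis (y - x)" unfolding uu by (simp add: cis_cnj cis_mult)
    finally show ?thesis .
  qed
  show thesis
  proof (rule that[of \<mu>])
    show "cmod \<mu> = 1" using W(3)[OF ab(1)] by (simp add: \<mu>_def norm_mult)
    show "\<mu> \<notin> u ` W"
    proof
      assume "\<mu> \<in> u ` W"
      then obtain w where w: "w \<in> W" "\<mu> = u w" by auto
      then have "cis \<beta> = cis (k w)" using uk[OF w(1)] nz[OF ab(1)] by (simp add: \<mu>_def)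
      then have "Arg2pi (cis \<beta>) = Arg2pi (cis (k w))" by simp
      then have "\<beta> = k w" using \<beta> k[of w] Arg2pi_unique[of 1 \<beta>] Arg2pi_unique[of 1 "k w"] by (simp add: cis_conv_exp)
      then show False using \<beta> w by auto
    qed
    have ua: "u a = u a * cis 0" by simp
    show "Im (cnj \<mu> * u a) < 0"
      by (subst ua, unfold \<mu>_def cross) (use \<beta> in \<open>simp add: sin_gt_zero\<close>)
    show "Im (cnj \<mu> * u b) > 0"
      by (subst uk[OF ab(2)], unfold \<mu>_def cross) (use \<beta> in \<open>simp add: sin_gt_zero \<theta>_def\<close>)
    fix w c and s c1 c2 :: real assume w: "w \<in> W" and c: "c \<in> {a,b}" and pos: "s > 0" "c1 > 0" "c2 > 0"
      and eq: "of_real s * u w = of_real c1 * \<mu> + of_real c2 * u c"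
    define \<kappa> where "\<kappa> = k c"
    have c': "c \<in> W" using c ab by auto
    \<comment> \<open>The cross product of the equation with the direction of angle
      \<open>x\<close>. If \<open>x\<close> is the angle of one of the two rays on the right, its
      term vanishes and the sign of the other tells on which side of that ray \<open>u w\<close>
      lies.\<close>
    have rot: "s * sin (k w - x) = c1 * sin (\<beta> - x) + c2 * sin (\<kappa> - x)" for x
    proof -
      have "of_real s * cis (k w - x) = cnj (u a * cis x) * (of_real s * u w)"
        by (subst uk[OF w], subst cross[symmetric]) (simp add: mult_ac)
      also have "\<dots> = cnj (u a * cis x) * (of_real c1 * \<mu> + of_real c2 * u c)"
        unfolding eq ..
      also have "\<dots> = of_real c1 * cis (\<beta> - x) + of_real c2 * cis (\<kappa> - x)"
        unfolding \<mu>_def \<kappa>_def by (subst uk[OF c'], subst (1 2) cross[symmetric]) (simp add: algebra_simps)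
      finally have "Im (of_real s * cis (k w - x)) = Im (of_real c1 * cis (\<beta> - x) + of_real c2 * cis (\<kappa> - x))"
        by (rule arg_cong)
      then show ?thesis by simp
    qed
    have "0 < k w \<and> k w < \<theta>"
    proof (cases "c = a")
      case True
      then have "\<kappa> = 0" unfolding \<kappa>_def k_def using nz[OF ab(1)] Arg2pi_of_real[of 1] by simp
      have "s * sin (k w) > 0" using rot[of 0] \<beta> pos \<open>\<kappa> = 0\<close> by (simp add: sin_gt_zero)
      then have "sin (k w) > 0" using pos by (simp add: zero_less_mult_iff)
      then have 1: "0 < k w" "k w < pi" using sin_pos_cases[of "k w"] k[of w] pi_gt_zero by auto
      have "s * sin (k w - \<beta>) < 0" using rot[of \<beta>] \<beta> pos \<open>\<kappa> = 0\<close> by (simp add: sin_gt_zero)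
      then have "sin (k w - \<beta>) < 0" using pos by (simp add: mult_less_0_iff)
      then have "k w < \<beta>" using sin_neg_cases[of "k w - \<beta>"] 1 \<beta> by auto
      then show ?thesis using 1 \<beta> by auto
    next
      case False
      then have [simp]: "\<kappa> = \<theta>" using c by (simp add: \<kappa>_def \<theta>_def)
      have "s * sin (k w - \<beta>) > 0" using rot[of \<beta>] \<beta> pos by (simp add: sin_gt_zero)
      then have "sin (k w - \<beta>) > 0" using pos by (simp add: zero_less_mult_iff)
      then have 1: "\<beta> < k w" "k w - \<beta> < pi" using sin_pos_cases[of "k w - \<beta>"] k[of w] \<beta> by auto
      have "sin (\<beta> - \<theta>) < 0" using \<beta> sin_gt_zero[of "\<theta> - \<beta>"] sin_minus[of "\<theta> - \<beta>"] by simp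
      then have "s * sin (k w - \<theta>) < 0" using rot[of \<theta>] pos by (simp add: mult_less_0_iff)
      then have "sin (k w - \<theta>) < 0" using pos by (simp add: mult_less_0_iff)
      then have "k w < \<theta>" using sin_neg_cases[of "k w - \<theta>"] 1 \<beta> \<theta> k[of w] by auto
      then show ?thesis using 1 \<beta> by auto
    qed
    moreover have "k a = 0" unfolding k_def using nz[OF ab(1)] Arg2pi_of_real[of 1] by simp
    ultimately show "w \<in> W - {a} \<and> Arg2pi (u w / u a) < Arg2pi (u b / u a)"
      using w by (auto simp: k_def \<theta>_def)
  qed
qed

section \<open>Discs around a vertex\<close>

lemma vertex_not_multiple:
  assumes "drawing G p \<gamma>" "v \<in> fst G"
  shows "p v \<notin> multiple_points G p \<gamma>"
proof
  assume "p v \<in> multiple_points G p \<gamma>"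
  then have "transversal_double_point G p \<gamma> (p v)" using assms by (auto simp: drawing_def)
  then obtain e s f t where "fibre G p \<gamma> (p v) = {Inner e s, Inner f t}"
    unfolding transversal_double_point_def by blast
  moreover have "Vertex v \<in> fibre G p \<gamma> (p v)" using assms by (simp add: Vertex_in_fibre_iff)
  ultimately show False by auto
qed

lemma drawing_vertex_inj:
  assumes "drawing G p \<gamma>" "u \<in> fst G" "v \<in> fst G" "p u = p v"
  shows "u = v"
proof (rule ccontr)
  assume "u \<noteq> v"
  then have "p v \<in> multiple_points G p \<gamma>"
    unfolding multiple_points_iff using assms
    by (intro bexI[of _ "Vertex u"] bexI[of _ "Vertex v"]) (auto simp: Vertex_in_fibre_iff)
  then show False using vertex_not_multiple[OF assms(1,3)] by simp
qed

lemma drawing_edge_avoids_vertex: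
  assumes D: "drawing G p \<gamma>" and "e \<in> snd G" "e \<subseteq> fst G" "v \<in> fst G" "v \<notin> e" "t \<in> {0..1}"
  shows "\<gamma> e t \<noteq> p v"
proof
  assume eq: "\<gamma> e t = p v"
  obtain x y where xy: "e = {x,y}" "\<gamma> e 0 = p x" "\<gamma> e 1 = p y"
    using D assms(2) by (auto simp: drawing_def pathstart_def pathfinish_def)
  have "p x \<noteq> p v" "p y \<noteq> p v"
    using drawing_vertex_inj[OF D _ assms(4)] xy(1) assms(3,5) by blast+
  then have "t \<noteq> 0" "t \<noteq> 1" using eq xy by auto
  then have "Inner e t \<in> fibre G p \<gamma> (p v)" using assms eq by (auto simp: Inner_in_fibre_iff)
  then have "p v \<in> multiple_points G p \<gamma>"
    unfolding multiple_points_iff using assms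
    by (intro bexI[of _ "Inner e t"] bexI[of _ "Vertex v"]) (auto simp: Vertex_in_fibre_iff)
  then show False using vertex_not_multiple[OF D assms(4)] by simp
qed

text \<open>The other vertices, the edges not at \<open>v\<close> and the crossings form a closed
  set, a finite union of compact ones, that misses \<open>p v\<close>. Only edges at
  \<open>v\<close> can enter the disc.\<close>

lemma clear_disc:
  assumes D: "drawing G p \<gamma>" and fin: "finite (fst G)" "finite (snd G)"
    and sub: "\<And>e. e \<in> snd G \<Longrightarrow> e \<subseteq> fst G" and v: "v \<in> fst G"
  obtains r where "r > 0" "\<And>w. w \<in> fst G - {v} \<Longrightarrow> r < dist (p v) (p w)"
    "\<And>e t. e \<in> snd G \<Longrightarrow> v \<notin> e \<Longrightarrow> t \<in> {0..1} \<Longrightarrow> r < dist (p v) (\<gamma> e t)"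
    "\<And>z. z \<in> multiple_points G p \<gamma> \<Longrightarrow> r < dist (p v) z"
proof -
  define C where "C = p ` (fst G - {v}) \<union> (\<Union>e\<in>{e \<in> snd G. v \<notin> e}. path_image (\<gamma> e)) \<union> multiple_points G p \<gamma>"
  have "closed C"
    unfolding C_def using D fin
    by (intro closed_Un closed_UN finite_imp_closed finite_imageI finite_Diff)
       (auto simp: drawing_def closed_path_image finite_imp_closed)
  moreover have "p v \<notin> C"
  proof -
    have "p v \<notin> p ` (fst G - {v})" using drawing_vertex_inj[OF D v] by auto
    moreover have "p v \<notin> path_image (\<gamma> e)" if "e \<in> snd G" "v \<notin> e" for e
      using drawing_edge_avoids_vertex[OF D that(1) sub[OF that(1)] v that(2)] by (force simp: path_image_def)
    ultimately show ?thesis using vertex_not_multiple[OF D v] by (auto simp: C_def)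
  qed
  ultimately obtain d where d: "d > 0" "ball (p v) d \<subseteq> - C"
    using open_contains_ball[of "- C"] by (auto simp: open_Compl)
  then have far: "d / 2 < dist (p v) z" if "z \<in> C" for z
    using that by (force simp: subset_iff)
  show thesis
  proof (rule that[of "d / 2"])
    show "d / 2 > 0" using d by simp
    show "d / 2 < dist (p v) (p w)" if "w \<in> fst G - {v}" for w
      using that by (intro far) (auto simp: C_def)
    show "d / 2 < dist (p v) (\<gamma> e t)" if "e \<in> snd G" "v \<notin> e" "t \<in> {0..1}" for e t
      using that by (intro far) (auto simp: C_def path_image_def)
    show "d / 2 < dist (p v) z" if "z \<in> multiple_points G p \<gamma>" for z
      using that by (intro far) (auto simp: C_def)
  qed
qed

text \<open>An edge may return to the disc infinitely often, so a first exit would not separate it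
  from the disc. The last time in the closed disc exists by compactness, and lies on the circle by
  the intermediate value theorem.\<close>

lemma last_exit:
  fixes g :: "real \<Rightarrow> complex"
  assumes g: "path g" "r > 0" "r < dist (g 0) (g 1)"
  obtains T where "0 < T" "T < 1" "dist (g 0) (g T) = r" "\<And>t. T < t \<Longrightarrow> t \<le> 1 \<Longrightarrow> r < dist (g 0) (g t)"
proof -
  define f where "f t = dist (g 0) (g t)" for t
  have f: "continuous_on {0..1} f"
    unfolding f_def using g(1) by (auto simp: path_def intro!: continuous_intros)
  have "compact ({0..1} \<inter> f -` {..r})"
    by (metis f continuous_closed_preimage closed_atMost closed_real_atLeastAtMost compact_Icc compact_Int_closed Int_left_absorb)
  moreover have "0 \<in> {0..1} \<inter> f -` {..r}" using g by (auto simp: f_def)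
  ultimately obtain T where T: "T \<in> {0..1} \<inter> f -` {..r}" "\<And>t. t \<in> {0..1} \<inter> f -` {..r} \<Longrightarrow> t \<le> T"
    using compact_attains_sup[of "{0..1} \<inter> f -` {..r}"] by blast
  have f1: "f 1 > r" using g by (simp add: f_def)
  obtain t where t: "T \<le> t" "t \<le> 1" "f t = r"
    using IVT'[of f T r 1] T(1) f1 continuous_on_subset[OF f, of "{T..1}"] by auto
  then have "T = t" using T(2)[of t] T(1) by auto
  then have fT: "f T = r" using t by simp
  show thesis
  proof (rule that[of T])
    show "0 < T" using T(1) fT g by (cases "T = 0") (auto simp: f_def)
    show "T < 1" using T(1) fT f1 by (cases "T = 1") auto
    show "dist (g 0) (g T) = r" using fT by (simp add: f_def)
    show "r < dist (g 0) (g t)" if "T < t" "t \<le> 1" for t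
      using T(2)[of t] T(1) that by (force simp: f_def)
  qed
qed

section \<open>Splitting a vertex\<close>

text \<open>Beyond \<open>T\<close> the parametrisation is kept, so crossings outside the disc keep
  their parameters. The start \<open>c\<close> may differ from \<open>g 0\<close>: for the edges to
  \<open>a\<close> and \<open>b\<close> it will be the new vertex.\<close>

definition straighten :: "complex \<Rightarrow> (real \<Rightarrow> complex) \<Rightarrow> real \<Rightarrow> real \<Rightarrow> complex" where
  "straighten c g T t = (if t \<le> T then c + of_real (t / T) * (g T - c) else g t)"

lemma path_straighten:
  assumes "path g" "0 < T" "T < 1"
  shows "path (straighten c g T)"
proof -
  have "continuous_on ({0..T} \<union> {T..1}) (\<lambda>t. if t \<le> T then c + of_real (t / T) * (g T - c) else g t)"
  proof (rule continuous_on_If)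
    show "continuous_on {0..T} (\<lambda>t. c + of_real (t / T) * (g T - c))"
      using assms by (intro continuous_intros) auto
    show "continuous_on {T..1} g"
      using assms by (auto simp: path_def intro: continuous_on_subset)
  qed (use assms in auto)
  moreover have "{0..T} \<union> {T..1} = {0..1}" using assms by auto
  ultimately show ?thesis by (simp add: path_def straighten_def[abs_def])
qed

text \<open>
  The new vertex \<open>v\<close> is put near \<open>v0\<close>, in the sector between the edges to \<open>a\<close> and \<open>b\<close>. The edge from
  \<open>v0\<close> to \<open>w\<close> is \<open>g w\<close>, and \<open>T w\<close> is the time of its last exit from the disc of radius \<open>r\<close> around \<open>p v0\<close>;
  what precedes this time is replaced by a straight segment.
\<close>

locale vertex_split =
  fixes V :: "'a set" and p :: "'a \<Rightarrow> complex" and \<gamma> :: "'a set \<Rightarrow> real \<Rightarrow> complex"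
    and v0 v a b :: 'a and r :: real and g :: "'a \<Rightarrow> real \<Rightarrow> complex" and T :: "'a \<Rightarrow> real"
    and u :: "'a \<Rightarrow> complex" and \<mu> :: complex
  assumes D: "drawing (complete_graph V) p \<gamma>" and fin: "finite V" and v0: "v0 \<in> V" and v: "v \<notin> V"
    and ab: "a \<in> V - {v0}" "b \<in> V - {v0}" "a \<noteq> b"
    and r: "r > 0"
    and far_vertex: "\<And>w. w \<in> V - {v0} \<Longrightarrow> r < dist (p v0) (p w)"
    and far_edge: "\<And>e t. e \<in> nsets (V - {v0}) 2 \<Longrightarrow> t \<in> {0..1} \<Longrightarrow> r < dist (p v0) (\<gamma> e t)"
    and g: "\<And>w. w \<in> V - {v0} \<Longrightarrow> path (g w)" "\<And>w. w \<in> V - {v0} \<Longrightarrow> g w 0 = p v0" "\<And>w. w \<in> V - {v0} \<Longrightarrow> g w 1 = p w"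
    and g_\<gamma>: "\<And>w. w \<in> V - {v0} \<Longrightarrow> (\<forall>t. g w t = \<gamma> {v0,w} t) \<or> (\<forall>t. g w t = \<gamma> {v0,w} (1 - t))"
    and T: "\<And>w. w \<in> V - {v0} \<Longrightarrow> 0 < T w \<and> T w < 1"
    and exit: "\<And>w. w \<in> V - {v0} \<Longrightarrow> g w (T w) = p v0 + of_real r * u w"
    and after: "\<And>w t. w \<in> V - {v0} \<Longrightarrow> T w < t \<Longrightarrow> t \<le> 1 \<Longrightarrow> r < dist (p v0) (g w t)"
    and u_norm: "\<And>w. w \<in> V - {v0} \<Longrightarrow> cmod (u w) = 1" and u_inj: "inj_on u (V - {v0})"
    and \<mu>_norm: "cmod \<mu> = 1" and \<mu>_u: "\<mu> \<notin> u ` (V - {v0})"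
    and \<mu>_a: "Im (cnj \<mu> * u a) < 0" and \<mu>_b: "Im (cnj \<mu> * u b) > 0"
    and sector: "\<And>w c s c1 c2. w \<in> V - {v0} \<Longrightarrow> c \<in> {a,b} \<Longrightarrow> s > 0 \<Longrightarrow> c1 > 0 \<Longrightarrow> c2 > 0 \<Longrightarrow>
       of_real s * u w = of_real c1 * \<mu> + of_real c2 * u c \<Longrightarrow>
       w \<in> V - {v0} - {a} \<and> Arg2pi (u w / u a) < Arg2pi (u b / u a)"
begin

section \<open>The new drawing and its fibres\<close>

definition "W = V - {v0}"
definition "hub w = (if w \<in> {a,b} then v else v0)"
definition "new_pos = p v0 + of_real (r / 2) * \<mu>"
definition "q = p(v := new_pos)"
text \<open>Edges are bare sets, so for an edge from \<open>v\<close> or \<open>v0\<close> into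
  \<open>W\<close> the \<open>THE\<close> recovers its end in \<open>W\<close>; the other end is the
  hub of that end.\<close>

definition "\<delta> e = (if e = {v,v0} then linepath new_pos (p v0) else if e \<subseteq> W then \<gamma> e
  else (let w = (THE w. w \<in> e \<inter> W) in straighten (q (hub w)) (g w) (T w)))"
definition "edges = (\<lambda>w. {hub w, w}) ` W \<union> {{v,v0}} \<union> (nsets W 2 - {{a,b}})"
definition "H = (insert v V, edges)"

lemma v_notin_W: "v \<notin> W" "v0 \<notin> W" "v \<noteq> v0" using v v0 by (auto simp: W_def)

lemma ab_W: "a \<in> W" "b \<in> W" using ab by (auto simp: W_def)

lemma hub_notin_W: "hub w \<notin> W" using v_notin_W by (auto simp: hub_def)

lemma hub_edge_inj: "w \<in> W \<Longrightarrow> w' \<in> W \<Longrightarrow> {hub w, w} = {hub w', w'} \<longleftrightarrow> w = w'"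
  using hub_notin_W by (metis doubleton_eq_iff)

lemma q_simps: "q v = new_pos" "q v0 = p v0" "w \<in> W \<Longrightarrow> q w = p w"
  using v_notin_W by (auto simp: q_def)

lemma \<delta>_center: "\<delta> {v,v0} = linepath new_pos (p v0)" by (simp add: \<delta>_def)

lemma \<delta>_old: "e \<in> nsets W 2 \<Longrightarrow> \<delta> e = \<gamma> e"
  using v_notin_W by (auto simp: \<delta>_def nsets_def)

lemma \<delta>_star: "w \<in> W \<Longrightarrow> \<delta> {hub w, w} = straighten (q (hub w)) (g w) (T w)"
proof -
  assume w: "w \<in> W"
  have "{hub w, w} \<inter> W = {w}" using w hub_notin_W by auto
  then have "(THE w'. w' \<in> {hub w, w} \<inter> W) = w" by simp
  moreover have "{hub w, w} \<noteq> {v,v0}" "\<not> {hub w, w} \<subseteq> W" using w v_notin_W hub_notin_W[of w] by auto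
  ultimately show ?thesis unfolding \<delta>_def Let_def by (simp only: if_False)
qed

lemma star_near:
  assumes w: "w \<in> W" and t: "0 < t" "t \<le> T w"
  shows "\<delta> {hub w, w} t = p v0 + of_real r *
    (if w \<in> {a,b} then of_real ((1 - t / T w) / 2) * \<mu> + of_real (t / T w) * u w else of_real (t / T w) * u w)"
proof -
  have "g w (T w) = p v0 + of_real r * u w" using exit w by (simp add: W_def)
  then have "\<delta> {hub w, w} t = q (hub w) + of_real (t / T w) * (p v0 + of_real r * u w - q (hub w))"
    using t w by (simp add: \<delta>_star straighten_def)
  moreover have "c + R / 2 * m + l * (c + R * x - (c + R / 2 * m)) = c + R * ((1 - l) / 2 * m + l * x)"
    "c + l * (c + R * x - c) = c + R * (l * x)" for c R m l x :: complex
    by (simp_all add: field_simps)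
  moreover have "complex_of_real (r / 2) = of_real r / 2"
    "complex_of_real ((1 - t / T w) / 2) = (1 - complex_of_real (t / T w)) / 2" by simp_all
  moreover have "q (hub w) = (if w \<in> {a,b} then new_pos else p v0)" using q_simps by (simp add: hub_def)
  ultimately show ?thesis unfolding new_pos_def by (cases "w \<in> {a,b}") (simp_all only: if_True if_False)
qed

lemma star_near_dist:
  assumes w: "w \<in> W" and t: "0 < t" "t \<le> T w"
  shows "dist (p v0) (\<delta> {hub w, w} t) \<le> r"
proof -
  define l where "l = t / T w"
  have l: "0 < l" "l \<le> 1" using t T w by (auto simp: l_def W_def)
  define \<zeta> where "\<zeta> = (if w \<in> {a,b} then of_real ((1 - l) / 2) * \<mu> + of_real l * u w else of_real l * u w)"
  have uw: "cmod (u w) = 1" using u_norm w by (simp add: W_def)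
  have "cmod \<zeta> \<le> 1"
  proof (cases "w \<in> {a,b}")
    case True
    have "cmod (of_real ((1 - l) / 2) * \<mu> + of_real l * u w) \<le> (1 - l) / 2 + l"
      by (rule norm_triangle_le) (use l in \<open>simp add: norm_mult uw \<mu>_norm del: of_real_divide of_real_diff\<close>)
    moreover have "\<zeta> = of_real ((1 - l) / 2) * \<mu> + of_real l * u w" using True by (simp only: \<zeta>_def if_True)
    moreover have "(1 - l) / 2 + l \<le> 1" using l by (simp add: field_simps)
    ultimately show ?thesis by (metis order_trans)
  next
    case False
    then show ?thesis using l uw by (simp add: \<zeta>_def norm_mult)
  qed
  then have "r * cmod \<zeta> \<le> r" using r by (simp add: mult_left_le)
  moreover have "\<delta> {hub w, w} t = p v0 + of_real r * \<zeta>"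
    using star_near[OF assms] by (simp only: \<zeta>_def l_def)
  ultimately show ?thesis using r by (simp add: dist_norm norm_mult)
qed

lemma star_far:
  assumes w: "w \<in> W" and t: "T w < t" "t \<le> 1"
  shows "\<delta> {hub w, w} t = g w t" "r < dist (p v0) (\<delta> {hub w, w} t)"
  using assms after by (auto simp: \<delta>_star straighten_def W_def)

lemma center_eq: "\<delta> {v,v0} t = p v0 + of_real r * (of_real ((1 - t) / 2) * \<mu>)"
  by (simp add: \<delta>_center linepath_def new_pos_def scaleR_conv_of_real algebra_simps)

lemma center_dist:
  assumes "0 < t" "t < 1"
  shows "dist (p v0) (\<delta> {v,v0} t) \<le> r"
proof -
  have "cmod (of_real r * (of_real ((1 - t) / 2) * \<mu>)) = r * ((1 - t) / 2)"
    using assms r by (simp add: norm_mult \<mu>_norm del: of_real_divide of_real_diff)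
  also have "\<dots> \<le> r * 1" using assms r by (intro mult_left_mono) auto
  finally show ?thesis unfolding center_eq by (simp add: dist_norm)
qed

lemma fibre_H_cases:
  assumes "x \<in> fibre H q \<delta> z"
  obtains (v) "x = Vertex v" "z = new_pos"
  | (v0) "x = Vertex v0" "z = p v0"
  | (vertex) w where "w \<in> W" "x = Vertex w" "z = p w"
  | (center) t where "x = Inner {v,v0} t" "0 < t" "t < 1" "z = \<delta> {v,v0} t"
  | (star) w t where "w \<in> W" "x = Inner {hub w, w} t" "0 < t" "t < 1" "z = \<delta> {hub w, w} t"
  | (old) e t where "e \<in> nsets W 2" "e \<noteq> {a,b}" "x = Inner e t" "0 < t" "t < 1" "z = \<gamma> e t"
proof (cases x)
  case (Vertex y)
  then have "y \<in> insert v V" "q y = z" using assms by (auto simp: Vertex_in_fibre_iff H_def)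
  then consider "y = v" | "y = v0" | "y \<in> W" by (auto simp: W_def)
  then show ?thesis using that(1-3) Vertex \<open>q y = z\<close> q_simps by cases auto
next
  case (Inner e t)
  then have e: "e \<in> edges" "0 < t" "t < 1" "\<delta> e t = z" using assms by (auto simp: Inner_in_fibre_iff H_def)
  then consider w where "w \<in> W" "e = {hub w, w}" | "e = {v,v0}" | "e \<in> nsets W 2" "e \<noteq> {a,b}"
    by (auto simp: edges_def)
  then show ?thesis
  proof cases
    case 1
    then show ?thesis using that(5)[of w t] Inner e by auto
  next
    case 2
    then show ?thesis using that(4)[of t] Inner e by auto
  next
    case 3
    then show ?thesis using that(6)[of e t] Inner e \<delta>_old by auto
  qed
qed

section \<open>Outside the disc\<close>

definition flip :: "'a \<Rightarrow> real \<Rightarrow> real" where "flip w t = (if \<forall>t. g w t = \<gamma> {v0,w} t then t else 1 - t)"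

lemma g_flip: "w \<in> W \<Longrightarrow> g w t = \<gamma> {v0,w} (flip w t)"
  using g_\<gamma>[of w] by (auto simp: flip_def W_def)

lemma flip_inj: "flip w t = flip w t' \<longleftrightarrow> t = t'"
  by (auto simp: flip_def)

lemma flip_bounds: "0 < t \<Longrightarrow> t < 1 \<Longrightarrow> 0 < flip w t \<and> flip w t < 1"
  by (auto simp: flip_def)

lemma flip_add: "\<exists>\<sigma>\<in>{1,-1}. \<forall>x. flip w (t + x) = flip w t + \<sigma> * x"
  by (cases "\<forall>t. g w t = \<gamma> {v0,w} t") (auto simp: flip_def)

text \<open>Identifies the part of the new complex drawn outside the disc with a part of the old
  complex: the edges from \<open>v\<close> to \<open>a\<close> and \<open>b\<close> become edges
  from \<open>v0\<close> again, with the orientation corrected by \<open>flip\<close>.\<close>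

definition "back x = (case x of Vertex w \<Rightarrow> Vertex w | Inner e t \<Rightarrow>
  if e \<subseteq> W then Inner e t else (let w = (THE w. w \<in> e \<inter> W) in Inner {v0,w} (flip w t)))"

lemma back_star: "w \<in> W \<Longrightarrow> back (Inner {hub w, w} t) = Inner {v0,w} (flip w t)"
proof -
  assume w: "w \<in> W"
  have "{hub w, w} \<inter> W = {w}" using w hub_notin_W by auto
  then have "(THE w'. w' \<in> {hub w, w} \<inter> W) = w" by simp
  moreover have "\<not> {hub w, w} \<subseteq> W" using hub_notin_W[of w] by auto
  ultimately show ?thesis unfolding back_def Let_def by (simp only: complex_point.case if_False)
qed

lemma back_old: "e \<in> nsets W 2 \<Longrightarrow> back (Inner e t) = Inner e t"
  by (auto simp: back_def nsets_def)

lemma far_fibre_cases: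
  assumes "x \<in> fibre H q \<delta> z" "r < dist (p v0) z"
  obtains (vertex) w where "w \<in> W" "x = Vertex w" "z = p w" "back x = Vertex w"
  | (star) w t where "w \<in> W" "x = Inner {hub w, w} t" "T w < t" "t < 1" "z = g w t" "back x = Inner {v0,w} (flip w t)"
  | (old) e t where "e \<in> nsets W 2" "e \<noteq> {a,b}" "x = Inner e t" "0 < t" "t < 1" "z = \<gamma> e t" "back x = Inner e t"
  using assms(1)
proof (cases rule: fibre_H_cases)
  case v
  then show ?thesis using assms(2) r \<mu>_norm by (auto simp: new_pos_def dist_norm norm_mult)
next
  case v0
  then show ?thesis using assms(2) r by auto
next
  case (vertex w)
  then show ?thesis using that(1) by (auto simp: back_def)
next
  case (center t)
  then show ?thesis using center_dist[of t] assms(2) by auto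
next
  case (star w t)
  then have "T w < t" using star_near_dist[of w t] assms(2) by force
  then show ?thesis using star star_far[of w t] that(2)[of w t] back_star by auto
next
  case (old e t)
  then show ?thesis using that(3)[of e t] back_old by auto
qed

lemma star_edge_notin: "{v0,w} \<notin> nsets W 2"
  using v_notin_W by (auto simp: nsets_def)

text \<open>Outside the disc nothing new is drawn, so \<open>back\<close> satisfies the hypotheses
  of \<open>transversal_double_point_transfer\<close>. It is then onto the old fibre, but it never
  hits the edge \<open>ab\<close>; this is how the crossings on that edge disappear.\<close>

lemma far_multiple_points:
  assumes z: "z \<in> multiple_points H q \<delta>" "r < dist (p v0) z"
  shows "z \<in> multiple_points (complete_graph V) p \<gamma>" "transversal_double_point H q \<delta> z"
    "\<And>t. 0 < t \<Longrightarrow> t < 1 \<Longrightarrow> \<gamma> {a,b} t \<noteq> z"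
proof -
  let ?G = "complete_graph V"
  have W_V: "w \<in> V" "w \<noteq> v0" if "w \<in> W" for w using that by (auto simp: W_def)
  have old_V: "e \<in> nsets V 2" if "e \<in> nsets W 2" for e
    using that by (auto simp: W_def nsets_def)
  have star_V: "{v0,w} \<in> nsets V 2" if "w \<in> W" for w
    using that v0 by (auto simp: W_def nsets_def)
  have 1: "inj_on back (fibre H q \<delta> z)"
  proof (rule inj_onI)
    fix x y assume x: "x \<in> fibre H q \<delta> z" and y: "y \<in> fibre H q \<delta> z" and eq: "back x = back y"
    from x z(2) show "x = y"
    proof (cases rule: far_fibre_cases)
      case (vertex w)
      from y z(2) show ?thesis by (cases rule: far_fibre_cases) (use vertex eq in auto)
    next
      case (star w t)
      note s = star
      from y z(2) show ?thesis
      proof (cases rule: far_fibre_cases)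
        case (star w' t')
        then have "{v0,w} = {v0,w'}" "flip w t = flip w' t'" using s eq by auto
        then have "w = w'" "t = t'" using W_V s(1) star(1) by (auto simp: doubleton_eq_iff flip_inj)
        then show ?thesis using s star by simp
      next
        case (old e t')
        then show ?thesis using s eq star_edge_notin by auto
      qed (use s eq in auto)
    next
      case (old e t)
      note o = old
      from y z(2) show ?thesis
      proof (cases rule: far_fibre_cases)
        case (star w' t')
        then show ?thesis using o eq star_edge_notin by auto
      qed (use o eq in auto)
    qed
  qed
  have 2: "back ` fibre H q \<delta> z \<subseteq> fibre ?G p \<gamma> z - {Inner {a,b} t |t. True}"
  proof
    fix y assume "y \<in> back ` fibre H q \<delta> z"
    then obtain x where x: "x \<in> fibre H q \<delta> z" and y: "y = back x" by auto
    from x z(2) show "y \<in> fibre ?G p \<gamma> z - {Inner {a,b} t |t. True}"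
    proof (cases rule: far_fibre_cases)
      case (vertex w)
      then show ?thesis using y W_V by (auto simp: Vertex_in_fibre_iff complete_graph_def)
    next
      case (star w t)
      have "0 < t" using star T[of w] by (auto simp: W_def)
      moreover have "{v0,w} \<noteq> {a,b}" using ab_W v_notin_W by (auto simp: doubleton_eq_iff)
      ultimately show ?thesis
        using star y star_V flip_bounds[of t w] g_flip[of w t] by (auto simp: Inner_in_fibre_iff complete_graph_def)
    next
      case (old e t)
      then show ?thesis using y old_V by (auto simp: Inner_in_fibre_iff complete_graph_def)
    qed
  qed
  have 3: "\<exists>y. back (Vertex w) = Vertex y" for w by (simp add: back_def)
  have 4: "\<exists>\<epsilon>>0. \<exists>\<sigma>\<in>{1,-1}. \<forall>x. \<bar>x\<bar> < \<epsilon> \<longrightarrow> \<delta> e' (s' + x) = \<gamma> e (s + \<sigma> * x)"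
    if x: "Inner e' s' \<in> fibre H q \<delta> z" and eq: "back (Inner e' s') = Inner e s" for e' s' e s
    using x z(2)
  proof (cases rule: far_fibre_cases)
    case (star w t)
    then have e: "e' = {hub w, w}" "s' = t" "e = {v0,w}" "s = flip w t" using eq by auto
    obtain \<sigma> where \<sigma>: "\<sigma> \<in> {1,-1}" "\<And>x. flip w (t + x) = flip w t + \<sigma> * x" using flip_add by blast
    show ?thesis
    proof (intro exI[of _ "min (t - T w) (1 - t)"] conjI bexI[OF _ \<sigma>(1)] allI impI)
      fix x :: real assume "\<bar>x\<bar> < min (t - T w) (1 - t)"
      then have "\<delta> {hub w, w} (t + x) = g w (t + x)" using star by (intro star_far(1)) auto
      then show "\<delta> e' (s' + x) = \<gamma> e (s + \<sigma> * x)" using \<sigma>(2) g_flip star e by simp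
    qed (use star in auto)
  next
    case (old e2 t)
    then have "\<delta> e' = \<gamma> e" "s' = s" using eq \<delta>_old by auto
    then show ?thesis by (intro exI[of _ 1] conjI bexI[of _ 1]) auto
  qed auto
  from 2 have back_sub: "back ` fibre H q \<delta> z \<subseteq> fibre ?G p \<gamma> z" by auto
  show "z \<in> multiple_points ?G p \<gamma>"
    by (rule transversal_double_point_transfer(1)[OF D z(1) 1 back_sub]) (use 3 4 in blast)+
  have onto: "back ` fibre H q \<delta> z = fibre ?G p \<gamma> z"
    by (rule transversal_double_point_transfer(2)[OF D z(1) 1 back_sub]) (use 3 4 in blast)+
  show "transversal_double_point H q \<delta> z"
    by (rule transversal_double_point_transfer(3)[OF D z(1) 1 back_sub]) (use 3 4 in blast)+
  show "\<gamma> {a,b} t \<noteq> z" if "0 < t" "t < 1" for t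
  proof
    assume "\<gamma> {a,b} t = z"
    then have "Inner {a,b} t \<in> fibre ?G p \<gamma> z"
      using that ab by (auto simp: Inner_in_fibre_iff complete_graph_def nsets_def)
    then have "Inner {a,b} t \<in> back ` fibre H q \<delta> z" using onto by simp
    then show False using 2 by auto
  qed
qed

section \<open>Inside the disc: axis, rays and sides\<close>

definition "J \<zeta> = Im (cnj \<mu> * \<zeta>)"

lemma J_add: "J (x + y) = J x + J y" by (simp add: J_def algebra_simps)

lemma J_mult: "J (of_real k * x) = k * J x" by (simp add: J_def algebra_simps)

lemma J_\<mu>: "J \<mu> = 0" by (simp add: J_def)

text \<open>\<open>J\<close> is the signed distance from the line spanned by \<open>\<mu>\<close>.
  Its sign separates the edge to \<open>a\<close> from the edge to \<open>b\<close>, and its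
  vanishing characterises the axis.\<close>

lemma J_side: "J (u a) < 0" "J (u b) > 0" using \<mu>_a \<mu>_b by (simp_all add: J_def)

text \<open>The vertices \<open>v0\<close> and \<open>v\<close> and the edge between them form one
  segment and are treated as one kind of point. The edge is drawn from \<open>v\<close> (at
  \<open>k = 1/2\<close>) to \<open>v0\<close> (at \<open>k = 0\<close>), hence the parameter
  \<open>1 - 2 * k\<close>.\<close>

definition "on_axis z x k \<longleftrightarrow> 0 \<le> k \<and> z = p v0 + of_real r * (of_real k * \<mu>) \<and>
  x = (if k = 0 then Vertex v0 else if k = 1/2 then Vertex v else Inner {v,v0} (1 - 2 * k))"

definition "on_ray z x w l \<longleftrightarrow> w \<in> W - {a,b} \<and> 0 < l \<and> l \<le> 1 \<and> x = Inner {hub w, w} (l * T w) \<and>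
  z = p v0 + of_real r * (of_real l * u w)"

definition "on_side z x c m \<longleftrightarrow> c \<in> {a,b} \<and> 0 < m \<and> m \<le> 1 \<and> x = Inner {hub c, c} (m * T c) \<and>
  z = p v0 + of_real r * (of_real ((1 - m) / 2) * \<mu> + of_real m * u c)"

lemma T_pos: "w \<in> W \<Longrightarrow> 0 < T w" "w \<in> W \<Longrightarrow> T w < 1" using T by (auto simp: W_def)

lemma u_unit: "w \<in> W \<Longrightarrow> cmod (u w) = 1" using u_norm by (simp add: W_def)

text \<open>The other vertices, the edges within \<open>W\<close> and the parts of the edges after
  their last exits all stay outside the closed disc.\<close>

lemma near_fibre_cases:
  assumes "x \<in> fibre H q \<delta> z" "dist (p v0) z \<le> r"
  obtains (axis) k where "on_axis z x k" | (ray) w l where "on_ray z x w l" | (side) c m where "on_side z x c m"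
  using assms(1)
proof (cases rule: fibre_H_cases)
  case v
  then have "on_axis z x (1/2)" by (simp add: on_axis_def new_pos_def)
  then show ?thesis by (rule axis)
next
  case v0
  then have "on_axis z x 0" by (simp add: on_axis_def)
  then show ?thesis by (rule axis)
next
  case (vertex w)
  then show ?thesis using far_vertex[of w] assms(2) by (simp add: W_def)
next
  case (center t)
  moreover have "1 - 2 * ((1 - t) / 2) = t" by (simp add: field_simps)
  ultimately have "on_axis z x ((1 - t) / 2)" unfolding on_axis_def center_eq by simp
  then show ?thesis by (rule axis)
next
  case (star w t)
  have t: "t \<le> T w" using star star_far(2)[of w t] assms(2) by force
  have l: "0 < t / T w" "t / T w \<le> 1" "t = t / T w * T w" using T_pos[of w] star t by auto
  show ?thesis
  proof (cases "w \<in> {a,b}")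
    case True
    then have "on_side z x w (t / T w)" using star star_near[OF star(1,3) t] l by (simp add: on_side_def)
    then show ?thesis by (rule side)
  next
    case False
    then have "on_ray z x w (t / T w)" using star star_near[OF star(1,3) t] l by (simp add: on_ray_def)
    then show ?thesis by (rule ray)
  qed
next
  case (old e t)
  then show ?thesis using far_edge[of e t] assms(2) by (simp add: W_def)
qed

lemma r_cancel: "p v0 + of_real r * x = p v0 + of_real r * y \<longleftrightarrow> x = y"
  using r by simp

lemma axis_axis: "on_axis z x k \<Longrightarrow> on_axis z y k' \<Longrightarrow> x = y"
proof -
  assume A: "on_axis z x k" "on_axis z y k'"
  then have "of_real k * \<mu> = of_real k' * \<mu>" by (metis on_axis_def r_cancel)
  moreover have "\<mu> \<noteq> 0" using \<mu>_norm by auto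
  ultimately have "k = k'" by simp
  then show "x = y" using A by (simp add: on_axis_def)
qed

text \<open>Axis and ray both issue from \<open>p v0\<close>; equal length would force equal
  directions, and \<open>\<mu>\<close> differs from every \<open>u w\<close>.\<close>

lemma axis_ray: "on_axis z x k \<Longrightarrow> on_ray z y w l \<Longrightarrow> False"
proof -
  assume A: "on_axis z x k" "on_ray z y w l"
  then have eq: "of_real k * \<mu> = of_real l * u w" by (metis on_axis_def on_ray_def r_cancel)
  have w: "w \<in> W" and k: "0 \<le> k" "0 < l" using A by (auto simp: on_axis_def on_ray_def)
  have "cmod (of_real k * \<mu>) = cmod (of_real l * u w)" unfolding eq ..
  then have "k = l" using k \<mu>_norm u_unit[OF w] by (simp add: norm_mult)
  then have "\<mu> = u w" using eq k by simp
  then show False using \<mu>_u w by (auto simp: W_def)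
qed

lemma axis_side: "on_axis z x k \<Longrightarrow> on_side z y c m \<Longrightarrow> False"
proof -
  assume A: "on_axis z x k" "on_side z y c m"
  then have eq: "of_real k * \<mu> = of_real ((1 - m) / 2) * \<mu> + of_real m * u c" by (metis on_axis_def on_side_def r_cancel)
  have c: "c \<in> {a,b}" and m: "0 < m" using A by (auto simp: on_side_def)
  have "J (of_real k * \<mu>) = J (of_real ((1 - m) / 2) * \<mu> + of_real m * u c)" unfolding eq ..
  then have "m * J (u c) = 0" by (simp only: J_add J_mult J_\<mu>)
  then show False using m c J_side by auto
qed

lemma ray_ray: "on_ray z x w l \<Longrightarrow> on_ray z y w' l' \<Longrightarrow> x = y"
proof -
  assume A: "on_ray z x w l" "on_ray z y w' l'"
  then have eq: "of_real l * u w = of_real l' * u w'" by (metis on_ray_def r_cancel)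
  have w: "w \<in> W" "w' \<in> W" and l: "0 < l" "0 < l'" using A by (auto simp: on_ray_def)
  have "cmod (of_real l * u w) = cmod (of_real l' * u w')" unfolding eq ..
  then have "l = l'" using l u_unit w by (simp add: norm_mult)
  then have "u w = u w'" using eq l by simp
  then have "w = w'" using u_inj w by (auto simp: W_def dest: inj_onD)
  then show "x = y" using A \<open>l = l'\<close> by (simp add: on_ray_def)
qed

lemma side_side: "on_side z x c m \<Longrightarrow> on_side z y c' m' \<Longrightarrow> x = y"
proof -
  assume A: "on_side z x c m" "on_side z y c' m'"
  then have eq: "of_real ((1 - m) / 2) * \<mu> + of_real m * u c = of_real ((1 - m') / 2) * \<mu> + of_real m' * u c'"
    by (metis on_side_def r_cancel)
  have c: "c \<in> {a,b}" "c' \<in> {a,b}" and m: "0 < m" "0 < m'" using A by (auto simp: on_side_def)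
  have "J (of_real ((1 - m) / 2) * \<mu> + of_real m * u c) = J (of_real ((1 - m') / 2) * \<mu> + of_real m' * u c')" unfolding eq ..
  then have J: "m * J (u c) = m' * J (u c')" by (simp only: J_add J_mult J_\<mu>)
  have "c = c'"
  proof (rule ccontr)
    assume "c \<noteq> c'"
    then have "c = a \<and> c' = b \<or> c = b \<and> c' = a" using c by auto
    moreover have "m * J (u a) < 0" "m * J (u b) > 0" "m' * J (u a) < 0" "m' * J (u b) > 0"
      using m J_side by (auto simp: mult_less_0_iff)
    ultimately show False using J by auto
  qed
  moreover have "J (u c) \<noteq> 0" using c J_side by auto
  ultimately have "m = m'" using J by simp
  then show "x = y" using A \<open>c = c'\<close> by (simp add: on_side_def)
qed

definition "ray_side w l c m \<longleftrightarrow> w \<in> W - {a,b} \<and> c \<in> {a,b} \<and> 0 < l \<and> l < 1 \<and> 0 < m \<and> m < 1 \<and>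
  of_real l * u w = of_real ((1 - m) / 2) * \<mu> + of_real m * u c"

text \<open>On the circle a ray and a side cannot meet, as exit points are distinct. So both
  parameters are below 1, and both edges are straight on a whole neighbourhood of the crossing, as
  \<open>transversal_at_affine\<close> requires.\<close>

lemma ray_sideI:
  assumes A: "on_ray z x w l" "on_side z y c m"
  shows "ray_side w l c m"
proof -
  have eq: "of_real l * u w = of_real ((1 - m) / 2) * \<mu> + of_real m * u c"
    using A by (metis on_ray_def on_side_def r_cancel)
  have w: "w \<in> W - {a,b}" and c: "c \<in> {a,b}" and l: "0 < l" "l \<le> 1" and m: "0 < m" "m \<le> 1"
    using A by (auto simp: on_ray_def on_side_def)
  have cW: "c \<in> W" using c ab_W by auto
  have norm_l: "l = cmod (of_real ((1 - m) / 2) * \<mu> + of_real m * u c)"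
    unfolding eq[symmetric] using l u_unit w by (simp add: norm_mult)
  have "m \<noteq> 1"
  proof
    assume "m = 1"
    then have "l = 1" using norm_l u_unit[OF cW] by simp
    then have "u w = u c" using eq \<open>m = 1\<close> by simp
    then have "w = c" using u_inj w cW by (auto simp: W_def dest: inj_onD)
    then show False using w c by auto
  qed
  then have m1: "m < 1" using m by simp
  have "cmod (of_real ((1 - m) / 2) * \<mu> + of_real m * u c) \<le> (1 - m) / 2 + m"
    by (rule norm_triangle_le)
      (use m in \<open>simp add: norm_mult u_unit[OF cW] \<mu>_norm del: of_real_divide of_real_diff\<close>)
  then have "l < 1" using norm_l m1 by (simp add: field_simps)
  then show ?thesis using w c l m m1 eq by (simp add: ray_side_def)
qed

lemma ray_side_J:
  assumes "ray_side w l c m"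
  shows "l * J (u w) = m * J (u c)"
proof -
  have "J (of_real l * u w) = J (of_real ((1 - m) / 2) * \<mu> + of_real m * u c)"
    using assms by (simp add: ray_side_def)
  then show ?thesis by (simp only: J_add J_mult J_\<mu>)
qed

text \<open>A ray meets the two sides together at most once, so each direction in the sector costs
  at most one crossing. The sign of \<open>J (u w)\<close> decides which side can be met, and
  comparing coefficients of \<open>\<mu>\<close> and \<open>u c\<close> then fixes the
  point.\<close>

lemma ray_side_unique:
  assumes A: "ray_side w l c m" and B: "ray_side w l' c' m'"
  shows "l = l'"
proof -
  have c: "c \<in> {a,b}" "c' \<in> {a,b}" and l: "0 < l" "0 < l'" and m: "0 < m" "0 < m'"
    using A B by (auto simp: ray_side_def)
  have J: "l * J (u w) = m * J (u c)" "l' * J (u w) = m' * J (u c')"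
    using A B by (simp_all add: ray_side_J)
  have "c = c'"
  proof (rule ccontr)
    assume "c \<noteq> c'"
    then have "c = a \<and> c' = b \<or> c = b \<and> c' = a" using c by auto
    moreover have "m * J (u a) < 0" "m * J (u b) > 0" "m' * J (u a) < 0" "m' * J (u b) > 0"
      using m J_side by (auto simp: mult_less_0_iff)
    ultimately have "l * J (u w) < 0 \<and> l' * J (u w) > 0 \<or> l * J (u w) > 0 \<and> l' * J (u w) < 0"
      using J by auto
    then show False using l by (auto simp: zero_less_mult_iff mult_less_0_iff)
  qed
  have Jc: "J (u c) \<noteq> 0" using c J_side by auto
  have "l' * (m * J (u c)) = l * (m' * J (u c))" using J \<open>c = c'\<close> by (metis mult.left_commute)
  then have lm: "l' * m = l * m'" using Jc by simp
  have "of_real l' * (of_real l * u w) = of_real l * (of_real l' * u w)" by simp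
  then have "of_real l' * (of_real ((1 - m) / 2) * \<mu> + of_real m * u c) = of_real l * (of_real ((1 - m') / 2) * \<mu> + of_real m' * u c)"
    using A B \<open>c = c'\<close> by (simp only: ray_side_def)
  then have "of_real (l' * (1 - m) / 2 - l * (1 - m') / 2) * \<mu> + of_real (l' * m - l * m') * u c = 0"
    by (simp add: algebra_simps diff_divide_distrib)
  then have "l' * (1 - m) / 2 - l * (1 - m') / 2 = 0"
    using lm \<mu>_norm by (auto simp del: of_real_diff of_real_mult of_real_divide)
  then have "l' * (1 - m) = l * (1 - m')" by simp
  then show "l = l'" using lm by (simp add: algebra_simps)
qed

lemma star_affine:
  assumes "w \<in> W" "t \<le> T w" "t + x \<le> T w"
  shows "\<delta> {hub w, w} (t + x) = \<delta> {hub w, w} t + of_real x * ((g w (T w) - q (hub w)) / of_real (T w))"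
proof -
  have "complex_of_real ((t + x) / T w) * d = of_real (t / T w) * d + of_real x * (d / of_real (T w))" for d
    by (simp add: add_divide_distrib distrib_right)
  then show ?thesis using assms by (simp add: \<delta>_star straighten_def del: of_real_divide)
qed

lemma ray_side_transversal:
  assumes A: "ray_side w l c m" and z: "z = p v0 + of_real r * (of_real l * u w)"
  shows "transversal_at (\<delta> {hub w, w}) (l * T w) (\<delta> {hub c, c}) (m * T c)"
proof -
  have w: "w \<in> W" "w \<notin> {a,b}" and c: "c \<in> {a,b}" and l: "0 < l" "l < 1" and m: "0 < m" "m < 1"
    and eq: "of_real l * u w = of_real ((1 - m) / 2) * \<mu> + of_real m * u c"
    using A by (auto simp: ray_side_def)
  have cW: "c \<in> W" using c ab_W by auto
  have lT: "0 < l * T w" "l * T w < T w" and mT: "0 < m * T c" "m * T c < T c"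
    using T_pos w cW l m by auto
  have gw: "g w (T w) - q (hub w) = of_real r * u w"
    using exit w by (simp add: W_def hub_def q_simps)
  have gc: "g c (T c) - q (hub c) = of_real r * (u c - \<mu> / 2)"
    using exit[of c] c cW by (simp add: W_def hub_def q_simps new_pos_def algebra_simps)
  have zw: "\<delta> {hub w, w} (l * T w) = z"
    using star_near[OF w(1) lT(1) less_imp_le[OF lT(2)]] w T_pos[OF w(1)] by (simp add: z)
  have zc: "\<delta> {hub c, c} (m * T c) = z"
    using star_near[OF cW mT(1) less_imp_le[OF mT(2)]] c T_pos[OF cW] eq z
    by (simp del: of_real_divide of_real_diff)
  define \<epsilon> where "\<epsilon> = min (T w - l * T w) (T c - m * T c)"
  show ?thesis
  proof (rule transversal_at_affine)
    show "\<epsilon> > 0" using lT mT by (simp add: \<epsilon>_def)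
    show "0 < l * T w" "l * T w < 1" "0 < m * T c" "m * T c < 1"
      using lT(1) mT(1) less_trans[OF lT(2) T_pos(2)[OF w(1)]] less_trans[OF mT(2) T_pos(2)[OF cW]] by auto
    show "\<delta> {hub w, w} (l * T w + x) = z + of_real x * (of_real r * u w / of_real (T w))" if "\<bar>x\<bar> < \<epsilon>" for x
    proof -
      have "l * T w \<le> T w" "l * T w + x \<le> T w" using that lT(2) by (auto simp: \<epsilon>_def)
      from star_affine[OF w(1) this] show ?thesis unfolding gw zw .
    qed
    show "\<delta> {hub c, c} (m * T c + x) = z + of_real x * (of_real r * (u c - \<mu> / 2) / of_real (T c))" if "\<bar>x\<bar> < \<epsilon>" for x
    proof -
      have "m * T c \<le> T c" "m * T c + x \<le> T c" using that mT(2) by (auto simp: \<epsilon>_def)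
      from star_affine[OF cW this] show ?thesis unfolding gc zc .
    qed
    have Jw: "J (u w) \<noteq> 0"
      using ray_side_J[OF A] l m c J_side by auto
    show "Im (cnj (of_real r * u w / of_real (T w)) * (of_real r * (u c - \<mu> / 2) / of_real (T c))) \<noteq> 0"
    proof
      have s: "cnj (of_real r * u w / of_real (T w)) * (of_real r * (u c - \<mu> / 2) / of_real (T c))
        = of_real (r * r / (T w * T c)) * (cnj (u w) * (u c - \<mu> / 2))" by (simp add: mult_ac)
      assume "Im (cnj (of_real r * u w / of_real (T w)) * (of_real r * (u c - \<mu> / 2) / of_real (T c))) = 0"
      then have "r * r / (T w * T c) * Im (cnj (u w) * (u c - \<mu> / 2)) = 0"
        unfolding s by (simp only: Im_complex_of_real Re_complex_of_real times_complex.sel)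
      then have 0: "Im (cnj (u w) * (u c - \<mu> / 2)) = 0"
        using r T_pos[OF w(1)] T_pos[OF cW] by auto
      \<comment> \<open>If the side were parallel to the ray, then, since a point of the side lies
        on the line of the ray, its start \<open>\<mu> / 2\<close> would too, contradicting
        \<open>Jw\<close>.\<close>
      have "\<mu> / 2 + of_real m * (u c - \<mu> / 2) = of_real l * u w"
        unfolding eq by (simp add: field_simps)
      then have "Im (cnj (u w) * (\<mu> / 2 + of_real m * (u c - \<mu> / 2))) = Im (cnj (u w) * (of_real l * u w))" by simp
      also have "\<dots> = 0" by (simp add: algebra_simps)
      finally have "Im (cnj (u w) * \<mu>) / 2 + m * Im (cnj (u w) * (u c - \<mu> / 2)) = 0"
        by (simp add: algebra_simps)
      then have "Im (cnj (u w) * \<mu>) = 0" unfolding 0 by simp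
      then have "J (u w) = 0" by (simp add: J_def algebra_simps)
      then show False using Jw by simp
    qed
  qed
qed

lemma near_multiple_points:
  assumes z: "z \<in> multiple_points H q \<delta>" "dist (p v0) z \<le> r"
  obtains w l c m where "ray_side w l c m" "z = p v0 + of_real r * (of_real l * u w)"
    "transversal_double_point H q \<delta> z"
proof -
  obtain x y where xy: "x \<in> fibre H q \<delta> z" "y \<in> fibre H q \<delta> z" "x \<noteq> y"
    using z by (auto simp: multiple_points_iff)
  have kinds: "(\<exists>k. on_axis z x k) \<or> (\<exists>w l. on_ray z x w l) \<or> (\<exists>c m. on_side z x c m)"
    if "x \<in> fibre H q \<delta> z" for x
    using that z(2) by (rule near_fibre_cases) blast+
  have "(\<exists>w l. on_ray z x w l) \<and> (\<exists>c m. on_side z y c m) \<or> (\<exists>w l. on_ray z y w l) \<and> (\<exists>c m. on_side z x c m)"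
    using kinds[OF xy(1)] kinds[OF xy(2)] xy(3) axis_axis[of z] axis_ray[of z] axis_side[of z] ray_ray[of z] side_side[of z]
    by metis
  then obtain x y w l c m where xy: "x \<in> fibre H q \<delta> z" "y \<in> fibre H q \<delta> z"
    and rs: "on_ray z x w l" "on_side z y c m" using xy(1,2) by blast
  have "x' = x \<or> x' = y" if "x' \<in> fibre H q \<delta> z" for x'
    using kinds[OF that] rs ray_ray[of z] side_side[of z] axis_ray[of z] by metis
  then have fib: "fibre H q \<delta> z = {x, y}" using xy by auto
  have RS: "ray_side w l c m" using rs by (rule ray_sideI)
  have zz: "z = p v0 + of_real r * (of_real l * u w)" using rs by (simp add: on_ray_def)
  have "w \<in> W" "c \<in> W" "w \<noteq> c" using RS ab_W by (auto simp: ray_side_def)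
  then have "{hub w, w} \<noteq> {hub c, c}" using hub_edge_inj by blast
  moreover have "x = Inner {hub w, w} (l * T w)" "y = Inner {hub c, c} (m * T c)"
    using rs by (auto simp: on_ray_def on_side_def)
  ultimately have "Inner {hub w, w} (l * T w) \<noteq> Inner {hub c, c} (m * T c) \<and>
      fibre H q \<delta> z = {Inner {hub w, w} (l * T w), Inner {hub c, c} (m * T c)} \<and>
      transversal_at (\<delta> {hub w, w}) (l * T w) (\<delta> {hub c, c}) (m * T c)"
    using fib ray_side_transversal[OF RS zz] by simp
  then have "transversal_double_point H q \<delta> z"
    unfolding transversal_double_point_def by (intro exI)
  then show thesis using that RS zz by blast
qed

text \<open>New multiple points are old ones off the edge \<open>ab\<close>, or points
  \<open>f w\<close> with \<open>w\<close> in the sector, where \<open>f w\<close> is the unique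
  possible crossing on the ray of \<open>w\<close>. The count is stated additively to avoid
  truncated subtraction.\<close>

lemma drawing_H: "drawing H q \<delta>"
  and card_multiple_H: "card (multiple_points H q \<delta>) + card {z \<in> multiple_points (complete_graph V) p \<gamma>. \<exists>t. 0 < t \<and> t < 1 \<and> \<gamma> {a,b} t = z}
    \<le> card (multiple_points (complete_graph V) p \<gamma>) + ccw_rank u W a b"
proof -
  let ?M = "multiple_points (complete_graph V) p \<gamma>"
  let ?X = "{z \<in> ?M. \<exists>t. 0 < t \<and> t < 1 \<and> \<gamma> {a,b} t = z}"
  let ?S = "{w \<in> W - {a}. Arg2pi (u w / u a) < Arg2pi (u b / u a)}"
  define f where "f w = p v0 + of_real r * (of_real (THE l. \<exists>c m. ray_side w l c m) * u w)" for w
  have finM: "finite ?M" using D by (simp add: drawing_def)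
  have finS: "finite ?S" using fin by (simp add: W_def)
  have tdp: "transversal_double_point H q \<delta> z" and sub: "z \<in> (?M - ?X) \<union> f ` ?S"
    if z: "z \<in> multiple_points H q \<delta>" for z
  proof -
    have "transversal_double_point H q \<delta> z \<and> z \<in> (?M - ?X) \<union> f ` ?S"
    proof (cases "r < dist (p v0) z")
      case True
      then show ?thesis using far_multiple_points[OF z] by blast
    next
      case False
      then have d: "dist (p v0) z \<le> r" by simp
      obtain w l c m where RS: "ray_side w l c m" and zz: "z = p v0 + of_real r * (of_real l * u w)"
        and t: "transversal_double_point H q \<delta> z" by (rule near_multiple_points[OF z d])
      have "(THE l. \<exists>c m. ray_side w l c m) = l"
        using RS ray_side_unique by (intro the_equality) blast+
      then have "z = f w" using zz by (simp add: f_def)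
      moreover have "w \<in> V - {v0} - {a} \<and> Arg2pi (u w / u a) < Arg2pi (u b / u a)"
        by (rule sector[of w c l "(1 - m) / 2" m]) (use RS in \<open>auto simp: ray_side_def W_def\<close>)
      ultimately show ?thesis using t by (auto simp: W_def)
    qed
    then show "transversal_double_point H q \<delta> z" "z \<in> (?M - ?X) \<union> f ` ?S" by auto
  qed
  have fin': "finite ((?M - ?X) \<union> f ` ?S)" using finM finS by auto
  have sub': "multiple_points H q \<delta> \<subseteq> (?M - ?X) \<union> f ` ?S" using sub by blast
  have "card (multiple_points H q \<delta>) \<le> card ((?M - ?X) \<union> f ` ?S)" using fin' sub' by (rule card_mono)
  also have "\<dots> \<le> card (?M - ?X) + card (f ` ?S)" by (rule card_Un_le)
  also have "card (f ` ?S) \<le> ccw_rank u W a b" unfolding ccw_rank_def using finS by (rule card_image_le)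
  also have "card (?M - ?X) = card ?M - card ?X" using finM by (intro card_Diff_subset) auto
  finally show "card (multiple_points H q \<delta>) + card ?X \<le> card ?M + ccw_rank u W a b"
    using card_mono[OF finM, of ?X] by auto
  show "drawing H q \<delta>"
    unfolding drawing_def
  proof (intro conjI ballI)
    show "finite (multiple_points H q \<delta>)" using sub' fin' by (rule finite_subset)
    show "transversal_double_point H q \<delta> z" if "z \<in> multiple_points H q \<delta>" for z using that by (rule tdp)
    fix e assume "e \<in> snd H"
    then consider w where "w \<in> W" "e = {hub w, w}" | "e = {v,v0}" | "e \<in> nsets W 2"
      by (auto simp: H_def edges_def)
    then have "path (\<delta> e) \<and> (\<exists>x y. e = {x, y} \<and> pathstart (\<delta> e) = q x \<and> pathfinish (\<delta> e) = q y)"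
    proof cases
      case (1 w)
      have "path (\<delta> e)" using 1 g(1) T_pos by (simp add: \<delta>_star path_straighten W_def)
      moreover have "pathstart (\<delta> e) = q (hub w)" "pathfinish (\<delta> e) = q w"
        using 1 g(3)[of w] T_pos[of w] by (auto simp: \<delta>_star straighten_def pathstart_def pathfinish_def q_simps W_def)
      ultimately show ?thesis using 1 by blast
    next
      case 2
      then have "path (\<delta> e)" "pathstart (\<delta> e) = q v" "pathfinish (\<delta> e) = q v0" by (auto simp: \<delta>_center q_simps)
      then show ?thesis using 2 by blast
    next
      case 3
      then have "e \<in> nsets V 2" by (auto simp: nsets_def W_def)
      then obtain x y where "path (\<gamma> e)" "e = {x,y}" "pathstart (\<gamma> e) = p x" "pathfinish (\<gamma> e) = p y"
        using D by (auto simp: drawing_def complete_graph_def)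
      moreover have "q x = p x" "q y = p y" using 3 \<open>e = {x,y}\<close> q_simps(3) by (auto simp: nsets_def)
      ultimately show ?thesis unfolding \<delta>_old[OF 3] by (intro conjI exI[of _ x] exI[of _ y]) simp_all
    qed
    then show "path (\<delta> e)" "\<exists>x y. e = {x, y} \<and> pathstart (\<delta> e) = q x \<and> pathfinish (\<delta> e) = q y" by auto
  qed
qed

lemma H_eq: "H = (insert v V, (nsets V 2 - {{v0,a},{a,b},{b,v0}}) \<union> {{v,v0},{v,a},{v,b}})"
proof -
  have "edges = (nsets V 2 - {{v0,a},{a,b},{b,v0}}) \<union> {{v,v0},{v,a},{v,b}}"
  proof (intro equalityI subsetI)
    fix e assume "e \<in> edges"
    then consider w where "w \<in> W" "e = {hub w, w}" | "e = {v,v0}" | "e \<in> nsets W 2" "e \<noteq> {a,b}"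
      by (auto simp: edges_def)
    then show "e \<in> (nsets V 2 - {{v0,a},{a,b},{b,v0}}) \<union> {{v,v0},{v,a},{v,b}}"
    proof cases
      case 1
      then show ?thesis using v0 ab_W
        by (cases "w \<in> {a,b}") (auto simp: hub_def W_def doubleton_in_nsets_2 doubleton_eq_iff)
    next
      case 3
      then have "v0 \<notin> e" "e \<in> nsets V 2" by (auto simp: nsets_def W_def)
      then show ?thesis using 3 by auto
    qed auto
  next
    fix e assume "e \<in> (nsets V 2 - {{v0,a},{a,b},{b,v0}}) \<union> {{v,v0},{v,a},{v,b}}"
    then consider "e = {v,v0}" | "e = {v,a}" | "e = {v,b}" | "e \<in> nsets V 2" "e \<noteq> {v0,a}" "e \<noteq> {a,b}" "e \<noteq> {b,v0}" by auto
    then show "e \<in> edges"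
    proof cases
      case 2
      then have "e = {hub a, a}" by (simp add: hub_def)
      then show ?thesis using ab_W by (auto simp: edges_def)
    next
      case 3
      then have "e = {hub b, b}" by (simp add: hub_def)
      then show ?thesis using ab_W by (auto simp: edges_def)
    next
      case 4
      from 4(1) obtain x y where xy: "e = {x,y}" "x \<in> V" "y \<in> V" "x \<noteq> y" by (rule nsets2_E)
      show ?thesis
      proof (cases "v0 \<in> e")
        case True
        then obtain w where w: "e = {v0,w}" "w \<in> W" using xy by (auto simp: W_def insert_commute)
        then have "w \<noteq> a" "w \<noteq> b" using 4 by (auto simp: insert_commute)
        then have "e = {hub w, w}" using w by (simp add: hub_def)
        then show ?thesis using w by (auto simp: edges_def)
      next
        case False
        then have "e \<in> nsets W 2" using xy by (auto simp: W_def doubleton_in_nsets_2)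
        then show ?thesis using 4 by (auto simp: edges_def)
      qed
    qed (auto simp: edges_def)
  qed
  then show ?thesis by (simp add: H_def)
qed

end

section \<open>From an arbitrary drawing to the local picture\<close>

lemma multiple_pointsI:
  "x \<in> fibre G p \<gamma> z \<Longrightarrow> y \<in> fibre G p \<gamma> z \<Longrightarrow> x \<noteq> y \<Longrightarrow> z \<in> multiple_points G p \<gamma>"
  by (auto simp: multiple_points_iff)

text \<open>The order of quantifiers matters: \<open>u\<close> depends on \<open>v0\<close> alone
  and only \<open>\<mu>\<close> on \<open>a\<close> and \<open>b\<close>, so that all ranks at
  \<open>v0\<close> come from one cyclic order and \<open>bij_betw_ccw_rank\<close> applies to
  them.\<close>

lemma crossing_number_split:
  assumes D: "drawing (complete_graph V) p \<gamma>" and fin: "finite V" and v0: "v0 \<in> V"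
  obtains u where "inj_on u (V - {v0})" "\<And>w. w \<in> V - {v0} \<Longrightarrow> cmod (u w) = 1"
    "\<And>a b v. a \<in> V - {v0} \<Longrightarrow> b \<in> V - {v0} \<Longrightarrow> a \<noteq> b \<Longrightarrow> v \<notin> V \<Longrightarrow>
      \<exists>k. crossing_number (insert v V, (nsets V 2 - {{v0,a},{a,b},{b,v0}}) \<union> {{v,v0},{v,a},{v,b}}) \<le> enat k \<and>
        k + card {z \<in> multiple_points (complete_graph V) p \<gamma>. \<exists>t. 0 < t \<and> t < 1 \<and> \<gamma> {a,b} t = z}
        \<le> card (multiple_points (complete_graph V) p \<gamma>) + ccw_rank u (V - {v0}) a b"
proof -
  let ?G = "complete_graph V"
  have G: "fst ?G = V" "snd ?G = nsets V 2" by (simp_all add: complete_graph_def)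
  have fn: "finite (nsets V 2)" using fin by (rule finite_imp_finite_nsets)
  have sub: "e \<subseteq> V" if "e \<in> nsets V 2" for e using that by (simp add: nsets_def)
  have "\<exists>r>0. (\<forall>w\<in>V - {v0}. r < dist (p v0) (p w)) \<and>
      (\<forall>e\<in>nsets V 2. v0 \<notin> e \<longrightarrow> (\<forall>t\<in>{0..1}. r < dist (p v0) (\<gamma> e t))) \<and>
      (\<forall>z\<in>multiple_points ?G p \<gamma>. r < dist (p v0) z)"
  proof (rule clear_disc[OF D, of v0])
    fix r assume "r > 0" "\<And>w. w \<in> fst ?G - {v0} \<Longrightarrow> r < dist (p v0) (p w)"
      "\<And>e t. e \<in> snd ?G \<Longrightarrow> v0 \<notin> e \<Longrightarrow> t \<in> {0..1} \<Longrightarrow> r < dist (p v0) (\<gamma> e t)"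
      "\<And>z. z \<in> multiple_points ?G p \<gamma> \<Longrightarrow> r < dist (p v0) z"
    then show ?thesis unfolding G by (intro exI[of _ r] conjI ballI impI) simp_all
  qed (use fin fn sub v0 G in auto)
  then obtain r where r: "r > 0" and fv: "\<And>w. w \<in> V - {v0} \<Longrightarrow> r < dist (p v0) (p w)"
    and fe: "\<And>e t. e \<in> nsets V 2 \<Longrightarrow> v0 \<notin> e \<Longrightarrow> t \<in> {0..1} \<Longrightarrow> r < dist (p v0) (\<gamma> e t)"
    and fm: "\<And>z. z \<in> multiple_points ?G p \<gamma> \<Longrightarrow> r < dist (p v0) z" by metis
  define g where "g w = (if \<gamma> {v0,w} 0 = p v0 then \<gamma> {v0,w} else reversepath (\<gamma> {v0,w}))" for w
  have g: "path (g w) \<and> g w 0 = p v0 \<and> g w 1 = p w" if w: "w \<in> V - {v0}" for w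
  proof -
    have "{v0,w} \<in> nsets V 2" using w v0 by (auto simp: doubleton_in_nsets_2)
    then obtain x y where xy: "path (\<gamma> {v0,w})" "{v0,w} = {x,y}" "\<gamma> {v0,w} 0 = p x" "\<gamma> {v0,w} 1 = p y"
      using D unfolding drawing_def G pathstart_def pathfinish_def by blast
    have ne: "p w \<noteq> p v0" using drawing_vertex_inj[OF D] w v0 G by auto
    from xy(2) have "x = v0 \<and> y = w \<or> x = w \<and> y = v0" by (auto simp: doubleton_eq_iff)
    then show ?thesis using xy ne by (auto simp: g_def reversepath_def simp flip: path_reversepath[of "\<gamma> _"])
  qed
  have "\<exists>T. 0 < T \<and> T < 1 \<and> dist (p v0) (g w T) = r \<and> (\<forall>t. T < t \<and> t \<le> 1 \<longrightarrow> r < dist (p v0) (g w t))"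
    if w: "w \<in> V - {v0}" for w
    using last_exit[of "g w" r] g[OF w] r fv[OF w] by metis
  then obtain T where T: "\<And>w. w \<in> V - {v0} \<Longrightarrow> 0 < T w \<and> T w < 1 \<and> dist (p v0) (g w (T w)) = r \<and>
      (\<forall>t. T w < t \<and> t \<le> 1 \<longrightarrow> r < dist (p v0) (g w t))" by metis
  define u where "u w = (g w (T w) - p v0) / of_real r" for w
  have exit: "g w (T w) = p v0 + of_real r * u w" for w using r by (simp add: u_def)
  have norm: "cmod (u w) = 1" if "w \<in> V - {v0}" for w
    using T[OF that] r by (simp add: u_def norm_divide dist_norm norm_minus_commute)
  have g_\<gamma>: "(\<forall>t. g w t = \<gamma> {v0,w} t) \<or> (\<forall>t. g w t = \<gamma> {v0,w} (1 - t))" for w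
    by (auto simp: g_def reversepath_def)
  \<comment> \<open>Two edges leaving the disc at the same point would create a multiple point at
    distance \<open>r\<close>, but all multiple points are farther away.\<close>
  have inj: "inj_on u (V - {v0})"
  proof (rule inj_onI, rule ccontr)
    fix w w' assume w: "w \<in> V - {v0}" "w' \<in> V - {v0}" "u w = u w'" "w \<noteq> w'"
    define z where "z = g w (T w)"
    have z': "z = g w' (T w')" using w exit by (simp add: z_def)
    have pt: "\<exists>t. Inner {v0,w} t \<in> fibre ?G p \<gamma> (g w (T w))" if "w \<in> V - {v0}" for w
    proof -
      have "{v0,w} \<in> nsets V 2" using that v0 by (auto simp: doubleton_in_nsets_2)
      moreover have "g w (T w) = \<gamma> {v0,w} (T w) \<or> g w (T w) = \<gamma> {v0,w} (1 - T w)" using g_\<gamma>[of w] by auto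
      ultimately show ?thesis using T[OF that]
        by (auto simp: Inner_in_fibre_iff G intro: exI[of _ "T w"] exI[of _ "1 - T w"])
    qed
    obtain t t' where t: "Inner {v0,w} t \<in> fibre ?G p \<gamma> z" "Inner {v0,w'} t' \<in> fibre ?G p \<gamma> z"
      using pt[OF w(1)] pt[OF w(2)] z' by (auto simp: z_def)
    have "Inner {v0,w} t \<noteq> Inner {v0,w'} t'" using w by (auto simp: doubleton_eq_iff)
    then have "z \<in> multiple_points ?G p \<gamma>" by (rule multiple_pointsI[OF t])
    from fm[OF this] show False using T[OF w(1)] by (simp add: z_def)
  qed
  show thesis
  proof (rule that[OF inj norm])
    fix a b v assume ab: "a \<in> V - {v0}" "b \<in> V - {v0}" "a \<noteq> b" and v: "v \<notin> V"
    obtain \<mu> where \<mu>: "cmod \<mu> = 1" "\<mu> \<notin> u ` (V - {v0})" "Im (cnj \<mu> * u a) < 0" "Im (cnj \<mu> * u b) > 0"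
      and sector: "\<And>w c s c1 c2. w \<in> V - {v0} \<Longrightarrow> c \<in> {a,b} \<Longrightarrow> s > 0 \<Longrightarrow> c1 > 0 \<Longrightarrow> c2 > 0 \<Longrightarrow>
       of_real s * u w = of_real c1 * \<mu> + of_real c2 * u c \<Longrightarrow>
       w \<in> V - {v0} - {a} \<and> Arg2pi (u w / u a) < Arg2pi (u b / u a)"
      using sector_direction[OF _ inj norm ab] fin by (metis finite_Diff)
    interpret vertex_split V p \<gamma> v0 v a b r g T u \<mu>
    proof
      show "r < dist (p v0) (\<gamma> e t)" if "e \<in> nsets (V - {v0}) 2" "t \<in> {0..1}" for e t
        using that by (intro fe) (auto simp: nsets_def)
      show "w \<in> V - {v0} - {a} \<and> Arg2pi (u w / u a) < Arg2pi (u b / u a)"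
        if "w \<in> V - {v0}" "c \<in> {a,b}" "s > 0" "c1 > 0" "c2 > 0"
          "of_real s * u w = of_real c1 * \<mu> + of_real c2 * u c" for w c s c1 c2
        using that by (rule sector)
    qed (use D fin v0 v ab r fv g g_\<gamma> T exit norm inj \<mu> in auto)
    have "crossing_number H \<le> enat (card (multiple_points H q \<delta>))"
      using drawing_H by (rule crossing_number_le)
    then show "\<exists>k. crossing_number (insert v V, (nsets V 2 - {{v0,a},{a,b},{b,v0}}) \<union> {{v,v0},{v,a},{v,b}}) \<le> enat k \<and>
        k + card {z \<in> multiple_points (complete_graph V) p \<gamma>. \<exists>t. 0 < t \<and> t < 1 \<and> \<gamma> {a,b} t = z}
        \<le> card (multiple_points (complete_graph V) p \<gamma>) + ccw_rank u (V - {v0}) a b"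
      using card_multiple_H unfolding H_eq W_def by blast
  qed
qed

text \<open>The symmetric group on \<open>V\<close> is transitive on ordered triples: three
  transpositions move \<open>v0\<close>, \<open>a\<close>, \<open>b\<close> into place one after
  another, each fixing the vertices already placed, and all of them fix \<open>v\<close>.\<close>

lemma crossing_number_delta_Y_le:
  assumes d: "distinct [v1, v2, v3]" "{v1,v2,v3} \<subseteq> V" and d': "distinct [v0, a, b]" "{v0,a,b} \<subseteq> V" and v: "v \<notin> V"
  shows "crossing_number (insert v V, (nsets V 2 - {{v1,v2},{v2,v3},{v3,v1}}) \<union> {{v,v1},{v,v2},{v,v3}})
    \<le> crossing_number (insert v V, (nsets V 2 - {{v0,a},{a,b},{b,v0}}) \<union> {{v,v0},{v,a},{v,b}})"
proof -
  define f1 where "f1 = Transposition.transpose v0 v1"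
  define f2 where "f2 = Transposition.transpose (f1 a) v2"
  define f3 where "f3 = Transposition.transpose (f2 (f1 b)) v3"
  define f where "f = f3 \<circ> f2 \<circ> f1"
  have tr_V: "Transposition.transpose x y ` V = V" "Transposition.transpose x y v = v" if "x \<in> V" "y \<in> V" for x y
    using that v by (auto simp: Transposition.transpose_def image_iff)
  have in_V: "Transposition.transpose x y z \<in> V" if "x \<in> V" "y \<in> V" "z \<in> V" for x y z
    using that by (auto simp: Transposition.transpose_def)
  have f1: "f1 ` V = V" "f1 v = v" "f1 a \<in> V" "f1 b \<in> V" "f1 v0 = v1" "inj f1"
    unfolding f1_def using tr_V in_V d d' by (auto intro: inj_on_subset[OF bij_is_inj] simp: bij_transpose bij_is_inj)
  have n1: "f1 a \<noteq> v1" "f1 b \<noteq> v1" "f1 a \<noteq> f1 b" using f1(5,6) d' by (auto dest: injD)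
  have f2: "f2 ` V = V" "f2 v = v" "f2 (f1 b) \<in> V" "f2 (f1 a) = v2" "f2 v1 = v1" "inj f2"
    unfolding f2_def using tr_V in_V d d' f1 n1 by (auto simp: bij_transpose bij_is_inj)
  have "f2 (f1 b) \<noteq> f2 v1" "f2 (f1 b) \<noteq> f2 (f1 a)" unfolding inj_eq[OF f2(6)] using n1 by auto
  then have n2: "f2 (f1 b) \<noteq> v1" "f2 (f1 b) \<noteq> v2" unfolding f2(4,5) .
  have f3: "f3 ` V = V" "f3 v = v" "f3 (f2 (f1 b)) = v3" "f3 v1 = v1" "f3 v2 = v2" "inj f3"
    unfolding f3_def using tr_V in_V d d' f2 n2 by (auto simp: bij_transpose bij_is_inj)
  have f: "f ` V = V" "f v = v" "f v0 = v1" "f a = v2" "f b = v3" "inj f"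
  proof -
    show "f ` V = V" unfolding f_def image_comp[symmetric] f1(1) f2(1) f3(1) ..
    show "inj f" unfolding f_def by (intro inj_compose f1 f2 f3)
  qed (use f1 f2 f3 in \<open>simp_all add: f_def\<close>)
  have "bij_betw f V V" using f by (auto simp: bij_betw_def intro: inj_on_subset)
  then have "(`) f ` nsets V 2 = nsets V 2" using bij_betw_nsets by (metis bij_betw_def)
  moreover have "inj ((`) f)" using f(6) by (simp add: inj_image_eq_iff inj_def)
  ultimately have E: "(`) f ` ((nsets V 2 - {{v0,a},{a,b},{b,v0}}) \<union> {{v,v0},{v,a},{v,b}})
     = (nsets V 2 - {{v1,v2},{v2,v3},{v3,v1}}) \<union> {{v,v1},{v,v2},{v,v3}}"
    by (simp add: image_Un image_set_diff f)
  have Vf: "f ` insert v V = insert v V" using f by simp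
  have "crossing_number (f ` insert v V, (`) f ` ((nsets V 2 - {{v0,a},{a,b},{b,v0}}) \<union> {{v,v0},{v,a},{v,b}}))
    \<le> crossing_number (insert v V, (nsets V 2 - {{v0,a},{a,b},{b,v0}}) \<union> {{v,v0},{v,a},{v,b}})"
  proof (rule crossing_number_image_le)
    show "inj_on f (insert v V)" using f(6) by (rule inj_on_subset) simp
  qed (use d' in \<open>auto simp: nsets_def\<close>)
  then show ?thesis unfolding E Vf .
qed

section \<open>Straight-line drawings\<close>

definition crs :: "complex \<Rightarrow> complex \<Rightarrow> real" where
  "crs x y = Im (cnj x * y)"

lemma crs_simps:
  "crs (x + y) z = crs x z + crs y z" "crs z (x + y) = crs z x + crs z y"
  "crs (x - y) z = crs x z - crs y z" "crs z (x - y) = crs z x - crs z y"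
  "crs (of_real k * x) y = k * crs x y" "crs x (of_real k * y) = k * crs x y"
  "crs x x = 0" "crs 0 x = 0" "crs x 0 = 0"
  by (simp_all add: crs_def algebra_simps)

lemma crs_swap: "crs y x = - crs x y" by (simp add: crs_def algebra_simps)

lemma crs_eq_0_imp_multiple:
  assumes "crs x w = 0" "w \<noteq> 0"
  obtains k :: real where "x = of_real k * w"
proof -
  have "Im (x / w) = 0" using assms(1) by (simp add: Im_divide crs_def)
  then have "x / w = of_real (Re (x / w))" by (simp add: complex_eq_iff)
  then have "x = of_real (Re (x / w)) * w" using assms(2) by (metis nonzero_divide_eq_eq)
  then show thesis by (rule that)
qed

text \<open>Twice the signed area of the triangle; it vanishes exactly if the three points are
  collinear.\<close>

definition area :: "complex \<Rightarrow> complex \<Rightarrow> complex \<Rightarrow> real" where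
  "area a b c = crs (b - a) (c - a)"

lemma area_perm: "area b a c = - area a b c" "area b c a = area a b c" "area c a b = area a b c"
  "area a c b = - area a b c" "area c b a = - area a b c"
  by (simp_all add: area_def crs_def algebra_simps)

lemma negligible_line:
  assumes "a \<noteq> b"
  shows "negligible {q. area a b q = 0}"
proof -
  have "\<i> * (b - a) \<noteq> 0" using assms by simp
  then have "negligible {q. (\<i> * (b - a)) \<bullet> q = (\<i> * (b - a)) \<bullet> a}" by (intro negligible_hyperplane) simp
  moreover have "area a b q = (\<i> * (b - a)) \<bullet> q - (\<i> * (b - a)) \<bullet> a" for q
    by (simp add: area_def crs_def inner_complex_def algebra_simps)
  ultimately show ?thesis by simp
qed

definition on_line :: "('a \<Rightarrow> complex) \<Rightarrow> 'a set \<Rightarrow> complex \<Rightarrow> bool" where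
  "on_line p e z \<longleftrightarrow> (\<forall>a b. e = {a,b} \<longrightarrow> area (p a) (p b) z = 0)"

lemma on_line_doubleton: "on_line p {a,b} z \<longleftrightarrow> area (p a) (p b) z = 0"
  by (auto simp: on_line_def doubleton_eq_iff area_perm(1)[of "p a" "p b"])

text \<open>Noncollinearity keeps edges off other vertices and makes disjoint edges cross
  transversally; the last condition excludes triple points.\<close>

definition general_position :: "'a set \<Rightarrow> ('a \<Rightarrow> complex) \<Rightarrow> bool" where
  "general_position V p \<longleftrightarrow> inj_on p V \<and>
    (\<forall>a\<in>V. \<forall>b\<in>V. \<forall>c\<in>V. distinct [a,b,c] \<longrightarrow> area (p a) (p b) (p c) \<noteq> 0) \<and>
    (\<forall>e1\<in>nsets V 2. \<forall>e2\<in>nsets V 2. \<forall>e3\<in>nsets V 2. \<forall>z. e1 \<inter> e2 = {} \<longrightarrow> e1 \<inter> e3 = {} \<longrightarrow> e2 \<inter> e3 = {} \<longrightarrow>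
      \<not> (on_line p e1 z \<and> on_line p e2 z \<and> on_line p e3 z))"

text \<open>With two common points both lines would have the direction \<open>w\<close>, so
  \<open>c\<close> would lie on the line through \<open>a\<close> and \<open>b\<close>.\<close>

lemma lines_meet_once:
  assumes z: "area a b z = 0" "area c d z = 0" and z': "area a b z' = 0" "area c d z' = 0"
    and abc: "area a b c \<noteq> 0" and cd: "c \<noteq> d"
  shows "z = z'"
proof (rule ccontr)
  assume "z \<noteq> z'"
  define w where "w = z - z'"
  have w: "w \<noteq> 0" using \<open>z \<noteq> z'\<close> by (simp add: w_def)
  have "w = (z - a) - (z' - a)" "w = (z - c) - (z' - c)" by (simp_all add: w_def)
  then have 1: "crs (b - a) w = 0" "crs (d - c) w = 0" using z z' by (auto simp: area_def crs_simps)
  obtain \<beta> where \<beta>: "b - a = of_real \<beta> * w" using 1(1) w by (rule crs_eq_0_imp_multiple)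
  have "crs w (d - c) = 0" using 1(2) crs_swap[of "d - c" w] by simp
  then obtain \<kappa> where \<kappa>: "w = of_real \<kappa> * (d - c)" using cd crs_eq_0_imp_multiple[of w "d - c"] by auto
  have "crs w (z - c) = 0" unfolding \<kappa> using z(2) by (simp add: area_def crs_simps)
  then have "crs (b - a) (z - c) = 0" unfolding \<beta> by (simp add: crs_simps)
  moreover have "area a b c = area a b z - crs (b - a) (z - c)" by (simp add: area_def crs_simps)
  ultimately show False using abc z by simp
qed

text \<open>Points are added one at a time. The forbidden positions for the next one lie in the old
  points and finitely many lines, a null set.\<close>

lemma general_position_exists:
  assumes "finite V"
  shows "\<exists>p. general_position V p"
  using assms
proof (induction V rule: finite_induct)
  case empty
  show ?case by (simp add: general_position_def nsets_eq_empty)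
next
  case (insert v V)
  then obtain p where gp: "general_position V p" by auto
  then have inj: "inj_on p V" and G1: "\<And>a b c. a \<in> V \<Longrightarrow> b \<in> V \<Longrightarrow> c \<in> V \<Longrightarrow> distinct [a,b,c] \<Longrightarrow> area (p a) (p b) (p c) \<noteq> 0"
    and G2: "\<And>e1 e2 e3 z. e1 \<in> nsets V 2 \<Longrightarrow> e2 \<in> nsets V 2 \<Longrightarrow> e3 \<in> nsets V 2 \<Longrightarrow> e1 \<inter> e2 = {} \<Longrightarrow> e1 \<inter> e3 = {} \<Longrightarrow>
      e2 \<inter> e3 = {} \<Longrightarrow> \<not> (on_line p e1 z \<and> on_line p e2 z \<and> on_line p e3 z)"
    by (simp_all add: general_position_def)
  define B1 where "B1 = (\<Union>a\<in>V. \<Union>b\<in>V - {a}. {q. area (p a) (p b) q = 0})"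
  \<comment> \<open>The positions \<open>q\<close> for which the line from \<open>y\<close> to
    \<open>q\<close> would pass through a common point of the lines of \<open>e\<close> and
    \<open>f\<close>. As these lines meet at most once, this is contained in a single line.\<close>
  define P where "P e f y = {q. \<exists>z. on_line p e z \<and> on_line p f z \<and> area (p y) z q = 0}" for e f y
  define B2 where "B2 = (\<Union>e\<in>nsets V 2. \<Union>f\<in>nsets (V - e) 2. \<Union>y\<in>V - (e \<union> f). P e f y)"
  have fin2: "finite (nsets W 2)" if "W \<subseteq> V" for W
    using that insert(1) by (meson finite_imp_finite_nsets finite_subset)
  have "negligible (p ` V)" using insert(1) by (simp add: negligible_finite)
  moreover have "negligible B1"
    unfolding B1_def using insert(1) inj
    by (auto intro!: negligible_Union negligible_line dest: inj_onD)
  moreover have "negligible B2"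
  proof -
    have "negligible (P e f y)" if e: "e \<in> nsets V 2" and f: "f \<in> nsets (V - e) 2" and y: "y \<in> V - (e \<union> f)" for e f y
    proof -
      obtain a b where ab: "e = {a,b}" "a \<in> V" "b \<in> V" "a \<noteq> b" using e by (rule nsets2_E)
      obtain c d where cd: "f = {c,d}" "c \<in> V - e" "d \<in> V - e" "c \<noteq> d" using f by (rule nsets2_E)
      show ?thesis
      proof (cases "\<exists>z. on_line p e z \<and> on_line p f z")
        case False
        then have "P e f y = {}" by (auto simp: P_def)
        then show ?thesis by simp
      next
        case True
        then obtain z where z: "on_line p e z" "on_line p f z" by auto
        have "P e f y \<subseteq> {q. area (p y) z q = 0}"
        proof
          fix q assume "q \<in> P e f y"
          then obtain z' where z': "on_line p e z'" "on_line p f z'" "area (p y) z' q = 0" by (auto simp: P_def)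
          have "z = z'"
            by (rule lines_meet_once[of "p a" "p b" z "p c" "p d" z'])
               (use z z' ab cd G1[of a b c] inj in \<open>auto simp: on_line_doubleton dest: inj_onD\<close>)
          then show "q \<in> {q. area (p y) z q = 0}" using z' by simp
        qed
        \<comment> \<open>Otherwise the vertex \<open>y\<close> would be collinear with the ends of
          \<open>e\<close>; distinctness is what makes the forbidden set a genuine line.\<close>
        moreover have "p y \<noteq> z" using G1[of a b y] z(1) ab y by (auto simp: on_line_doubleton)
        ultimately show ?thesis using negligible_line negligible_subset by blast
      qed
    qed
    then show ?thesis
      unfolding B2_def using insert(1) fin2 by (intro negligible_Union) (auto intro!: negligible_Union)
  qed
  ultimately have "negligible (p ` V \<union> B1 \<union> B2)" by (intro negligible_Un)
  then have "p ` V \<union> B1 \<union> B2 \<noteq> UNIV" using non_negligible_UNIV by metis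
  then obtain q where q: "q \<notin> p ` V" "q \<notin> B1" "q \<notin> B2" by auto
  define p' where "p' = p(v := q)"
  have p'_old: "p' x = p x" if "x \<in> V" for x using that insert(2) by (auto simp: p'_def)
  have p'_v: "p' v = q" by (simp add: p'_def)
  have qG1: "area (p a) (p b) q \<noteq> 0" if "a \<in> V" "b \<in> V" "a \<noteq> b" for a b
    using q(2) that unfolding B1_def by blast
  have on_old: "on_line p' e z \<longleftrightarrow> on_line p e z" if "e \<in> nsets V 2" for e z
    using that p'_old by (auto elim!: nsets2_E simp: on_line_doubleton)
  have core: False
    if H: "e1 \<in> nsets (insert v V) 2" "v \<in> e1" "e2 \<in> nsets V 2" "e3 \<in> nsets V 2" "e1 \<inter> e2 = {}" "e1 \<inter> e3 = {}" "e2 \<inter> e3 = {}"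
      "on_line p' e1 z" "on_line p' e2 z" "on_line p' e3 z" for e1 e2 e3 z
  proof -
    obtain x y where "e1 = {x,y}" "x \<in> insert v V" "y \<in> insert v V" "x \<noteq> y" using H(1) by (rule nsets2_E)
    then obtain y where y: "e1 = {v,y}" "y \<in> V" using H(2) by (auto simp: insert_commute)
    have "area q (p y) z = 0" using H(8) p'_v p'_old y by (simp add: on_line_doubleton)
    then have "area (p y) z q = 0" by (simp only: area_perm(2)[where a = q and b = "p y" and c = z])
    moreover have "on_line p e2 z" "on_line p e3 z" using H(3,4,9,10) on_old by auto
    ultimately have "q \<in> P e2 e3 y" unfolding P_def by auto
    moreover have "e3 \<in> nsets (V - e2) 2" "y \<in> V - (e2 \<union> e3)" using H y by (auto simp: nsets_def)
    ultimately have "q \<in> B2" unfolding B2_def using H(3) by blast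
    then show False using q by simp
  qed
  have "general_position (insert v V) p'"
    unfolding general_position_def
  proof (intro conjI ballI allI impI notI)
    show "inj_on p' (insert v V)"
      using inj q(1) insert(2) by (auto simp: p'_def inj_on_def)
    fix a b c assume abc: "a \<in> insert v V" "b \<in> insert v V" "c \<in> insert v V" "distinct [a,b,c]" "area (p' a) (p' b) (p' c) = 0"
    consider "a \<in> V" "b \<in> V" "c \<in> V" | "a = v" "b \<in> V" "c \<in> V" | "b = v" "a \<in> V" "c \<in> V" | "c = v" "a \<in> V" "b \<in> V"
      using abc by auto
    then show False
    proof cases
      case 1
      then show False using G1[of a b c] abc p'_old by auto
    next
      case 2
      then show False using qG1[of b c] abc p'_old p'_v area_perm(2)[where a = q and b = "p b" and c = "p c"] by auto
    next
      case 3
      then show False using qG1[of a c] abc p'_old p'_v area_perm(4)[of "p a" q "p c"] by auto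
    next
      case 4
      then show False using qG1[of a b] abc p'_old p'_v by auto
    qed
  next
    fix e1 e2 e3 z assume e: "e1 \<in> nsets (insert v V) 2" "e2 \<in> nsets (insert v V) 2" "e3 \<in> nsets (insert v V) 2"
      and d: "e1 \<inter> e2 = {}" "e1 \<inter> e3 = {}" "e2 \<inter> e3 = {}"
      and on: "on_line p' e1 z \<and> on_line p' e2 z \<and> on_line p' e3 z"
    have old: "f \<in> nsets V 2" if "f \<in> nsets (insert v V) 2" "v \<notin> f" for f using that by (auto simp: nsets_def)
    consider "v \<in> e1" "v \<notin> e2" "v \<notin> e3" | "v \<in> e2" "v \<notin> e1" "v \<notin> e3" | "v \<in> e3" "v \<notin> e1" "v \<notin> e2" | "v \<notin> e1" "v \<notin> e2" "v \<notin> e3"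
      using d by blast
    then show False
    proof cases
      case 1
      then show False using core[of e1 e2 e3 z] e d on old by blast
    next
      case 2
      then show False using core[of e2 e1 e3 z] e d on old by blast
    next
      case 3
      then show False using core[of e3 e1 e2 z] e d on old by blast
    next
      case 4
      then show False using G2[of e1 e2 e3 z] e d on old on_old by blast
    qed
  qed
  then show ?case by blast
qed

text \<open>Makes the set of crossing numbers of drawings nonempty, so that its infimum is a finite
  minimum.\<close>

lemma straight_line_drawing_exists:
  assumes fin: "finite V"
  shows "\<exists>p \<gamma>. drawing (complete_graph V) p \<gamma>"
proof -
  let ?G = "complete_graph V"
  obtain p where gp: "general_position V p" using general_position_exists[OF fin] by blast
  then have inj: "inj_on p V" and G1: "\<And>a b c. a \<in> V \<Longrightarrow> b \<in> V \<Longrightarrow> c \<in> V \<Longrightarrow> distinct [a,b,c] \<Longrightarrow> area (p a) (p b) (p c) \<noteq> 0"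
    and G2: "\<And>e1 e2 e3 z. e1 \<in> nsets V 2 \<Longrightarrow> e2 \<in> nsets V 2 \<Longrightarrow> e3 \<in> nsets V 2 \<Longrightarrow> e1 \<inter> e2 = {} \<Longrightarrow> e1 \<inter> e3 = {} \<Longrightarrow>
      e2 \<inter> e3 = {} \<Longrightarrow> on_line p e1 z \<Longrightarrow> on_line p e2 z \<Longrightarrow> on_line p e3 z \<Longrightarrow> False"
    by (simp_all add: general_position_def)
  have "\<exists>a b. e = {a,b} \<and> a \<in> V \<and> b \<in> V \<and> a \<noteq> b" if "e \<in> nsets V 2" for e
    using that by - (erule nsets2_E, blast)
  then obtain A B where AB: "\<And>e. e \<in> nsets V 2 \<Longrightarrow> e = {A e, B e} \<and> A e \<in> V \<and> B e \<in> V \<and> A e \<noteq> B e" by metis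
  define \<gamma> where "\<gamma> e = linepath (p (A e)) (p (B e))" for e
  have \<gamma>_eq: "\<gamma> e t = p (A e) + of_real t * (p (B e) - p (A e))" for e t
    by (simp add: \<gamma>_def linepath_def scaleR_conv_of_real algebra_simps)
  have p_ne: "p (B e) - p (A e) \<noteq> 0" if "e \<in> nsets V 2" for e
    using AB[OF that] inj by (auto dest: inj_onD)
  have on: "on_line p e (\<gamma> e t)" if e: "e \<in> nsets V 2" for e t
  proof -
    have "area (p (A e)) (p (B e)) (\<gamma> e t) = 0" by (simp add: area_def \<gamma>_eq crs_simps)
    then have "on_line p {A e, B e} (\<gamma> e t)" by (simp only: on_line_doubleton)
    then show ?thesis using AB[OF e] by simp
  qed
  have no_vertex: "\<gamma> e t \<noteq> p c" if e: "e \<in> nsets V 2" and c: "c \<in> V" and t: "0 < t" "t < 1" for e t c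
  proof
    assume eq: "\<gamma> e t = p c"
    show False
    proof (cases "c \<in> e")
      case True
      then have "c = A e \<or> c = B e" using AB[OF e] by auto
      then show False
      proof
        assume "c = A e"
        then show False using eq p_ne[OF e] t by (simp add: \<gamma>_eq)
      next
        assume "c = B e"
        then have "of_real (1 - t) * (p (B e) - p (A e)) = 0" using eq by (simp add: \<gamma>_eq algebra_simps)
        then show False using p_ne[OF e] t by simp
      qed
    next
      case False
      have "on_line p {A e, B e} (p c)" using on[OF e, of t] AB[OF e] eq by simp
      then have "area (p (A e)) (p (B e)) (p c) = 0" by (simp only: on_line_doubleton)
      moreover have "distinct [A e, B e, c]" using AB[OF e] False by auto
      ultimately show False using G1 AB[OF e] c by blast
    qed
  qed
  have param: "t = t'" if "e \<in> nsets V 2" "\<gamma> e t = \<gamma> e t'" for e t t'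
    using that p_ne[of e] by (simp add: \<gamma>_eq)
  \<comment> \<open>Edges with a common end \<open>a\<close> cannot meet again: both would be
    parallel to the vector \<open>w\<close> from \<open>p a\<close> to the meeting point, and three
    vertices would be collinear.\<close>
  have disj: "e \<inter> f = {}" if e: "e \<in> nsets V 2" and f: "f \<in> nsets V 2" and ne: "e \<noteq> f" and eq: "\<gamma> e t = \<gamma> f t'"
    and t: "0 < t" "t < 1" for e f t t'
  proof (rule ccontr)
    assume "e \<inter> f \<noteq> {}"
    then obtain a where a: "a \<in> e" "a \<in> f" by auto
    obtain b where b: "e = {a,b}" "b \<in> V" "a \<in> V" "a \<noteq> b" using AB[OF e] a by (metis insertE insert_commute singletonD)
    obtain c where c: "f = {a,c}" "c \<in> V" "a \<noteq> c" using AB[OF f] a by (metis insertE insert_commute singletonD)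
    define w where "w = \<gamma> e t - p a"
    have w: "w \<noteq> 0" using no_vertex[OF e _ t, of a] b by (simp add: w_def)
    have "area (p a) (p b) (\<gamma> e t) = 0" "area (p a) (p c) (\<gamma> e t) = 0"
      using on[OF e, of t] on[OF f, of t'] eq b c by (simp_all add: on_line_doubleton)
    then have "crs (p b - p a) w = 0" "crs (p c - p a) w = 0" by (simp_all add: area_def w_def)
    then obtain k k' where "p b - p a = of_real k * w" "p c - p a = of_real k' * w"
      using crs_eq_0_imp_multiple w by metis
    then have "area (p a) (p b) (p c) = 0" by (simp add: area_def crs_simps)
    moreover have "distinct [a,b,c]" using b c ne by auto
    ultimately show False using G1 b c by blast
  qed
  have cross: "crs (p (B e) - p (A e)) (p (B f) - p (A f)) \<noteq> 0"
    if e: "e \<in> nsets V 2" and f: "f \<in> nsets V 2" and d: "e \<inter> f = {}" and eq: "\<gamma> e t = \<gamma> f t'" for e f t t'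
  proof
    assume 0: "crs (p (B e) - p (A e)) (p (B f) - p (A f)) = 0"
    have "p (A f) - p (A e) = of_real t * (p (B e) - p (A e)) - of_real t' * (p (B f) - p (A f))"
      using eq by (simp add: \<gamma>_eq algebra_simps)
    moreover have "crs E (of_real t * E - of_real t' * F) = - t' * crs E F" for E F by (simp add: crs_simps)
    ultimately have "area (p (A e)) (p (B e)) (p (A f)) = 0" unfolding area_def using 0 by simp
    moreover have "distinct [A e, B e, A f]" using AB[OF e] AB[OF f] d by auto
    ultimately show False using G1 AB[OF e] AB[OF f] by blast
  qed
  have mult: "\<exists>e f s t. e \<in> nsets V 2 \<and> f \<in> nsets V 2 \<and> e \<inter> f = {} \<and> \<gamma> e s = z \<and> \<gamma> f t = z \<and> transversal_double_point ?G p \<gamma> z"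
    if z: "z \<in> multiple_points ?G p \<gamma>" for z
  proof -
    obtain x y where xy: "x \<in> fibre ?G p \<gamma> z" "y \<in> fibre ?G p \<gamma> z" "x \<noteq> y"
      using z by (auto simp: multiple_points_iff)
    have inner: "\<exists>e t. x = Inner e t \<and> e \<in> nsets V 2 \<and> 0 < t \<and> t < 1 \<and> \<gamma> e t = z"
      if x: "x \<in> fibre ?G p \<gamma> z" and y: "y \<in> fibre ?G p \<gamma> z" and "x \<noteq> y" for x y
    proof (cases x)
      case (Vertex a)
      then have a: "a \<in> V" "p a = z" using x by (auto simp: Vertex_in_fibre_iff complete_graph_def)
      show ?thesis
      proof (cases y)
        case (Vertex b)
        then have "b \<in> V" "p b = z" using y by (auto simp: Vertex_in_fibre_iff complete_graph_def)
        then show ?thesis using a inj \<open>x \<noteq> y\<close> Vertex \<open>x = Vertex a\<close> by (auto dest: inj_onD)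
      next
        case (Inner e t)
        then show ?thesis using y a no_vertex by (auto simp: Inner_in_fibre_iff complete_graph_def)
      qed
    next
      case (Inner e t)
      then show ?thesis using x by (auto simp: Inner_in_fibre_iff complete_graph_def)
    qed
    obtain e s where es: "x = Inner e s" "e \<in> nsets V 2" "0 < s" "s < 1" "\<gamma> e s = z" using inner[OF xy] by blast
    obtain f t where ft: "y = Inner f t" "f \<in> nsets V 2" "0 < t" "t < 1" "\<gamma> f t = z" using inner[OF xy(2,1)] xy(3) by blast
    have "e \<noteq> f" using param es ft xy(3) by blast
    then have d: "e \<inter> f = {}" using disj[of e f s t] es ft by simp
    have "x' = x \<or> x' = y" if x': "x' \<in> fibre ?G p \<gamma> z" for x'
    proof (rule ccontr)
      assume ne: "\<not> (x' = x \<or> x' = y)"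
      then obtain h r where hr: "x' = Inner h r" "h \<in> nsets V 2" "0 < r" "r < 1" "\<gamma> h r = z"
        using inner[OF x' xy(1)] by blast
      have "h \<noteq> e" "h \<noteq> f" using param hr es ft ne by blast+
      then have "e \<inter> h = {}" "f \<inter> h = {}" using disj[of e h s r] disj[of f h t r] es ft hr by auto
      then show False using G2[of e f h z] es ft hr d on[of e s] on[of f t] on[of h r] by simp
    qed
    then have fib: "fibre ?G p \<gamma> z = {Inner e s, Inner f t}" using xy es ft by blast
    have tr: "transversal_at (\<gamma> e) s (\<gamma> f) t"
    proof (rule transversal_at_affine[of 1])
      show "Im (cnj (p (B e) - p (A e)) * (p (B f) - p (A f))) \<noteq> 0"
        using cross[of e f s t] es ft d by (simp add: crs_def)
      show "\<gamma> e (s + x) = z + of_real x * (p (B e) - p (A e))" for x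
        unfolding es(5)[symmetric] by (simp add: \<gamma>_eq algebra_simps)
      show "\<gamma> f (t + x) = z + of_real x * (p (B f) - p (A f))" for x
        unfolding ft(5)[symmetric] by (simp add: \<gamma>_eq algebra_simps)
    qed (use es ft in auto)
    have "Inner e s \<noteq> Inner f t" using \<open>e \<noteq> f\<close> by simp
    with fib tr have "transversal_double_point ?G p \<gamma> z"
      unfolding transversal_double_point_def by blast
    then show ?thesis using es ft d by blast
  qed
  have "finite (multiple_points ?G p \<gamma>)"
  proof -
    \<comment> \<open>Each pair of disjoint edges contributes at most one point, since by
      \<open>cross\<close> their directions are independent.\<close>
    define S where "S e f = {z. \<exists>s t. e \<inter> f = {} \<and> \<gamma> e s = z \<and> \<gamma> f t = z}" for e f
    have "finite (S e f)" if e: "e \<in> nsets V 2" and f: "f \<in> nsets V 2" for e f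
    proof -
      have "z = z'" if zz: "z \<in> S e f" "z' \<in> S e f" for z z'
      proof -
        obtain s t s' t' where st: "e \<inter> f = {}" "\<gamma> e s = z" "\<gamma> f t = z" "\<gamma> e s' = z'" "\<gamma> f t' = z'"
          using zz by (auto simp: S_def)
        have "z - z' = of_real (s - s') * (p (B e) - p (A e))"
          unfolding st(2)[symmetric] st(4)[symmetric] by (simp add: \<gamma>_eq algebra_simps)
        moreover have "z - z' = of_real (t - t') * (p (B f) - p (A f))"
          unfolding st(3)[symmetric] st(5)[symmetric] by (simp add: \<gamma>_eq algebra_simps)
        ultimately have "of_real (s - s') * (p (B e) - p (A e)) = of_real (t - t') * (p (B f) - p (A f))" by simp
        then have "crs (p (B e) - p (A e)) (of_real (s - s') * (p (B e) - p (A e))) = crs (p (B e) - p (A e)) (of_real (t - t') * (p (B f) - p (A f)))"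
          by (rule arg_cong)
        then have "(t - t') * crs (p (B e) - p (A e)) (p (B f) - p (A f)) = 0" by (simp only: crs_simps(6,7))
        then have "t = t'" using cross[OF e f st(1), of s t] st by simp
        then show "z = z'" using st by simp
      qed
      then obtain z where "S e f \<subseteq> {z}" by blast
      then show ?thesis by (rule finite_subset) simp
    qed
    moreover have "multiple_points ?G p \<gamma> \<subseteq> (\<Union>e\<in>nsets V 2. \<Union>f\<in>nsets V 2. S e f)"
    proof
      fix z assume "z \<in> multiple_points ?G p \<gamma>"
      from mult[OF this] obtain e f s t where ef: "e \<in> nsets V 2" "f \<in> nsets V 2"
        and "e \<inter> f = {}" "\<gamma> e s = z" "\<gamma> f t = z" by (elim exE conjE)
      then have "z \<in> S e f" unfolding S_def by blast
      then show "z \<in> (\<Union>e\<in>nsets V 2. \<Union>f\<in>nsets V 2. S e f)" using ef by (intro UN_I)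
    qed
    moreover have "finite (nsets V 2)" using fin by (rule finite_imp_finite_nsets)
    ultimately show ?thesis by (auto intro: finite_subset)
  qed
  have edge: "path (\<gamma> e) \<and> (\<exists>u v. e = {u, v} \<and> pathstart (\<gamma> e) = p u \<and> pathfinish (\<gamma> e) = p v)" if "e \<in> nsets V 2" for e
    using AB[OF that] by (auto simp: \<gamma>_def)
  have "drawing ?G p \<gamma>"
    unfolding drawing_def
  proof (intro conjI ballI)
    fix e assume "e \<in> snd ?G"
    then have "e \<in> nsets V 2" by (simp add: complete_graph_def)
    from edge[OF this] show "path (\<gamma> e)" "\<exists>u v. e = {u, v} \<and> pathstart (\<gamma> e) = p u \<and> pathfinish (\<gamma> e) = p v"
      by (rule conjunct1, rule conjunct2)
  next
    fix z assume "z \<in> multiple_points ?G p \<gamma>"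
    from mult[OF this] show "transversal_double_point ?G p \<gamma> z" by (elim exE conjE)
  qed fact
  then show ?thesis by blast
qed

section \<open>Counting crossings\<close>

text \<open>From m to m + 2, each of the m + 1 old terms grows by 1 and two zero terms appear at the
  ends; on the right, the square grows by 4 (m + 1).\<close>

lemma sum_min_le: "4 * (\<Sum>j<Suc m. min j (m - j)) \<le> m\<^sup>2"
proof (induction m rule: induct_nat_012)
  case (ge2 m)
  have "(\<Sum>j<Suc (Suc (Suc m)). min j (Suc (Suc m) - j)) = (\<Sum>j<Suc m. min (Suc j) (Suc (Suc m) - Suc j))"
    by (subst sum.lessThan_Suc_shift, subst sum.lessThan_Suc) simp
  also have "\<dots> = (\<Sum>j<Suc m. min j (m - j) + 1)"
    by (rule sum.cong) auto
  also have "\<dots> = (\<Sum>j<Suc m. min j (m - j)) + Suc m" by (simp only: sum.distrib) simp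
  finally show ?case using ge2 by (simp add: power2_eq_square)
qed (simp_all add: eval_nat_numeral)

text \<open>The combinatorial remainder of a counterexample. \<open>N x y\<close> is the rank of
  \<open>y\<close> seen from \<open>x\<close> around \<open>v\<close>, from 0 to n - 3; the two
  inequalities come from the two sectors between \<open>x\<close> and \<open>y\<close>, the second
  written without truncated subtraction.\<close>

locale rank_bounds =
  fixes V :: "'a set" and c :: "'a \<Rightarrow> 'a \<Rightarrow> nat" and n :: nat
  assumes fin: "finite V" and card_V: "card V = n" and n: "n \<ge> 7"
    and sym: "\<And>x y. c x y = c y x"
    and rank: "\<And>v. v \<in> V \<Longrightarrow> \<exists>N. \<forall>x\<in>V - {v}. bij_betw (N x) (V - {v,x}) {..<n - 2} \<and>
      (\<forall>y\<in>V - {v,x}. c x y \<le> N x y \<and> c x y + N x y \<le> n - 3)"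
begin

lemma rank_at:
  assumes "v \<in> V" "x \<in> V" "v \<noteq> x"
  obtains N where "bij_betw N (V - {v,x}) {..<n - 2}" "\<And>y. y \<in> V - {v,x} \<Longrightarrow> c x y \<le> N y"
    "\<And>y. y \<in> V - {v,x} \<Longrightarrow> c x y + N y \<le> n - 3"
proof -
  obtain N where "\<forall>x\<in>V - {v}. bij_betw (N x) (V - {v,x}) {..<n - 2} \<and>
      (\<forall>y\<in>V - {v,x}. c x y \<le> N x y \<and> c x y + N x y \<le> n - 3)" using rank[OF assms(1)] by blast
  then show thesis using assms by (intro that[of "N x"]) auto
qed

definition "s x = (\<Sum>y\<in>V - {x}. c x y)"

text \<open>For each \<open>v\<close>, the ranks of the remaining \<open>y\<close> run through 0,
  ..., n - 3, so \<open>sum_min_le\<close> bounds the sum of their \<open>c x y\<close>. Summing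
  over the n - 1 choices of \<open>v\<close> counts every \<open>y\<close> exactly n - 2
  times.\<close>

lemma s_le:
  assumes x: "x \<in> V"
  shows "4 * (n - 2) * s x \<le> (n - 1) * (n - 3)\<^sup>2"
proof -
  have "4 * (\<Sum>y\<in>V - {x} - {v}. c x y) \<le> (n - 3)\<^sup>2" if v: "v \<in> V - {x}" for v
  proof -
    obtain N where N: "bij_betw N (V - {v,x}) {..<n - 2}" "\<And>y. y \<in> V - {v,x} \<Longrightarrow> c x y \<le> N y"
      "\<And>y. y \<in> V - {v,x} \<Longrightarrow> c x y + N y \<le> n - 3" using rank_at[of v x] v x by blast
    have "(\<Sum>y\<in>V - {v,x}. c x y) \<le> (\<Sum>y\<in>V - {v,x}. min (N y) (n - 3 - N y))"
      using N(2,3) by (intro sum_mono) fastforce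
    also have "\<dots> = (\<Sum>j<n - 2. min j (n - 3 - j))"
      using N(1) by (rule sum.reindex_bij_betw)
    also have "n - 2 = Suc (n - 3)" using n by simp
    finally have "4 * (\<Sum>y\<in>V - {v,x}. c x y) \<le> (n - 3)\<^sup>2" using sum_min_le[of "n - 3"] by linarith
    moreover have "V - {x} - {v} = V - {v,x}" by auto
    ultimately show ?thesis by simp
  qed
  then have "(\<Sum>v\<in>V - {x}. 4 * (\<Sum>y\<in>V - {x} - {v}. c x y)) \<le> (\<Sum>v\<in>V - {x}. (n - 3)\<^sup>2)"
    by (rule sum_mono)
  then have 1: "4 * (\<Sum>v\<in>V - {x}. \<Sum>y\<in>V - {x} - {v}. c x y) \<le> (n - 1) * (n - 3)\<^sup>2"
    using x fin card_V by (simp add: sum_distrib_left)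
  have "(n - 1) * s x = (\<Sum>v\<in>V - {x}. s x)" using x fin card_V by simp
  also have "\<dots> = (\<Sum>v\<in>V - {x}. c x v + (\<Sum>y\<in>V - {x} - {v}. c x y))"
    unfolding s_def using fin by (intro sum.cong refl sum.remove) auto
  also have "\<dots> = s x + (\<Sum>v\<in>V - {x}. \<Sum>y\<in>V - {x} - {v}. c x y)" by (simp add: sum.distrib s_def)
  finally have "(\<Sum>v\<in>V - {x}. \<Sum>y\<in>V - {x} - {v}. c x y) = (n - 1) * s x - s x" by simp
  also have "n - 1 = Suc (n - 2)" using n by simp
  also have "Suc (n - 2) * s x - s x = (n - 2) * s x" by simp
  finally show ?thesis using 1 by (simp add: mult.assoc)
qed

lemma s_sum_le: "4 * (n - 2) * (\<Sum>x\<in>V. s x) \<le> n * ((n - 1) * (n - 3)\<^sup>2)"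
proof -
  have "4 * (n - 2) * (\<Sum>x\<in>V. s x) = (\<Sum>x\<in>V. 4 * (n - 2) * s x)" by (rule sum_distrib_left)
  also have "\<dots> \<le> (\<Sum>x\<in>V. (n - 1) * (n - 3)\<^sup>2)" using s_le by (rule sum_mono)
  finally show ?thesis using card_V by simp
qed

definition "Z x = {y \<in> V - {x}. c x y = 0}"
definition "D x = {y \<in> V - {x}. c x y = 2}"

text \<open>Around any \<open>v\<close>, the extreme ranks 0 and n - 3 give two uncrossed edges at
  \<open>x\<close> that avoid \<open>v\<close>. Choosing \<open>v\<close> itself as the end of an
  uncrossed edge yields a third.\<close>

lemma card_Z: "x \<in> V \<Longrightarrow> card (Z x) \<ge> 3"
proof -
  assume x: "x \<in> V"
  have two: "card (Z x - {v}) \<ge> 2" if v: "v \<in> V - {x}" for v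
  proof -
    obtain N where N: "bij_betw N (V - {v,x}) {..<n - 2}" "\<And>y. y \<in> V - {v,x} \<Longrightarrow> c x y \<le> N y"
      "\<And>y. y \<in> V - {v,x} \<Longrightarrow> c x y + N y \<le> n - 3" using rank_at[of v x] v x by blast
    have "0 \<in> {..<n - 2}" "n - 3 \<in> {..<n - 2}" using n by auto
    then have "0 \<in> N ` (V - {v,x})" "n - 3 \<in> N ` (V - {v,x})" using N(1) by (simp_all add: bij_betw_def)
    then obtain y y' where y: "y \<in> V - {v,x}" "N y = 0" "y' \<in> V - {v,x}" "N y' = n - 3" by force
    then have "y \<noteq> y'" using n by auto
    moreover have "c x y = 0" "c x y' = 0" using N(2)[of y] N(3)[of y'] y by auto
    then have "{y, y'} \<subseteq> Z x - {v}" using y by (auto simp: Z_def)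
    then have "card {y, y'} \<le> card (Z x - {v})" using fin by (intro card_mono) (auto simp: Z_def)
    ultimately show ?thesis by simp
  qed
  have "card (V - {x}) > 0" using x fin card_V n by simp
  then obtain v where "v \<in> V - {x}" by (metis card_gt_0_iff ex_in_conv)
  from two[OF this] have "Z x \<noteq> {}" by auto
  then obtain w where w: "w \<in> Z x" by auto
  then have "w \<in> V - {x}" by (simp add: Z_def)
  from two[OF this] show ?thesis unfolding card_Diff_singleton[OF w] by simp
qed

text \<open>Ranks around \<open>v\<close> say nothing about the edge \<open>xv\<close>, so
  \<open>v\<close> is taken with \<open>xv\<close> uncrossed. An edge with two crossings has rank
  between 2 and n - 5, which leaves n - 6 ranks; for n at most 8 no edge can have three.\<close>

lemma small_n_bounds:
  assumes x: "x \<in> V" and n8: "n \<le> 8"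
  shows "card (D x) \<le> n - 6" "s x \<le> n - 4 + card (D x)"
proof -
  obtain v where v: "v \<in> Z x" using card_Z[OF x] by (metis card.empty ex_in_conv not_numeral_le_zero)
  then have vx: "v \<in> V" "v \<noteq> x" "c x v = 0" by (auto simp: Z_def)
  obtain N where N: "bij_betw N (V - {v,x}) {..<n - 2}" "\<And>y. y \<in> V - {v,x} \<Longrightarrow> c x y \<le> N y"
      "\<And>y. y \<in> V - {v,x} \<Longrightarrow> c x y + N y \<le> n - 3" using rank_at[of v x] vx x by blast
  have sub: "D x \<subseteq> V - {v,x}" using vx by (auto simp: D_def)
  then have "inj_on N (D x)" using N(1) by (auto simp: bij_betw_def intro: inj_on_subset)
  then have "card (D x) = card (N ` D x)" by (simp add: card_image)
  also have "N ` D x \<subseteq> {2..n - 5}"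
  proof
    fix j assume "j \<in> N ` D x"
    then obtain y where y: "y \<in> D x" "j = N y" by auto
    then have "c x y = 2" "y \<in> V - {v,x}" using sub by (auto simp: D_def)
    then show "j \<in> {2..n - 5}" using N(2,3)[of y] y by auto
  qed
  then have "card (N ` D x) \<le> card {2..n - 5}" by (intro card_mono) auto
  finally show "card (D x) \<le> n - 6" by simp
  have c2: "c x y \<le> 2" if "y \<in> V - {x}" for y
  proof (cases "y = v")
    case False
    then show ?thesis using N(2,3)[of y] that n8 by fastforce
  qed (use vx in simp)
  have "s x + card (Z x) = (\<Sum>y\<in>V - {x}. c x y) + (\<Sum>y\<in>V - {x}. if c x y = 0 then 1 else 0)"
    using fin by (simp add: s_def Z_def sum.If_cases Int_def)
  also have "\<dots> = (\<Sum>y\<in>V - {x}. c x y + (if c x y = 0 then 1 else 0))" by (simp add: sum.distrib)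
  \<comment> \<open>Checked for each of the values 0, 1 and 2 of \<open>c x y\<close>.\<close>
  also have "\<dots> \<le> (\<Sum>y\<in>V - {x}. 1 + (if c x y = 2 then 1 else 0))"
    using c2 by (intro sum_mono) (force simp: le_Suc_eq numeral_2_eq_2)
  also have "\<dots> = (n - 1) + card (D x)"
  proof -
    have "(\<Sum>y\<in>V - {x}. if c x y = 2 then 1 else 0) = card (D x)" using fin by (simp add: D_def sum.If_cases Int_def)
    moreover have "(\<Sum>y\<in>V - {x}. 1) = n - 1" using fin x card_V by simp
    ultimately show ?thesis by (simp only: sum.distrib)
  qed
  finally show "s x \<le> n - 4 + card (D x)" using card_Z[OF x] by simp
qed

text \<open>The bound 28 is 7 times the largest possible \<open>s x\<close>, namely 3 + 1. Equality
  would give every vertex exactly one partner joined by an edge with two crossings, a perfect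
  matching of seven vertices.\<close>

lemma s_sum_7: "n = 7 \<Longrightarrow> (\<Sum>x\<in>V. s x) < 28"
proof (rule ccontr)
  assume n7: "n = 7" and "\<not> (\<Sum>x\<in>V. s x) < 28"
  have le: "s x \<le> 3 + card (D x)" "card (D x) \<le> 1" if "x \<in> V" for x using small_n_bounds[OF that] n7 by auto
  have "card (D x) = 1" if x: "x \<in> V" for x
  proof (rule ccontr)
    assume "card (D x) \<noteq> 1"
    then have "s x \<le> 3" using le[OF x] by simp
    moreover have "(\<Sum>y\<in>V - {x}. s y) \<le> (\<Sum>y\<in>V - {x}. 4)" using le by (intro sum_mono) fastforce
    moreover have "(\<Sum>x\<in>V. s x) = s x + (\<Sum>y\<in>V - {x}. s y)" using fin x by (rule sum.remove)
    ultimately show False using \<open>\<not> _ < 28\<close> fin x card_V n7 by simp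
  qed
  then have ex1: "\<exists>y. D x = {y}" if "x \<in> V" for x using that by (meson card_1_singletonE)
  define C where "C = {{x,y} |x y. x \<in> V \<and> y \<in> D x}"
  have D_sym: "y \<in> D x \<Longrightarrow> x \<in> V \<Longrightarrow> x \<in> D y \<and> y \<in> V \<and> x \<noteq> y" for x y using sym by (auto simp: D_def)
  have C_eq: "e = {x, y}" if "e \<in> C" "x \<in> e" "y \<in> D x" for e x y
  proof -
    obtain x' y' where xy: "e = {x',y'}" "x' \<in> V" "y' \<in> D x'" using \<open>e \<in> C\<close> by (auto simp: C_def)
    have "y' \<in> V" "x' \<in> D y'" using D_sym[OF xy(3,2)] by simp_all
    obtain d where d: "D x' = {d}" using ex1 xy by blast
    obtain d' where d': "D y' = {d'}" using ex1 \<open>y' \<in> V\<close> by blast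
    show ?thesis using xy d d' \<open>x' \<in> D y'\<close> that by (auto simp: insert_commute)
  qed
  have "2 * card C = card (\<Union>C)"
  proof (rule card_partition)
    have "C \<subseteq> Pow V" by (auto simp: C_def D_def)
    then show "finite C" "finite (\<Union>C)" using fin by (auto intro: finite_subset[of _ "Pow V"] finite_subset[of _ V])
    show "card e = 2" if "e \<in> C" for e using that by (auto simp: C_def D_def)
    show "e1 \<inter> e2 = {}" if e: "e1 \<in> C" "e2 \<in> C" "e1 \<noteq> e2" for e1 e2
    proof (rule ccontr)
      assume "e1 \<inter> e2 \<noteq> {}"
      then obtain x where x: "x \<in> e1" "x \<in> e2" by auto
      then have "x \<in> V" using e by (auto simp: C_def D_def)
      then obtain y where "y \<in> D x" using ex1 by blast
      then have "e1 = {x,y}" "e2 = {x,y}" using C_eq e x by blast+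
      then show False using e by simp
    qed
  qed
  moreover have "\<Union>C = V"
  proof
    show "\<Union>C \<subseteq> V" by (auto simp: C_def D_def)
    show "V \<subseteq> \<Union>C"
    proof
      fix x assume x: "x \<in> V"
      then obtain y where "y \<in> D x" using ex1 by blast
      then have "{x,y} \<in> C" using x by (auto simp: C_def)
      then show "x \<in> \<Union>C" by blast
    qed
  qed
  ultimately have "2 * card C = 7" using card_V n7 by simp
  then show False by presburger
qed

lemma s_sum_8: "n = 8 \<Longrightarrow> (\<Sum>x\<in>V. s x) \<le> 48"
proof -
  assume n8: "n = 8"
  have "s x \<le> 6" if "x \<in> V" for x using small_n_bounds[OF that] n8 by simp
  then have "(\<Sum>x\<in>V. s x) \<le> (\<Sum>x\<in>V. 6)" by (rule sum_mono)
  then show ?thesis using card_V n8 by simp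
qed

lemma crossing_bounds_inconsistent:
  assumes total: "4 * I \<le> (\<Sum>x\<in>V. s x)" and lower: "n choose 5 \<le> (n - 4) * I"
  shows False
proof -
  consider "n = 7" | "n = 8" | "n \<ge> 9" using n by linarith
  then show False
  proof cases
    case 1
    then have "I \<ge> 7" using lower by (simp add: eval_nat_numeral)
    then show False using s_sum_7[OF 1] total by simp
  next
    case 2
    then have "I \<ge> 14" using lower by (simp add: eval_nat_numeral)
    then show False using s_sum_8[OF 2] total by simp
  next
    case 3
    \<comment> \<open>Turns the truncated differences n - 1, ..., n - 4 into sums, so that the
      binomial coefficient can be expanded factor by factor.\<close>
    define k where "k = n - 9"
    have nk: "n = k + 9" using 3 by (simp add: k_def)
    have e: "5 * (k + 9 choose 5) = (k + 9) * (k + 8 choose 4)" "4 * (k + 8 choose 4) = (k + 8) * (k + 7 choose 3)"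
      "3 * (k + 7 choose 3) = (k + 7) * (k + 6 choose 2)" "2 * (k + 6 choose 2) = (k + 6) * (k + 5)"
      using times_binomial_minus1_eq[of 5 "k + 9"] times_binomial_minus1_eq[of 4 "k + 8"]
        times_binomial_minus1_eq[of 3 "k + 7"] times_binomial_minus1_eq[of 2 "k + 6"] by (auto simp: add.commute)
    have "120 * (k + 9 choose 5) = 24 * (5 * (k + 9 choose 5))" by simp
    also have "\<dots> = (k + 9) * (6 * (4 * (k + 8 choose 4)))" unfolding e(1) by simp
    also have "\<dots> = (k + 9) * ((k + 8) * (2 * (3 * (k + 7 choose 3))))" unfolding e(2) by simp
    also have "\<dots> = (k + 9) * ((k + 8) * ((k + 7) * (2 * (k + 6 choose 2))))" unfolding e(3) by simp
    also have "\<dots> = (k + 9) * ((k + 8) * ((k + 7) * ((k + 6) * (k + 5))))" unfolding e(4) ..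
    finally have "120 * (n choose 5) = n * ((n - 1) * ((n - 2) * ((n - 3) * (n - 4))))"
    proof -
      have "n - 1 = k + 8" "n - 2 = k + 7" "n - 3 = k + 6" "n - 4 = k + 5" using nk by auto
      then show "120 * (k + 9 choose 5) = (k + 9) * ((k + 8) * ((k + 7) * ((k + 6) * (k + 5)))) \<Longrightarrow> ?thesis"
        using nk by (simp only:)
    qed
    moreover have "120 * (n choose 5) \<le> 120 * ((n - 4) * I)" using lower by (rule mult_le_mono2)
    ultimately have "n * ((n - 1) * ((n - 2) * ((n - 3) * (n - 4)))) \<le> 120 * ((n - 4) * I)" by (simp only:)
    then have "(n - 4) * (n * (n - 1) * (n - 2) * (n - 3)) \<le> (n - 4) * (120 * I)" by (simp only: mult_ac)
    then have A: "n * (n - 1) * (n - 2) * (n - 3) \<le> 120 * I" using 3 by simp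
    have "4 * (n - 2) * (4 * I) \<le> 4 * (n - 2) * (\<Sum>x\<in>V. s x)" using total by (rule mult_le_mono2)
    then have "4 * (n - 2) * (4 * I) \<le> n * ((n - 1) * (n - 3)\<^sup>2)" using s_sum_le by (rule order_trans)
    then have "120 * (4 * (n - 2) * (4 * I)) \<le> 120 * (n * ((n - 1) * (n - 3)\<^sup>2))" by (rule mult_le_mono2)
    moreover have "16 * (n - 2) * (n * (n - 1) * (n - 2) * (n - 3)) \<le> 16 * (n - 2) * (120 * I)"
      using A by (rule mult_le_mono2)
    moreover have "16 * (n - 2) * (120 * I) = 120 * (4 * (n - 2) * (4 * I))" by simp
    ultimately have "16 * (n - 2) * (n * (n - 1) * (n - 2) * (n - 3)) \<le> 120 * (n * ((n - 1) * (n - 3)\<^sup>2))" by linarith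
    then have "(n * (n - 1) * (n - 3)) * (16 * (n - 2)\<^sup>2) \<le> (n * (n - 1) * (n - 3)) * (120 * (n - 3))"
      by (simp only: power2_eq_square mult_ac)
    \<comment> \<open>The threshold: for n = 9 this would read 784 at most 720, and the left side
      grows faster; for n = 8 it is true (576 and 600).\<close>
    then have "16 * (n - 2)\<^sup>2 \<le> 120 * (n - 3)" using 3 by simp
    then show False unfolding nk by (simp add: power2_eq_square algebra_simps)
  qed
qed

end

text \<open>\<open>van_Kampen_K5\<close> only yields a meeting with parameters in the closed
  interval. A parameter 0 or 1 would put a vertex on an edge that does not contain it, so the
  meeting is in the interior of both edges.\<close>

lemma K5_independent_crossing:
  assumes D: "drawing (complete_graph V) p \<gamma>" and S: "S \<in> nsets V 5"
  obtains u v w x s t where "{u,v,w,x} \<subseteq> S" "distinct [u,v,w,x]" "0 < s" "s < 1" "0 < t" "t < 1"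
    "\<gamma> {u,v} s = \<gamma> {w,x} t"
proof (rule ccontr)
  assume no: "\<not> thesis"
  have S': "S \<subseteq> V" "finite S" "card S = 5" using S by (auto simp: nsets_def)
  obtain xs where xs: "set xs = S" "distinct xs" using finite_distinct_list[OF S'(2)] by blast
  then have "length xs = 5" using distinct_card[of xs] S' by simp
  then obtain a b c d e where "xs = [a,b,c,d,e]"
    by (auto simp: numeral_eq_Suc length_Suc_conv)
  then have abcde: "distinct [a,b,c,d,e]" "S = {a,b,c,d,e}" using xs by auto
  \<comment> \<open>A drawing orients each edge in one arbitrary way; \<open>g u v\<close> is the
    edge traversed from \<open>u\<close> to \<open>v\<close>.\<close>
  define g where "g u v t = (if \<gamma> {u,v} 0 = p u then \<gamma> {u,v} t else \<gamma> {u,v} (1 - t))" for u v t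
  have edge: "path (\<gamma> {u,v}) \<and> (\<gamma> {u,v} 0 = p u \<and> \<gamma> {u,v} 1 = p v \<or> \<gamma> {u,v} 0 = p v \<and> \<gamma> {u,v} 1 = p u) \<and> p u \<noteq> p v"
    if "u \<in> S" "v \<in> S" "u \<noteq> v" for u v
  proof -
    have "{u,v} \<in> nsets V 2" using that S' by (auto simp: doubleton_in_nsets_2)
    then have 1: "path (\<gamma> {u,v})" "\<exists>x y. {u,v} = {x,y} \<and> \<gamma> {u,v} 0 = p x \<and> \<gamma> {u,v} 1 = p y"
      using D unfolding drawing_def complete_graph_def pathstart_def pathfinish_def by simp_all
    have "p u \<noteq> p v" using drawing_vertex_inj[OF D, of u v] that S' by (auto simp: complete_graph_def)
    then show ?thesis using 1 by (auto simp: doubleton_eq_iff)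
  qed
  have g_cases: "g u v = \<gamma> {u,v} \<or> g u v = reversepath (\<gamma> {u,v})" for u v
    by (auto simp: g_def reversepath_def fun_eq_iff)
  show False
  proof (rule van_Kampen_K5[OF abcde, of g p])
    fix u v assume uv: "u \<in> S" "v \<in> S" "u \<noteq> v"
    show "path (g u v)" using g_cases[of u v] edge[OF uv] by (auto simp: path_reversepath)
    show "g u v 0 = p u" "g u v 1 = p v" using edge[OF uv] by (auto simp: g_def)
    show "g v u t = g u v (1 - t)" for t using edge[OF uv] by (auto simp: g_def insert_commute)
  next
    fix u v w x and s t :: real
    assume H: "{u,v,w,x} \<subseteq> S" "distinct [u,v,w,x]" "s \<in> {0..1}" "t \<in> {0..1}"
    show "g u v s \<noteq> g w x t"
    proof
      assume eq: "g u v s = g w x t"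
      obtain s' where s': "s' \<in> {0..1}" "g u v s = \<gamma> {u,v} s'" 
        using H(3) by (intro that[of "if \<gamma> {u,v} 0 = p u then s else 1 - s"]) (auto simp: g_def)
      obtain t' where t': "t' \<in> {0..1}" "g w x t = \<gamma> {w,x} t'" 
        using H(4) by (intro that[of "if \<gamma> {w,x} 0 = p w then t else 1 - t"]) (auto simp: g_def)
      have ends: "\<gamma> {u,v} 0 \<in> p ` {u,v}" "\<gamma> {u,v} 1 \<in> p ` {u,v}" "\<gamma> {w,x} 0 \<in> p ` {w,x}" "\<gamma> {w,x} 1 \<in> p ` {w,x}"
        using edge[of u v] edge[of w x] H(1,2) by auto
      have avoid: "\<gamma> {u,v} s' \<notin> p ` {w,x}" "\<gamma> {w,x} t' \<notin> p ` {u,v}"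
        using drawing_edge_avoids_vertex[OF D, of "{u,v}" _ s'] drawing_edge_avoids_vertex[OF D, of "{w,x}" _ t'] s'(1) t'(1) H(1,2) S'(1)
        by (auto simp: complete_graph_def doubleton_in_nsets_2)
      have "s' \<noteq> 0" "s' \<noteq> 1" "t' \<noteq> 0" "t' \<noteq> 1"
        using ends avoid s' t' eq by auto
      then have "0 < s'" "s' < 1" "0 < t'" "t' < 1" using s'(1) t'(1) by auto
      then show False using no that[OF H(1,2), of s' t'] eq s'(2) t'(2) by simp
    qed
  qed
qed

lemma rank_bounds_not_all_satisfied:
  assumes D: "drawing (complete_graph V) p \<gamma>" and fin: "finite V" and n: "card V \<ge> 7"
    and le: "\<And>v0. v0 \<in> V \<Longrightarrow> \<exists>u. inj_on u (V - {v0}) \<and> (\<forall>w\<in>V - {v0}. cmod (u w) = 1) \<and>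
      (\<forall>a\<in>V - {v0}. \<forall>b\<in>V - {v0}. a \<noteq> b \<longrightarrow>
        card {z \<in> multiple_points (complete_graph V) p \<gamma>. \<exists>t. 0 < t \<and> t < 1 \<and> \<gamma> {a,b} t = z} \<le> ccw_rank u (V - {v0}) a b)"
  shows False
proof -
  let ?G = "complete_graph V"
  let ?M = "multiple_points ?G p \<gamma>"
  define n where "n = card V"
  \<comment> \<open>The crossings of disjoint edges, with the whole fibre recorded so that the point
    determines its two edges.\<close>
  define I where "I = {z \<in> ?M. \<exists>e\<in>nsets V 2. \<exists>f\<in>nsets V 2. \<exists>s t. e \<inter> f = {} \<and> 0 < s \<and> s < 1 \<and> 0 < t \<and> t < 1 \<and> \<gamma> e s = z \<and> \<gamma> f t = z \<and>
     fibre ?G p \<gamma> z = {Inner e s, Inner f t}}"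
  define Q where "Q = (\<lambda>(x, y) z. \<exists>t. 0 < t \<and> t < 1 \<and> \<gamma> {x,y} t = z)"
  define c where "c x y = card {z \<in> I. Q (x, y) z}" for x y
  have finM: "finite ?M" using D by (simp add: drawing_def)
  then have finI: "finite I" by (simp add: I_def)
  have c_le: "c a b \<le> card {z \<in> ?M. \<exists>t. 0 < t \<and> t < 1 \<and> \<gamma> {a,b} t = z}" for a b
    unfolding c_def Q_def using finM by (intro card_mono) (auto simp: I_def)
  interpret rank_bounds V c n
  proof
    show "finite V" "card V = n" "7 \<le> n" using fin n by (simp_all add: n_def)
    show "c x y = c y x" for x y by (simp add: c_def Q_def insert_commute)
    fix v assume v: "v \<in> V"
    obtain u where U: "inj_on u (V - {v}) \<and> (\<forall>w\<in>V - {v}. cmod (u w) = 1) \<and>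
      (\<forall>a\<in>V - {v}. \<forall>b\<in>V - {v}. a \<noteq> b \<longrightarrow>
        card {z \<in> ?M. \<exists>t. 0 < t \<and> t < 1 \<and> \<gamma> {a,b} t = z} \<le> ccw_rank u (V - {v}) a b)"
      using le[OF v] by (rule exE)
    then have u: "inj_on u (V - {v})" "\<And>w. w \<in> V - {v} \<Longrightarrow> cmod (u w) = 1" by simp_all
    have b: "\<And>a b. a \<in> V - {v} \<Longrightarrow> b \<in> V - {v} \<Longrightarrow> a \<noteq> b \<Longrightarrow>
        card {z \<in> ?M. \<exists>t. 0 < t \<and> t < 1 \<and> \<gamma> {a,b} t = z} \<le> ccw_rank u (V - {v}) a b"
      using U by simp
    have fW: "finite (V - {v})" and cW: "card (V - {v}) = n - 1" using fin v by (simp_all add: n_def)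
    show "\<exists>N. \<forall>x\<in>V - {v}. bij_betw (N x) (V - {v,x}) {..<n - 2} \<and>
      (\<forall>y\<in>V - {v,x}. c x y \<le> N x y \<and> c x y + N x y \<le> n - 3)"
    proof (intro exI[of _ "ccw_rank u (V - {v})"] ballI conjI)
      fix x assume x: "x \<in> V - {v}"
      have e: "V - {v} - {x} = V - {v,x}" by auto
      show "bij_betw (ccw_rank u (V - {v}) x) (V - {v,x}) {..<n - 2}"
        using bij_betw_ccw_rank[OF fW u x] unfolding e cW by (simp add: numeral_2_eq_2)
      fix y assume y: "y \<in> V - {v,x}"
      then have y': "y \<in> V - {v}" "x \<noteq> y" by auto
      show 1: "c x y \<le> ccw_rank u (V - {v}) x y" using c_le b[OF x y'] by (rule order_trans)
      \<comment> \<open>The bound for the exchanged pair \<open>y\<close>, \<open>x\<close> is the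
        one from the complementary sector.\<close>
      have "c x y \<le> ccw_rank u (V - {v}) y x"
        using c_le[of y x] b[OF y'(1) x] y'(2) by (simp add: c_def Q_def insert_commute)
      moreover have "ccw_rank u (V - {v}) x y + ccw_rank u (V - {v}) y x = n - 3"
        using ccw_rank_add[OF fW u x y'] unfolding cW by simp
      ultimately show "c x y + ccw_rank u (V - {v}) x y \<le> n - 3" by linarith
    qed
  qed
  show False
  proof (rule crossing_bounds_inconsistent)
    define P where "P = (SIGMA x:V. V - {x})"
    have finP: "finite P" using fin by (simp add: P_def)
    have "(\<Sum>x\<in>V. s x) = (\<Sum>x\<in>V. \<Sum>y\<in>V - {x}. card {z \<in> I. Q (x, y) z})" by (simp add: s_def c_def)
    also have "\<dots> = (\<Sum>i\<in>P. card {z \<in> I. Q i z})"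
      unfolding P_def using fin by (subst sum.Sigma) (auto simp: case_prod_unfold)
    also have "\<dots> = (\<Sum>z\<in>I. card {i \<in> P. Q i z})"
      using finP finI by (intro sum_multicount_gen) auto
    \<comment> \<open>Each point of \<open>I\<close> lies on two disjoint edges, and each of them
      occurs as two ordered pairs.\<close>
    also have "\<dots> \<ge> (\<Sum>z\<in>I. 4)"
    proof (rule sum_mono)
      fix z assume "z \<in> I"
      then obtain e f s t where ef: "e \<in> nsets V 2" "f \<in> nsets V 2" "e \<inter> f = {}" "0 < s" "s < 1" "0 < t" "t < 1" "\<gamma> e s = z" "\<gamma> f t = z"
        unfolding I_def by blast
      obtain x y where xy: "e = {x,y}" "x \<in> V" "y \<in> V" "x \<noteq> y" using ef(1) by (rule nsets2_E)
      obtain x' y' where xy': "f = {x',y'}" "x' \<in> V" "y' \<in> V" "x' \<noteq> y'" using ef(2) by (rule nsets2_E)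
      have "{(x,y),(y,x),(x',y'),(y',x')} \<subseteq> {i \<in> P. Q i z}"
        using ef xy xy' by (auto simp: P_def Q_def insert_commute)
      then have "card {(x,y),(y,x),(x',y'),(y',x')} \<le> card {i \<in> P. Q i z}" using finP by (intro card_mono) auto
      moreover have "card {(x,y),(y,x),(x',y'),(y',x')} = 4" using ef(3) xy xy' by (auto simp: card_insert_if)
      ultimately show "4 \<le> card {i \<in> P. Q i z}" by simp
    qed
    finally show "4 * card I \<le> (\<Sum>x\<in>V. s x)" by simp
    \<comment> \<open>\<open>A z\<close> will be the set of the four ends of the edges that cross at
      \<open>z\<close>.\<close>
    have "\<exists>A. A \<subseteq> V \<and> card A = 4 \<and> (\<forall>e f s t. fibre ?G p \<gamma> z = {Inner e s, Inner f t} \<longrightarrow> e \<union> f = A)" if zI: "z \<in> I" for z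
    proof -
      obtain e f s t where ef: "e \<in> nsets V 2" "f \<in> nsets V 2" "e \<inter> f = {}" "fibre ?G p \<gamma> z = {Inner e s, Inner f t}"
        using zI unfolding I_def by blast
      have "card (e \<union> f) = 4" "e \<union> f \<subseteq> V" using ef by (auto simp: nsets_def card_Un_disjoint)
      moreover have "e' \<union> f' = e \<union> f" if "fibre ?G p \<gamma> z = {Inner e' s', Inner f' t'}" for e' f' s' t'
      proof -
        have "{Inner e' s', Inner f' t'} = {Inner e s, Inner f t}" using that ef(4) by simp
        then show ?thesis by (auto simp: doubleton_eq_iff)
      qed
      ultimately show ?thesis by blast
    qed
    then obtain A where A: "\<And>z. z \<in> I \<Longrightarrow> A z \<subseteq> V \<and> card (A z) = 4 \<and> (\<forall>e f s t. fibre ?G p \<gamma> z = {Inner e s, Inner f t} \<longrightarrow> e \<union> f = A z)"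
      by metis
    \<comment> \<open>Every five vertices contain the four ends \<open>A z\<close> of some crossing,
      and a given \<open>A z\<close> lies in only n - 4 sets of five; hence the factor n - 4 in the
      lower bound.\<close>
    have "nsets V 5 \<subseteq> (\<Union>z\<in>I. (\<lambda>x. insert x (A z)) ` (V - A z))"
    proof
      fix S assume S: "S \<in> nsets V 5"
      obtain u v w x s t where H: "{u,v,w,x} \<subseteq> S" "distinct [u,v,w,x]" "0 < s" "s < 1" "0 < t" "t < 1" "\<gamma> {u,v} s = \<gamma> {w,x} t"
        using K5_independent_crossing[OF D S] .
      have S': "S \<subseteq> V" "finite S" "card S = 5" using S by (auto simp: nsets_def)
      define z where "z = \<gamma> {u,v} s"
      have e: "{u,v} \<in> nsets V 2" "{w,x} \<in> nsets V 2" using H(1,2) S' by (auto simp: doubleton_in_nsets_2)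
      then have in_f: "Inner {u,v} s \<in> fibre ?G p \<gamma> z" "Inner {w,x} t \<in> fibre ?G p \<gamma> z"
        using H by (auto simp: Inner_in_fibre_iff complete_graph_def z_def)
      have ne: "Inner {u,v} s \<noteq> Inner {w,x} t" using H(2) by (auto simp: doubleton_eq_iff)
      have zM: "z \<in> ?M" using in_f ne by (rule multiple_pointsI)
      then have "transversal_double_point ?G p \<gamma> z" using D by (simp add: drawing_def)
      then obtain e' s' f' t' where "fibre ?G p \<gamma> z = {Inner e' s', Inner f' t'}"
        unfolding transversal_double_point_def by blast
      then have fib: "fibre ?G p \<gamma> z = {Inner {u,v} s, Inner {w,x} t}" using in_f ne by auto
      have d: "{u,v} \<inter> {w,x} = {}" using H(2) by auto
      have z: "\<gamma> {u,v} s = z" "\<gamma> {w,x} t = z" using H(7) by (simp_all add: z_def)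
      have "z \<in> I"
        unfolding I_def
        by (intro CollectI conjI zM bexI[OF _ e(1)] bexI[OF _ e(2)] exI[of _ s] exI[of _ t]) (fact d z fib H(3-6))+
      have Az: "A z = {u,v} \<union> {w,x}" "card (A z) = 4" using A[OF \<open>z \<in> I\<close>] fib by (metis, metis)
      then have sub: "A z \<subseteq> S" using H(1) by auto
      have "card (S - A z) = 1" using sub Az(2) S' by (simp add: card_Diff_subset finite_subset)
      then obtain y where y: "S - A z = {y}" by (auto simp: card_1_singleton_iff)
      then have "S = insert y (A z)" "y \<in> V - A z" using sub S' by auto
      then show "S \<in> (\<Union>z\<in>I. (\<lambda>x. insert x (A z)) ` (V - A z))" using \<open>z \<in> I\<close> by blast
    qed
    then have "card (nsets V 5) \<le> card (\<Union>z\<in>I. (\<lambda>x. insert x (A z)) ` (V - A z))"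
      using finI fin by (intro card_mono) auto
    also have "\<dots> \<le> (\<Sum>z\<in>I. card ((\<lambda>x. insert x (A z)) ` (V - A z)))" using finI by (rule card_UN_le)
    also have "\<dots> \<le> (\<Sum>z\<in>I. n - 4)"
    proof (rule sum_mono)
      fix z assume z: "z \<in> I"
      have "card ((\<lambda>x. insert x (A z)) ` (V - A z)) \<le> card (V - A z)" using fin by (intro card_image_le) simp
      also have "\<dots> = n - 4"
      proof -
        have "A z \<subseteq> V" "card (A z) = 4" using A[OF z] by auto
        then show ?thesis using finite_subset[OF _ fin] by (simp add: card_Diff_subset n_def)
      qed
      finally show "card ((\<lambda>x. insert x (A z)) ` (V - A z)) \<le> n - 4" .
    qed
    finally show "n choose 5 \<le> (n - 4) * card I" by (simp add: card_nsets n_def mult.commute)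
  qed
qed

theorem theorem1:
  fixes V :: "'a set" and G :: "'a ugraph" and n :: nat
  assumes "n \<ge> 7"
    and "finite V" and "card V = n"
    and "delta_Y_move (complete_graph V) G"
  shows "crossing_number G < crossing_number (complete_graph V)"
proof (rule ccontr)
  assume not_less: "\<not> crossing_number G < crossing_number (complete_graph V)"
  let ?K = "complete_graph V"
  let ?C = "{enat (card (multiple_points ?K p \<gamma>)) |p \<gamma>. drawing ?K p \<gamma>}"
  have "?C \<noteq> {}" using straight_line_drawing_exists[OF assms(2)] by blast
  \<comment> \<open>Extended naturals are well-ordered, so the infimum is attained; one optimal
    drawing serves for all \<open>v0\<close>, \<open>a\<close> and \<open>b\<close>.\<close>
  then have "Inf ?C \<in> ?C" by (metis (no_types, lifting) Inf_enat_def LeastI_ex ex_in_conv)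
  then obtain p \<gamma> where D: "drawing ?K p \<gamma>" and min: "crossing_number ?K = enat (card (multiple_points ?K p \<gamma>))"
    unfolding crossing_number_def by blast
  obtain v1 v2 v3 v where vs: "distinct [v1, v2, v3]" "{v1, v2, v3} \<subseteq> V" "v \<notin> V"
    and G: "G = (insert v V, (nsets V 2 - {{v1,v2},{v2,v3},{v3,v1}}) \<union> {{v,v1},{v,v2},{v,v3}})"
    using assms(4) unfolding delta_Y_move_def complete_graph_def by auto
  show False
  proof (rule rank_bounds_not_all_satisfied[OF D assms(2)])
    show "7 \<le> card V" using assms by simp
    fix v0 assume v0: "v0 \<in> V"
    show "\<exists>u. inj_on u (V - {v0}) \<and> (\<forall>w\<in>V - {v0}. cmod (u w) = 1) \<and>
      (\<forall>a\<in>V - {v0}. \<forall>b\<in>V - {v0}. a \<noteq> b \<longrightarrow>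
        card {z \<in> multiple_points ?K p \<gamma>. \<exists>t. 0 < t \<and> t < 1 \<and> \<gamma> {a,b} t = z} \<le> ccw_rank u (V - {v0}) a b)"
    proof (rule crossing_number_split[OF D assms(2) v0])
      fix u assume u: "inj_on u (V - {v0})" "\<And>w. w \<in> V - {v0} \<Longrightarrow> cmod (u w) = 1"
        and split: "\<And>a b v. a \<in> V - {v0} \<Longrightarrow> b \<in> V - {v0} \<Longrightarrow> a \<noteq> b \<Longrightarrow> v \<notin> V \<Longrightarrow>
        \<exists>k. crossing_number (insert v V, (nsets V 2 - {{v0,a},{a,b},{b,v0}}) \<union> {{v,v0},{v,a},{v,b}}) \<le> enat k \<and>
          k + card {z \<in> multiple_points ?K p \<gamma>. \<exists>t. 0 < t \<and> t < 1 \<and> \<gamma> {a,b} t = z}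
          \<le> card (multiple_points ?K p \<gamma>) + ccw_rank u (V - {v0}) a b"
      have "card {z \<in> multiple_points ?K p \<gamma>. \<exists>t. 0 < t \<and> t < 1 \<and> \<gamma> {a,b} t = z} \<le> ccw_rank u (V - {v0}) a b"
        if ab: "a \<in> V - {v0}" "b \<in> V - {v0}" "a \<noteq> b" for a b
      proof -
        obtain k where k: "crossing_number (insert v V, (nsets V 2 - {{v0,a},{a,b},{b,v0}}) \<union> {{v,v0},{v,a},{v,b}}) \<le> enat k"
          "k + card {z \<in> multiple_points ?K p \<gamma>. \<exists>t. 0 < t \<and> t < 1 \<and> \<gamma> {a,b} t = z}
          \<le> card (multiple_points ?K p \<gamma>) + ccw_rank u (V - {v0}) a b"
          using split[OF ab vs(3)] by blast
        \<comment> \<open>A counterexample has at least as many crossings as the optimal drawing of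
          \<open>?K\<close>, and so has the split drawing, since its triangle is equivalent. What
          the split removes is therefore at most what it adds.\<close>
        have "enat (card (multiple_points ?K p \<gamma>)) \<le> crossing_number G" using not_less min by simp
        also have "\<dots> \<le> crossing_number (insert v V, (nsets V 2 - {{v0,a},{a,b},{b,v0}}) \<union> {{v,v0},{v,a},{v,b}})"
          unfolding G by (rule crossing_number_delta_Y_le[OF vs(1,2) _ _ vs(3)]) (use ab v0 in auto)
        also note k(1)
        finally have "card (multiple_points ?K p \<gamma>) \<le> k" by simp
        then show ?thesis using k(2) by linarith
      qed
      then show ?thesis using u by (intro exI[of _ u]) simp
    qed
  qed
qed

end
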